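(* Let $1\le k\le n$, $s\in(-1,\infty)$, $\delta\in(0,1)$, and let $\Omega\subset\mathbb{R}^n$ be a strictly $(k-1)$-convex bounded domain containing the origin with boundary $\partial\Omega\in C^3$. Let $f$ be a nonnegative Lipschitz continuous function on $\overline\Omega\times\mathbb{R}$, and let $u\in C^3(\Omega)\cap C^1(\overline\Omega)$ be a $k$-admissible solution of $$S_k(D^2u)=\big[(|x|^2+\delta^2)^sf(x,u)\big]^k\quad\text{in }\Omega$$ with $u=\varphi$ on $\partial\Omega$, where $\varphi\in C^{1,1}(\partial\Omega)$. Suppose $K$ is a constant with $\sup_\Omega|x||Du(x)|\le K$. Then there exists $\alpha\in(0,1)$ independent of $\delta$ such that $$\|u\|_{C^{\alpha}(\overline\Omega)}\le C,$$ where $C$ depends on $n,k,s,\Omega,\|u\|_{L^\infty(\Omega)},f$ and $K$.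
   Context: For a symmetric matrix $A$ with eigenvalues $\lambda(A)$, $S_k(A)=\sigma_k(\lambda(A))$, $\sigma_k(\lambda)=\sum_{i_1<\cdots<i_k}\lambda_{i_1}\cdots\lambda_{i_k}$. $\Gamma_k=\{\lambda\in\mathbb{R}^n:\sigma_j(\lambda)>0,\ j=1,\dots,k\}$. A function $u\in C^2(\Omega)\cap C^0(\overline\Omega)$ is $k$-admissible if $\lambda(D^2u(x))\in\overline{\Gamma}_k$ for all $x\in\Omega$. A bounded $C^2$ domain is strictly $(k-1)$-convex if there is $K_0>0$ with $(\kappa_1(x),\dots,\kappa_{n-1}(x),K_0)\in\Gamma_k$ for all $x\in\partial\Omega$, $\kappa_i$ the principal curvatures of $\partial\Omega$ with respect to the inner normal. *)

theory Defs
  imports "HOL-Analysis.Analysis" "HOL-Computational_Algebra.Polynomial"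
begin

definition pd :: "'n::finite \<Rightarrow> (real^'n \<Rightarrow> real) \<Rightarrow> real^'n \<Rightarrow> real" where
  "pd i u x = frechet_derivative u (at x) (axis i 1)"

definition grad :: "(real^'n::finite \<Rightarrow> real) \<Rightarrow> real^'n \<Rightarrow> real^'n" where
  "grad u x = (\<chi> i. pd i u x)"

definition hess :: "(real^'n::finite \<Rightarrow> real) \<Rightarrow> real^'n \<Rightarrow> real^'n^'n" where
  "hess u x = (\<chi> i j. pd i (pd j u) x)"

fun Ck_on :: "nat \<Rightarrow> (real^'n::finite) set \<Rightarrow> (real^'n \<Rightarrow> real) \<Rightarrow> bool" where
  "Ck_on 0 S u = continuous_on S u"
| "Ck_on (Suc m) S u = ((\<forall>x\<in>S. u differentiable (at x)) \<and> (\<forall>i. Ck_on m S (pd i u)))"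

definition C1_closure :: "(real^'n::finite) set \<Rightarrow> (real^'n \<Rightarrow> real) \<Rightarrow> bool" where
  "C1_closure \<Omega> u \<longleftrightarrow> continuous_on (closure \<Omega>) u \<and> Ck_on 1 \<Omega> u \<and>
     (\<exists>g. continuous_on (closure \<Omega>) g \<and> (\<forall>x\<in>\<Omega>. g x = grad u x))"

definition C11_on_boundary :: "(real^'n::finite) set \<Rightarrow> (real^'n \<Rightarrow> real) \<Rightarrow> bool" where
  "C11_on_boundary \<Omega> \<phi> \<longleftrightarrow> (\<exists>\<Phi>. Ck_on 1 UNIV \<Phi> \<and> (\<exists>L. L-lipschitz_on UNIV (grad \<Phi>)) \<and>
      (\<forall>x\<in>frontier \<Omega>. \<Phi> x = \<phi> x))"

definition sigma :: "nat \<Rightarrow> real^'n::finite \<Rightarrow> real" where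
  "sigma k l = (\<Sum>I\<in>{I. card I = k}. \<Prod>i\<in>I. l $ i)"

definition Gamma :: "nat \<Rightarrow> (real^'n::finite) set" where
  "Gamma k = {l. \<forall>j\<in>{1..k}. sigma j l > 0}"

definition charpoly :: "real^'n^'n::finite \<Rightarrow> real poly" where
  "charpoly A = det (\<chi> i j. (if i = j then [:0, 1:] else 0) - [: A $ i $ j :])"

text \<open>The eigenvalues (with multiplicity, in some order) of a matrix whose characteristic
  polynomial splits over the reals (e.g. a symmetric matrix).\<close>
definition eigvals :: "real^'n^'n::finite \<Rightarrow> real^'n" where
  "eigvals A = (SOME l. charpoly A = (\<Prod>i\<in>UNIV. [: - (l $ i), 1 :]))"

definition Sk :: "nat \<Rightarrow> real^'n^'n::finite \<Rightarrow> real" where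
  "Sk k A = sigma k (eigvals A)"

definition k_admissible :: "nat \<Rightarrow> (real^'n::finite) set \<Rightarrow> (real^'n \<Rightarrow> real) \<Rightarrow> bool" where
  "k_admissible k \<Omega> u \<longleftrightarrow> Ck_on 2 \<Omega> u \<and> continuous_on (closure \<Omega>) u \<and>
     (\<forall>x\<in>\<Omega>. eigvals (hess u x) \<in> closure (Gamma k))"

text \<open>At x0 on the boundary, with unit inner normal nu, the domain is locally
  {x. (x - x0) . nu > rho (x - x0)} where rho depends only on the tangential component,
  rho 0 = 0, grad rho 0 = 0 and rho is C^m.  The principal curvatures (w.r.t. the inner
  normal) are the eigenvalues kappa_i of the Hessian of rho at 0 on the tangent hyperplane,
  given by an orthonormal eigenbasis b with b i0 = nu.\<close>
definition boundary_chart :: "nat \<Rightarrow> (real^'n::finite) set \<Rightarrow> real^'n \<Rightarrow> real^'n \<Rightarrow>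
    (real^'n \<Rightarrow> real) \<Rightarrow> bool" where
  "boundary_chart m \<Omega> x0 \<nu> \<rho> \<longleftrightarrow> norm \<nu> = 1 \<and>
     (\<exists>r>0. Ck_on m (ball 0 r) \<rho> \<and>
        (\<forall>x\<in>ball x0 r. x \<in> \<Omega> \<longleftrightarrow> (x - x0) \<bullet> \<nu> > \<rho> (x - x0))) \<and>
     (\<forall>y. \<rho> y = \<rho> (y - (y \<bullet> \<nu>) *\<^sub>R \<nu>)) \<and> \<rho> 0 = 0 \<and> grad \<rho> 0 = 0"

definition principal_curvatures :: "real^'n::finite \<Rightarrow> (real^'n \<Rightarrow> real) \<Rightarrow>
    ('n \<Rightarrow> real^'n) \<Rightarrow> 'n \<Rightarrow> real^'n \<Rightarrow> bool" where
  "principal_curvatures \<nu> \<rho> b i0 \<kappa> \<longleftrightarrow>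
     (\<forall>i j. b i \<bullet> b j = (if i = j then 1 else 0)) \<and> b i0 = \<nu> \<and>
     (\<forall>i. i \<noteq> i0 \<longrightarrow> hess \<rho> 0 *v b i = \<kappa> $ i *\<^sub>R b i)"

definition C3_boundary :: "(real^'n::finite) set \<Rightarrow> bool" where
  "C3_boundary \<Omega> \<longleftrightarrow> (\<forall>x0\<in>frontier \<Omega>. \<exists>\<nu> \<rho>. boundary_chart 3 \<Omega> x0 \<nu> \<rho>)"

definition strictly_k1_convex :: "nat \<Rightarrow> (real^'n::finite) set \<Rightarrow> bool" where
  "strictly_k1_convex k \<Omega> \<longleftrightarrow> (\<exists>K0>0. \<forall>x0\<in>frontier \<Omega>. \<exists>\<nu> \<rho>. boundary_chart 2 \<Omega> x0 \<nu> \<rho> \<and>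
      (\<exists>b i0 \<kappa>. principal_curvatures \<nu> \<rho> b i0 \<kappa> \<and>
         (\<chi> i. if i = i0 then K0 else \<kappa> $ i) \<in> Gamma k))"

definition hoelder_norm :: "real \<Rightarrow> (real^'n::finite) set \<Rightarrow> (real^'n \<Rightarrow> real) \<Rightarrow> ereal" where
  "hoelder_norm \<alpha> S u = (SUP x\<in>S. ereal \<bar>u x\<bar>) +
     (SUP p\<in>{(x, y). x \<in> S \<and> y \<in> S \<and> x \<noteq> y}.
        ereal (\<bar>u (fst p) - u (snd p)\<bar> / dist (fst p) (snd p) powr \<alpha>))"

end

theory Submission
  imports Defs "HOL-Computational_Algebra.Fundamental_Theorem_Algebra"
begin

text \<open>
  Away from the origin the bound \<open>|x| |Du| \<le> K\<close> is a Lipschitz bound, so only a Hoelder bound near the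
  origin is at stake. If \<open>2 k > n\<close>, it holds for every bounded \<open>k\<close>-admissible function, because
  \<open>|x - y|\<^sup>\<beta>\<close> with \<open>\<beta> < 2 - n / k\<close> cannot touch such a function from above. If \<open>2 k \<le> n\<close>, then
  \<open>b(x) = (|x|\<^sup>2 + \<delta>\<^sup>2)\<^bsup>\<beta>/2\<^esup>\<close> is strictly \<open>k\<close>-admissible for every \<open>\<beta> > 0\<close>, and for
  \<open>\<beta> \<le> 2 + 2 s\<close> the function \<open>u + N b(\<cdot> + h)\<close> is a strict subsolution of the equation solved by
  \<open>u(\<cdot> + h)\<close>. Comparison in the ball of radius \<open>|h|\<^bsup>1/2\<^esup>\<close>, on whose boundary the gradient bound gives
  \<open>|u(x + h) - u(x)| \<le> 2 K |h|\<^bsup>1/2\<^esup>\<close>, yields the Hoelder exponent \<open>\<beta> / 2\<close>.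

  The only facts about \<open>S\<^sub>k\<close> needed are that the cone \<open>S\<^sub>1, \<dots>, S\<^sub>k \<ge> 0\<close> is stable under adding a positive
  semidefinite matrix or \<open>I - \<gamma> e e\<^sup>T\<close> with \<open>\<gamma> |e|\<^sup>2 \<le> n / k\<close>. As \<open>S\<^sub>k\<close> is affine along rank-one
  perturbations, both reduce to inequalities between elementary symmetric functions of the eigenvalues,
  which follow from the real-rootedness of \<open>t \<mapsto> \<sigma>\<^sub>k(\<lambda> + t)\<close>.
\<close>

section \<open>Real-rooted polynomials\<close>

text \<open>The cases meet at \<open>2 k = n\<close> because the Hessian of
  \<open>|x|^\<beta>\<close> is a positive multiple of \<open>I - (2 - \<beta>) e e^T\<close> with
  \<open>|e| = 1\<close>, and \<open>S_k (I - \<gamma> e e^T)\<close> changes sign exactly at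
  \<open>\<gamma> = n / k\<close>: for every \<open>\<beta> > 0\<close> the barrier lies inside the
  cone if \<open>n / k \<ge> 2\<close>, while for small \<open>\<beta>\<close> it lies outside if
  \<open>n / k < 2\<close>. The obstacle is uniformity in \<delta>, since for small \<delta> the
  weight of the equation may degenerate or blow up at the origin. The barrier is built from the same
  quantity \<open>\<rho> = |x|^2 + \<delta>^2\<close>; its Hessian has size
  \<open>\<rho>^(\<beta>/2 - 1)\<close>, which on a bounded set dominates \<open>\<rho>^s\<close> up
  to a constant when \<open>\<beta> \<le> 2 + 2 s\<close>. Only its oscillation enters the
  comparison, so its minimum \<open>\<delta>^\<beta>\<close> cancels. The radius
  \<open>|h|^(1/2)\<close> is a compromise: at distance \<open>r\<close> from the origin the
  gradient bound costs \<open>K |h| / r\<close>, while the barrier oscillates by a multiple of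
  \<open>r^\<beta>\<close> over the ball; with \<open>r = |h|^(1/2)\<close> both are powers of
  \<open>|h|\<close>.\<close>

definition lin_prod :: "'a::comm_ring_1 list \<Rightarrow> 'a poly" where
  "lin_prod rs = prod_list (map (\<lambda>r. [:- r, 1:]) rs)"

lemma lin_prod_simps [simp]:
  "lin_prod [] = 1" "lin_prod (r # rs) = [:- r, 1:] * lin_prod rs"
  by (simp_all add: lin_prod_def)

lemma poly_lin_prod_eq_0_iff: "poly (lin_prod rs) x = 0 \<longleftrightarrow> x \<in> set rs"
  for x :: "'a::idom"
  by (induction rs) auto

lemma lin_prod_neq_0 [simp]: "lin_prod rs \<noteq> (0 :: 'a::idom poly)"
  by (induction rs) (auto simp del: mult_pCons_left)

lemma degree_lin_prod [simp]: "degree (lin_prod rs :: 'a::idom poly) = length rs"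
  by (induction rs) (auto simp: degree_mult_eq simp del: mult_pCons_left)

lemma lead_coeff_lin_prod [simp]: "lead_coeff (lin_prod rs :: 'a::idom poly) = 1"
  by (induction rs) (auto simp: lead_coeff_mult simp del: mult_pCons_left degree_lin_prod)

lemma pderiv_lin_prod_Cons:
  "pderiv (lin_prod (r # rs)) = lin_prod rs + [:- r, 1:] * pderiv (lin_prod rs :: 'a::idom poly)"
proof -
  have "pderiv [:- r, 1:] = 1" by (simp add: pderiv_pCons)
  then show ?thesis by (simp only: lin_prod_simps pderiv_mult) simp
qed

lemma pderiv_lin_prod:
  fixes x :: "'a::field"
  assumes "x \<notin> set rs"
  shows "poly (pderiv (lin_prod rs)) x = poly (lin_prod rs) x * (\<Sum>r\<leftarrow>rs. 1 / (x - r))"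
  using assms
proof (induction rs)
  case (Cons r rs)
  then show ?case
    by (simp add: pderiv_lin_prod_Cons field_simps del: lin_prod_simps(2)) (simp add: field_simps)
qed simp

text \<open>Laguerre's inequality. Away from the roots it is Cauchy-Schwarz for the sum of
  \<open>1 / (x - r)\<close>; induction on the roots avoids the division, so that \<open>x\<close>
  may itself be a root.\<close>

lemma laguerre_lin_prod:
  fixes x :: real
  shows "(poly (pderiv (lin_prod rs)) x)\<^sup>2 \<le> real (length rs) *
    ((poly (pderiv (lin_prod rs)) x)\<^sup>2 - poly (lin_prod rs) x * poly (pderiv (pderiv (lin_prod rs))) x)"
proof (induction rs)
  case (Cons r rs)
  define h h' h'' y k where "h = poly (lin_prod rs) x" and "h' = poly (pderiv (lin_prod rs)) x"
    and "h'' = poly (pderiv (pderiv (lin_prod rs))) x" and "y = x - r" and "k = real (length rs)"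
  define D where "D = h'\<^sup>2 - h * h''"
  have IH: "h'\<^sup>2 \<le> k * D"
    using Cons by (simp add: h_def h'_def h''_def k_def D_def)
  have e1: "poly (pderiv (lin_prod (r # rs))) x = h + y * h'"
    by (simp add: pderiv_lin_prod_Cons h_def h'_def y_def algebra_simps del: lin_prod_simps(2))
  have "pderiv [:- r, 1:] = 1" by (simp add: pderiv_pCons)
  then have pp: "pderiv (pderiv (lin_prod (r # rs)))
      = 2 * pderiv (lin_prod rs) + [:- r, 1:] * pderiv (pderiv (lin_prod rs))"
    by (simp only: pderiv_lin_prod_Cons pderiv_add pderiv_mult)
  have e2: "poly (pderiv (pderiv (lin_prod (r # rs)))) x = 2 * h' + y * h''"
    unfolding pp by (simp add: h_def h'_def h''_def y_def algebra_simps)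
  have e0: "poly (lin_prod (r # rs)) x = y * h"
    by (simp add: h_def y_def algebra_simps)
  have *: "(h + y * h')\<^sup>2 \<le> (k + 1) * (h\<^sup>2 + y\<^sup>2 * D)"
  proof (cases "rs = []")
    case True
    then show ?thesis by (simp add: h_def h'_def h''_def D_def k_def)
  next
    case False
    then have k: "k > 0" by (simp add: k_def)
    \<comment> \<open>Completing the square leaves a nonnegative multiple of the induction
      hypothesis.\<close>
    have "k * ((k + 1) * (h\<^sup>2 + y\<^sup>2 * D) - (h + y * h')\<^sup>2)
        = (k * h - y * h')\<^sup>2 + (k + 1) * (y\<^sup>2 * (k * D - h'\<^sup>2))"
      by (simp add: power2_eq_square algebra_simps)
    also have "\<dots> \<ge> 0"
      using IH k by auto
    finally show ?thesis
      using k by (simp add: zero_le_mult_iff)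
  qed
  have "(h + y * h')\<^sup>2 - (y * h) * (2 * h' + y * h'') = h\<^sup>2 + y\<^sup>2 * D"
    by (simp add: D_def power2_eq_square algebra_simps)
  then show ?case
    unfolding e0 e1 e2 using * by (simp add: k_def add.commute)
qed simp

section \<open>Splitting over the reals and its stability under differentiation\<close>

abbreviation cpoly :: "real poly \<Rightarrow> complex poly" where
  "cpoly \<equiv> map_poly of_real"

lemma cpoly_mult: "cpoly (p * q) = cpoly p * cpoly q"
  by (intro poly_eqI) (simp add: coeff_map_poly coeff_mult)

lemma cpoly_pderiv: "cpoly (pderiv p) = pderiv (cpoly p)"
  by (intro poly_eqI) (simp add: coeff_map_poly coeff_pderiv)

lemma cpoly_lin_prod: "cpoly (lin_prod rs) = lin_prod (map of_real rs)"
  by (induction rs) (simp_all add: cpoly_mult map_poly_pCons del: mult_pCons_left)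

lemma poly_cpoly_of_real: "poly (cpoly p) (of_real x) = of_real (poly p x)"
  by (induction p) (simp_all add: map_poly_pCons)

definition real_rooted :: "real poly \<Rightarrow> bool" where
  "real_rooted p \<longleftrightarrow> (\<forall>z. poly (cpoly p) z = 0 \<longrightarrow> Im z = 0)"

lemma real_rooted_imp_split:
  assumes "real_rooted p" "p \<noteq> 0"
  shows "\<exists>c rs. p = smult c (lin_prod rs)"
  using assms
proof (induction "degree p" arbitrary: p)
  case 0
  then obtain c where "p = [:c:]" by (metis degree_eq_zeroE)
  then show ?case by (intro exI[of _ c] exI[of _ "[]"]) simp
next
  case (Suc n)
  have "degree (cpoly p) = Suc n"
    using Suc by (simp add: degree_map_poly)
  then obtain z where z: "poly (cpoly p) z = 0"
    using fundamental_theorem_of_algebra constant_degree by (metis nat.distinct(1))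
  then have "Im z = 0" using Suc.prems by (auto simp: real_rooted_def)
  then have "z = of_real (Re z)" by (simp add: complex_eq_iff)
  then have "poly p (Re z) = 0"
    using z poly_cpoly_of_real by (metis of_real_eq_0_iff)
  then obtain q where q: "p = [:- Re z, 1:] * q"
    by (metis dvdE poly_eq_0_iff_dvd)
  have "q \<noteq> 0" using q Suc.prems by auto
  then have "degree q = n"
    using Suc.hyps(2) q by (simp add: degree_mult_eq del: mult_pCons_left)
  moreover have "real_rooted q"
    using Suc.prems(1) by (auto simp: real_rooted_def q cpoly_mult simp del: mult_pCons_left)
  ultimately obtain c rs where "q = smult c (lin_prod rs)"
    using Suc.hyps(1) \<open>q \<noteq> 0\<close> by blast
  then have "p = smult c (lin_prod (Re z # rs))" by (simp add: q mult_smult_right del: mult_pCons_left)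
  then show ?case by blast
qed

text \<open>The imaginary part of the logarithmic derivative has a sign off the real axis
  (Gauss--Lucas).\<close>

lemma real_rooted_pderiv_lin_prod:
  assumes "rs \<noteq> []"
  shows "real_rooted (pderiv (lin_prod rs))"
  unfolding real_rooted_def
proof (intro allI impI, rule ccontr)
  fix z assume z: "poly (cpoly (pderiv (lin_prod rs))) z = 0" and im: "Im z \<noteq> 0"
  have ni: "z \<notin> set (map complex_of_real rs)" using im by auto
  have "poly (lin_prod (map complex_of_real rs)) z \<noteq> 0"
    using ni poly_lin_prod_eq_0_iff by blast
  then have "(\<Sum>r\<leftarrow>map complex_of_real rs. 1 / (z - r)) = 0"
    using z pderiv_lin_prod[OF ni] by (simp add: cpoly_pderiv cpoly_lin_prod)
  moreover have "Im (\<Sum>r\<leftarrow>map complex_of_real rs. 1 / (z - r)) = - Im z * (\<Sum>r\<leftarrow>rs. 1 / (cmod (z - of_real r))\<^sup>2)"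
    by (induction rs) (simp_all add: Im_divide cmod_power2 algebra_simps divide_inverse)
  moreover have "(\<Sum>r\<leftarrow>rs. 1 / (cmod (z - of_real r))\<^sup>2) > 0"
  proof -
    obtain a as where rs: "rs = a # as" using assms by (cases rs) auto
    have "(\<Sum>r\<leftarrow>as. 1 / (cmod (z - of_real r))\<^sup>2) \<ge> 0" by (intro sum_list_nonneg) auto
    moreover have "1 / (cmod (z - of_real a))\<^sup>2 > 0" using im by (auto simp: complex_eq_iff)
    ultimately show ?thesis unfolding rs by (simp only: list.map sum_list.Cons)
  qed
  ultimately show False using im by auto
qed

text \<open>The condition \<open>c > 0\<close> excludes the zero polynomial and makes the values
  positive beyond the largest root.\<close>

definition splits :: "real poly \<Rightarrow> bool" where
  "splits p \<longleftrightarrow> (\<exists>c rs. c > 0 \<and> p = smult c (lin_prod rs))"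

lemma splits_pderiv:
  assumes "splits p" "degree p > 0"
  shows "splits (pderiv p)"
proof -
  obtain c rs where c: "c > 0" and p: "p = smult c (lin_prod rs)"
    using assms(1) by (auto simp: splits_def)
  have rs: "rs \<noteq> []" using assms(2) p c by (intro notI) simp
  have nz: "pderiv (lin_prod rs) \<noteq> 0" using rs by (simp add: pderiv_eq_0_iff)
  obtain d qs where d: "pderiv (lin_prod rs) = smult d (lin_prod qs)"
    using real_rooted_imp_split[OF real_rooted_pderiv_lin_prod[OF rs] nz] by blast
  have "lead_coeff (pderiv (lin_prod rs)) = real (length rs)"
  proof -
    have "length rs = Suc (length rs - 1)" using rs by (cases rs) auto
    then show ?thesis
      using lead_coeff_lin_prod[of rs]
      by (metis coeff_pderiv degree_lin_prod degree_pderiv mult.right_neutral)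
  qed
  then have "d = real (length rs)" unfolding d lead_coeff_smult by (simp del: degree_lin_prod)
  then have "c * d > 0" using c rs by simp
  then show ?thesis unfolding splits_def p pderiv_smult d by (auto intro!: exI[of _ "c * d"] exI[of _ qs])
qed

lemma splits_smult_iff:
  assumes "c > 0"
  shows "splits (smult c p) \<longleftrightarrow> splits p"
proof
  assume "splits (smult c p)"
  then obtain d rs where d: "d > 0" "smult c p = smult d (lin_prod rs)" by (auto simp: splits_def)
  then have "smult (1/c) (smult c p) = smult (d/c) (lin_prod rs)" by simp
  then have "p = smult (d/c) (lin_prod rs)" using assms by (simp add: smult_smult)
  then show "splits p" using assms d(1) by (auto simp: splits_def intro!: exI[of _ "d/c"])
next
  assume "splits p"
  then obtain d rs where d: "d > 0" "p = smult d (lin_prod rs)" by (auto simp: splits_def)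
  then show "splits (smult c p)" using assms by (auto simp: splits_def intro!: exI[of _ "c*d"])
qed

lemma splits_laguerre:
  assumes "splits p"
  shows "(poly (pderiv p) x)\<^sup>2 \<le>
    real (degree p) * ((poly (pderiv p) x)\<^sup>2 - poly p x * poly (pderiv (pderiv p)) x)"
proof -
  obtain c rs where c: "c > 0" and p: "p = smult c (lin_prod rs)"
    using assms by (auto simp: splits_def)
  show ?thesis
    using mult_left_mono[OF laguerre_lin_prod[of rs x], of "c\<^sup>2"] c
    by (simp add: p pderiv_smult power2_eq_square algebra_simps)
qed

text \<open>Beyond \<tau> the polynomial stays positive, so all roots lie to the left of \<tau>; the
  logarithmic derivative at \<tau> is then a nonempty sum of positive terms
  \<open>1 / (\<tau> - r)\<close>.\<close>

lemma splits_no_critical_point: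
  assumes "splits p" "degree p > 0" "poly p \<tau> > 0" "\<And>t. t > \<tau> \<Longrightarrow> poly (pderiv p) t \<ge> 0"
  shows "poly (pderiv p) \<tau> > 0"
proof -
  obtain c rs where c: "c > 0" and p: "p = smult c (lin_prod rs)"
    using assms by (auto simp: splits_def)
  have pos: "poly p t > 0" if t: "t > \<tau>" for t
  proof -
    obtain \<xi> where "\<xi> > \<tau>" "poly p t - poly p \<tau> = (t - \<tau>) * poly (pderiv p) \<xi>"
      using poly_MVT[of \<tau> t p] t by blast
    then show ?thesis using assms(3) assms(4)[of \<xi>] t
      by (smt (verit) mult_nonneg_nonneg)
  qed
  have lt: "r < \<tau>" if "r \<in> set rs" for r
  proof -
    have "poly p r = 0" using that poly_lin_prod_eq_0_iff[of rs r] by (simp add: p)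
    then show ?thesis using pos[of r] assms(3) by (metis less_irrefl linorder_cases)
  qed
  have "rs \<noteq> []" using assms(2) p c by (intro notI) simp
  moreover have "(\<Sum>r\<leftarrow>rs. 1 / (\<tau> - r)) > 0" if "rs \<noteq> []" "\<forall>r\<in>set rs. r < \<tau>" for rs
    using that
  proof (induction rs rule: list_nonempty_induct)
    case (cons x xs)
    then have "0 < 1 / (\<tau> - x)" "0 < (\<Sum>r\<leftarrow>xs. 1 / (\<tau> - r))" by auto
    then show ?case by (simp only: list.map sum_list.Cons)
  qed auto
  ultimately have "(\<Sum>r\<leftarrow>rs. 1 / (\<tau> - r)) > 0" using lt by blast
  then show ?thesis
    using pderiv_lin_prod[of \<tau> rs] lt assms(3) c
    by (force simp: p pderiv_smult zero_less_mult_iff)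
qed

section \<open>Elementary symmetric functions under a shift\<close>

text \<open>The index set is a parameter so that one index can be removed, and the values lie in a
  ring so that the linear polynomials \<open>x i + t\<close> can be inserted.\<close>

definition esym :: "'a set \<Rightarrow> nat \<Rightarrow> ('a \<Rightarrow> 'b::comm_ring_1) \<Rightarrow> 'b" where
  "esym S k x = (\<Sum>I | I \<subseteq> S \<and> card I = k. \<Prod>i\<in>I. x i)"

lemma esym_0 [simp]: "finite S \<Longrightarrow> esym S 0 x = 1"
proof -
  assume "finite S"
  then have "{I. I \<subseteq> S \<and> card I = 0} = {{}}" by (auto dest: finite_subset)
  then show ?thesis by (simp add: esym_def)
qed

lemma esym_card: "finite S \<Longrightarrow> esym S (card S) x = (\<Prod>i\<in>S. x i)"
proof -
  assume "finite S"
  then have "{I. I \<subseteq> S \<and> card I = card S} = {S}" by (auto dest: card_subset_eq)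
  then show ?thesis by (simp add: esym_def)
qed

lemma esym_eq_0: "finite S \<Longrightarrow> card S < k \<Longrightarrow> esym S k x = 0"
  unfolding esym_def by (intro sum.neutral) (auto dest: card_mono)

lemma esym_insert:
  assumes "finite S" "a \<notin> S"
  shows "esym (insert a S) (Suc k) x = esym S (Suc k) x + x a * esym S k x"
proof -
  let ?F = "\<lambda>k. {I. I \<subseteq> S \<and> card I = k}"
  have fin: "finite (?F k)" for k
    using assms(1) by (auto intro: finite_subset[of _ "Pow S"])
  have eq: "{I. I \<subseteq> insert a S \<and> card I = Suc k} = ?F (Suc k) \<union> insert a ` ?F k"
  proof (intro subset_antisym subsetI)
    fix I assume "I \<in> {I. I \<subseteq> insert a S \<and> card I = Suc k}"
    then have I: "I \<subseteq> insert a S" "card I = Suc k" by auto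
    show "I \<in> ?F (Suc k) \<union> insert a ` ?F k"
    proof (cases "a \<in> I")
      case True
      then have "I = insert a (I - {a})" "I - {a} \<subseteq> S" "card (I - {a}) = k" using I by auto
      then show ?thesis by blast
    qed (use I in auto)
  next
    fix I assume "I \<in> ?F (Suc k) \<union> insert a ` ?F k"
    then show "I \<in> {I. I \<subseteq> insert a S \<and> card I = Suc k}"
      using assms by (auto dest: finite_subset) (subst card_insert_disjoint, auto dest: finite_subset)
  qed
  have inj: "inj_on (insert a) (?F k)"
    using assms(2) by (auto simp: inj_on_def)
  have "(\<Sum>I\<in>insert a ` ?F k. \<Prod>i\<in>I. x i) = (\<Sum>I\<in>?F k. x a * (\<Prod>i\<in>I. x i))"
    unfolding sum.reindex[OF inj] o_def
  proof (intro sum.cong refl)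
    fix I assume "I \<in> ?F k"
    then have "finite I" "a \<notin> I" using assms by (auto dest: finite_subset)
    then show "prod x (insert a I) = x a * prod x I" by simp
  qed
  moreover have "?F (Suc k) \<inter> insert a ` ?F k = {}" using assms(2) by auto
  ultimately show ?thesis
    unfolding esym_def eq using fin by (subst sum.union_disjoint) (auto simp: sum_distrib_left)
qed

lemma prod_add_eq_esym:
  assumes "finite S"
  shows "(\<Prod>i\<in>S. x i + y) = (\<Sum>j\<le>card S. esym S j x * y ^ (card S - j))"
proof -
  have "(\<Prod>i\<in>S. x i + y) = (\<Sum>I\<in>Pow S. (\<Prod>i\<in>I. x i) * (\<Prod>i\<in>S - I. y))"
    by (rule prod_add[OF assms])
  also have "\<dots> = (\<Sum>I\<in>Pow S. (\<Prod>i\<in>I. x i) * y ^ (card S - card I))"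
    using assms by (intro sum.cong refl) (auto simp: card_Diff_subset finite_subset)
  also have "\<dots> = (\<Sum>j\<le>card S. \<Sum>I | I \<in> Pow S \<and> card I = j. (\<Prod>i\<in>I. x i) * y ^ (card S - card I))"
    using assms by (intro sum.group[symmetric]) (auto intro: card_mono)
  also have "\<dots> = (\<Sum>j\<le>card S. esym S j x * y ^ (card S - j))"
    unfolding esym_def by (intro sum.cong refl) (auto simp: sum_distrib_right intro: sum.cong)
  finally show ?thesis .
qed

definition esym_poly :: "'a set \<Rightarrow> nat \<Rightarrow> ('a \<Rightarrow> real) \<Rightarrow> real poly" where
  "esym_poly S k x = esym S k (\<lambda>i. [:x i, 1:])"

lemma poly_esym_poly: "poly (esym_poly S k x) t = esym S k (\<lambda>i. x i + t)"
  by (simp add: esym_poly_def esym_def poly_sum poly_prod)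

text \<open>Differentiating a product drops one factor, and a given \<open>k\<close>-subset arises
  in this way from \<open>card S - k\<close> sets of size \<open>k + 1\<close>.\<close>

lemma pderiv_esym_poly:
  assumes "finite S"
  shows "pderiv (esym_poly S (Suc k) x) = smult (real (card S) - real k) (esym_poly S k x)"
  using assms
proof (induction S arbitrary: k rule: finite_induct)
  case empty
  then show ?case by (cases k) (simp_all add: esym_poly_def esym_eq_0)
next
  case (insert a S)
  have 1: "pderiv [:x a, 1:] = 1" by (simp add: pderiv_pCons)
  have 2: "esym_poly (insert a S) (Suc k) x = esym_poly S (Suc k) x + [:x a, 1:] * esym_poly S k x" for k
    unfolding esym_poly_def by (rule esym_insert[OF insert(1,2)])
  show ?case
  proof (cases k)
    case 0
    then show ?thesis
      using insert.IH[of 0] insert(1,2)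
      by (simp only: 2 pderiv_add pderiv_mult 1) (simp add: esym_poly_def one_pCons)
  next
    case (Suc j)
    have "pderiv (esym_poly (insert a S) (Suc k) x)
        = smult (real (card S) - real k) (esym_poly S k x) + esym_poly S k x
          + [:x a, 1:] * smult (real (card S) - real j) (esym_poly S j x)"
      by (simp only: 2 pderiv_add pderiv_mult 1 insert.IH Suc mult_1_right add_ac)
    also have "\<dots> = smult (real (card S) - real j) (esym_poly S k x + [:x a, 1:] * esym_poly S j x)"
      by (simp add: Suc smult_add_right algebra_simps smult_diff_left smult_add_left)
    also have "\<dots> = smult (real (card (insert a S)) - real k) (esym_poly (insert a S) k x)"
      using insert(1,2) by (simp only: Suc 2[of j, symmetric]) simp
    finally show ?thesis .
  qed
qed

text \<open>Downward induction: the full product splits by construction, and each derivative is a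
  positive multiple of the next lower symmetric function.\<close>

lemma splits_esym_poly:
  assumes "finite S" "k \<le> card S"
  shows "splits (esym_poly S k x) \<and> degree (esym_poly S k x) = k"
  using assms(2)
proof (induction k rule: inc_induct)
  case base
  obtain l where l: "set l = S" "distinct l" using finite_distinct_list[OF assms(1)] by blast
  have "esym_poly S (card S) x = (\<Prod>i\<in>S. [:x i, 1:])"
    unfolding esym_poly_def by (rule esym_card[OF assms(1)])
  also have "\<dots> = lin_prod (map (\<lambda>i. - x i) l)"
    using l by (auto simp: lin_prod_def o_def prod.distinct_set_conv_list)
  finally have e: "esym_poly S (card S) x = lin_prod (map (\<lambda>i. - x i) l)" .
  have "length l = card S" using l distinct_card by metis
  then show ?case unfolding e splits_def by (auto intro!: exI[of _ 1])
next
  case (step k)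
  have pos: "real (card S) - real k > 0" using step by auto
  have "splits (smult (real (card S) - real k) (esym_poly S k x))"
    using splits_pderiv[of "esym_poly S (Suc k) x"] step.IH
    by (simp add: pderiv_esym_poly[OF assms(1)])
  moreover have "degree (smult (real (card S) - real k) (esym_poly S k x)) = k"
    using step.IH degree_pderiv[of "esym_poly S (Suc k) x"]
    by (simp only: pderiv_esym_poly[OF assms(1)])
  ultimately show ?case using pos by (simp add: splits_smult_iff)
qed

text \<open>Integrate in \<open>t\<close>: the derivative of the symmetric function of order
  \<open>k + 1\<close> is \<open>card S - k\<close> times the one of order \<open>k\<close>, which
  the induction hypothesis bounds from below.\<close>

lemma esym_shift_ge:
  fixes x :: "'a \<Rightarrow> real"
  assumes "finite S" "k \<le> card S" "\<And>j. 1 \<le> j \<Longrightarrow> j \<le> k \<Longrightarrow> 0 \<le> esym S j x" "t > 0"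
  shows "esym S k (\<lambda>i. x i + t) \<ge> t ^ k / fact k"
  using assms(2-4)
proof (induction k arbitrary: t)
  case 0
  then show ?case by (simp add: esym_0[OF assms(1)])
next
  case (Suc k)
  define G where "G = (\<lambda>t. esym S (Suc k) (\<lambda>i. x i + t) - t ^ Suc k / fact (Suc k))"
  have D: "(G has_real_derivative (real (card S) - real k) * esym S k (\<lambda>i. x i + t) - t ^ k / fact k) (at t)" for t
  proof -
    have "((\<lambda>t. poly (esym_poly S (Suc k) x) t - t ^ Suc k / fact (Suc k)) has_real_derivative
        poly (pderiv (esym_poly S (Suc k) x)) t - (real (Suc k) * t ^ k) / fact (Suc k)) (at t)"
      using DERIV_pow[of "Suc k" t UNIV] by (intro DERIV_diff poly_DERIV DERIV_cdivide) (simp only: diff_Suc_Suc diff_zero)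
    moreover have "(real (Suc k) * t ^ k) / fact (Suc k) = t ^ k / fact k"
      by (simp add: divide_simps)
    ultimately show ?thesis
      unfolding G_def pderiv_esym_poly[OF assms(1)] by (simp add: poly_esym_poly)
  qed
  have "G 0 \<le> G t"
  proof (rule DERIV_nonneg_imp_increasing_open[of 0 t])
    fix s :: real assume s: "0 < s" "s < t"
    have IH: "s ^ k / fact k \<le> esym S k (\<lambda>i. x i + s)"
      using Suc s by auto
    \<comment> \<open>The factor \<open>card S - k\<close> is at least 1 since
      \<open>Suc k \<le> card S\<close>; estimating it by 1 produces the constant
      \<open>1 / fact k\<close>.\<close>
    have "1 * esym S k (\<lambda>i. x i + s) \<le> (real (card S) - real k) * esym S k (\<lambda>i. x i + s)"
      using Suc.prems(1) s order_trans[OF _ IH, of 0] by (intro mult_right_mono) auto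
    then show "\<exists>y. (G has_real_derivative y) (at s) \<and> 0 \<le> y"
      using D[of s] IH by (intro exI conjI) auto
  next
    show "continuous_on {0..t} G"
      using D by (meson DERIV_continuous continuous_at_imp_continuous_on)
  qed (use Suc in auto)
  moreover have "G 0 \<ge> 0" using Suc.prems(2)[of "Suc k"] by (simp add: G_def)
  ultimately show ?case by (simp add: G_def)
qed

lemma esym_remove:
  assumes "finite S" "i \<in> S"
  shows "esym S (Suc k) x = esym (S - {i}) (Suc k) x + x i * esym (S - {i}) k x"
  using esym_insert[of "S - {i}" i k x] assms by (simp add: insert_absorb)

text \<open>Write \<open>f(t) = \<sigma>\<^sub>k\<^sub>+\<^sub>1(x + t)\<close> as \<open>h + (x\<^sub>i + t) g\<close> with \<open>g\<close>, \<open>h\<close> not involving \<open>x\<^sub>i\<close>; then \<open>h'\<close> is a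
  multiple of \<open>g\<close>. Beyond the largest root \<open>\<tau> > 0\<close> of \<open>g\<close> the polynomial \<open>h\<close> increases, and
  \<open>h(\<tau>) = f(\<tau>) > 0\<close>; as \<open>h\<close> splits, \<open>\<tau>\<close> cannot be a critical point of \<open>h\<close>.\<close>

lemma esym_remove_shift_pos:
  fixes x :: "'a \<Rightarrow> real"
  assumes S: "finite S" "i \<in> S" "Suc k \<le> card S"
    and x: "\<And>j. 1 \<le> j \<Longrightarrow> j \<le> Suc k \<Longrightarrow> 0 \<le> esym S j x" and t: "t > 0"
  shows "esym (S - {i}) k (\<lambda>j. x j + t) > 0"
proof (rule ccontr)
  define f g h where "f = esym_poly S (Suc k) x" and "g = esym_poly (S - {i}) k x"
    and "h = esym_poly (S - {i}) (Suc k) x"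
  have cT: "card (S - {i}) = card S - 1" "finite (S - {i})" using S by auto
  have g: "splits g" using splits_esym_poly[of "S - {i}" k x] cT S unfolding g_def by auto
  then obtain c rs where c: "c > 0" "g = smult c (lin_prod rs)" by (auto simp: splits_def)
  then have lc: "lead_coeff g > 0" unfolding c(2) lead_coeff_smult by (simp del: degree_lin_prod)
  then have g0: "g \<noteq> 0" by auto
  obtain N where N: "\<And>x. x \<ge> N \<Longrightarrow> poly g x \<ge> lead_coeff g"
    using poly_pinfty_gt_lc[OF lc] by blast
  assume "\<not> ?thesis"
  then have neg: "poly g t \<le> 0" by (simp add: g_def poly_esym_poly)
  define Z where "Z = {s. poly g s = 0 \<and> s \<ge> t}"
  have fin: "finite Z" unfolding Z_def using poly_roots_finite[OF g0] by (rule finite_subset[rotated]) auto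
  have root: "\<exists>s\<in>Z. s \<ge> a" if a: "a \<ge> t" "poly g a \<le> 0" for a
  proof -
    define b where "b = max (a + 1) N"
    have "poly g b > 0" using N[of b] lc by (auto simp: b_def)
    moreover have "a \<le> b" by (auto simp: b_def)
    moreover have "continuous_on {a..b} (poly g)" by (intro continuous_intros)
    ultimately obtain s where "a \<le> s" "s \<le> b" "poly g s = 0"
      using IVT'[of "poly g" a 0 b] a less_imp_le[of 0 "poly g b"] by blast
    then show ?thesis using a by (auto simp: Z_def)
  qed
  have Zne: "Z \<noteq> {}" using root[of t] neg by auto
  define \<tau> where "\<tau> = Max Z"
  have \<tau>: "poly g \<tau> = 0" "\<tau> \<ge> t" using Max_in[OF fin Zne] by (auto simp: \<tau>_def Z_def)
  have gpos: "poly g s > 0" if s: "s > \<tau>" for s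
  proof (rule ccontr)
    assume "\<not> ?thesis"
    then obtain r where "r \<in> Z" "r \<ge> s" using root[of s] s \<tau> by auto
    then show False using Max_ge[OF fin] s by (force simp: \<tau>_def)
  qed
  have "esym S (Suc k) (\<lambda>i. x i + \<tau>) \<ge> \<tau> ^ Suc k / fact (Suc k)"
    using \<tau> t x by (intro esym_shift_ge S) auto
  moreover have "\<tau> ^ Suc k / fact (Suc k) > 0" using \<tau> t by simp
  ultimately have fpos: "poly f \<tau> > 0" unfolding f_def poly_esym_poly by linarith
  have "poly f \<tau> = poly h \<tau> + (x i + \<tau>) * poly g \<tau>"
    unfolding f_def g_def h_def poly_esym_poly using esym_remove[OF S(1,2)] .
  then have hpos: "poly h \<tau> > 0" using fpos \<tau> by simp
  \<comment> \<open>In the extreme case \<open>Suc k = card S\<close> the polynomial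
    \<open>h\<close> would vanish identically, contradicting its positive value at \<tau>; hence it
    splits with positive degree.\<close>
  have "Suc k \<le> card (S - {i})"
  proof (rule ccontr)
    assume "\<not> ?thesis"
    then have "h = 0" unfolding h_def esym_poly_def using cT by (intro esym_eq_0) auto
    then show False using hpos by simp
  qed
  then have h: "splits h" "degree h = Suc k"
    using splits_esym_poly[OF cT(2)] unfolding h_def by auto
  have h': "pderiv h = smult (real (card (S - {i})) - real k) g"
    unfolding h_def g_def by (rule pderiv_esym_poly[OF cT(2)])
  have "poly (pderiv h) \<tau> > 0"
    using \<open>Suc k \<le> card (S - {i})\<close> gpos by (intro splits_no_critical_point h hpos) (auto simp: h' h less_imp_le)
  then show False using \<tau> by (simp add: h')
qed

text \<open>With \<open>f\<close>, \<open>g\<close>, \<open>h\<close> as before, \<open>f / g = t + x\<^sub>i + h / g\<close>, and the Laguerre inequality for \<open>h\<close> bounds its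
  derivative from below by \<open>n / (k + 1)\<close>.\<close>

lemma esym_shift_ge_remove:
  fixes x :: "'a \<Rightarrow> real"
  assumes S: "finite S" "i \<in> S" "Suc k \<le> card S"
    and x: "\<And>j. 1 \<le> j \<Longrightarrow> j \<le> Suc k \<Longrightarrow> 0 \<le> esym S j x" and t: "t > 0"
  shows "esym S (Suc k) (\<lambda>j. x j + t) \<ge> (card S / Suc k) * t * esym (S - {i}) k (\<lambda>j. x j + t)"
proof -
  define f g h where "f = esym_poly S (Suc k) x" and "g = esym_poly (S - {i}) k x"
    and "h = esym_poly (S - {i}) (Suc k) x"
  define c q where "c = real (card S) - real (Suc k)" and "q = real (card S) / real (Suc k)"
  have cT: "card (S - {i}) = card S - 1" "finite (S - {i})" using S by auto
  have q: "q > 0" using S by (auto simp: q_def)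
  have gpos: "poly g s > 0" if "s > 0" for s
    unfolding g_def poly_esym_poly by (rule esym_remove_shift_pos[OF S x that])
  have feq: "poly f s = poly h s + (x i + s) * poly g s" for s
    unfolding f_def g_def h_def poly_esym_poly using esym_remove[OF S(1,2)] .
  have fpos: "poly f s > 0" if "s > 0" for s
  proof -
    have "esym S (Suc k) (\<lambda>i. x i + s) \<ge> s ^ Suc k / fact (Suc k)"
      using that x by (intro esym_shift_ge S) auto
    moreover have "s ^ Suc k / fact (Suc k) > 0" using that by simp
    ultimately show ?thesis unfolding f_def poly_esym_poly by linarith
  qed
  have h': "pderiv h = smult c g"
    using pderiv_esym_poly[OF cT(2), of k x] cT(1) S unfolding h_def g_def c_def
    by (simp add: of_nat_diff diff_diff_eq add.commute)
  \<comment> \<open>The Laguerre inequality with \<open>h' = c g\<close>, divided by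
    \<open>c\<close>; it bounds the numerator of the derivative of \<open>h / g\<close>. For
    \<open>c = 0\<close> both sides vanish because \<open>h = 0\<close>.\<close>
  have key: "c / real (Suc k) * (poly g s)\<^sup>2 \<le> poly (pderiv h) s * poly g s - poly h s * poly (pderiv g) s" for s
  proof (cases "Suc k = card S")
    case True
    then have "h = 0" unfolding h_def esym_poly_def using cT S by (intro esym_eq_0) auto
    then show ?thesis using True by (simp add: c_def)
  next
    case False
    then have "c > 0" "Suc k \<le> card (S - {i})" using S cT by (auto simp: c_def)
    then have h: "splits h" "degree h = Suc k"
      using splits_esym_poly[OF cT(2)] unfolding h_def by auto
    have "(c * poly g s)\<^sup>2 \<le> real (Suc k) * ((c * poly g s)\<^sup>2 - poly h s * (c * poly (pderiv g) s))"
      using splits_laguerre[OF h(1), of s] by (simp only: h' h(2) pderiv_smult poly_smult)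
    then have "c * (c * (poly g s)\<^sup>2) \<le> c * (real (Suc k) * (c * (poly g s)\<^sup>2 - poly h s * poly (pderiv g) s))"
      by (simp add: power2_eq_square algebra_simps)
    then have "c * (poly g s)\<^sup>2 \<le> real (Suc k) * (c * (poly g s)\<^sup>2 - poly h s * poly (pderiv g) s)"
      using \<open>c > 0\<close> by (simp only: mult_le_cancel_left_pos)
    then show ?thesis by (simp add: h' field_simps power2_eq_square)
  qed
  define F where "F = (\<lambda>s. x i + s + poly h s / poly g s)"
  have F: "F s * poly g s = poly f s" if "s > 0" for s
    using gpos[OF that] by (simp add: F_def feq field_simps)
  have DF: "(F has_real_derivative
      1 + (poly (pderiv h) s * poly g s - poly h s * poly (pderiv g) s) / (poly g s)\<^sup>2) (at s)"
    if "s > 0" for s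
    unfolding F_def using gpos[OF that]
    by (auto intro!: derivative_eq_intros simp: power2_eq_square)
  \<comment> \<open>The mean value theorem is applied on \<open>[e, t]\<close> and not on
    \<open>[0, t]\<close> because \<open>g\<close> may vanish at 0; afterwards \<open>e\<close> is
    taken small.\<close>
  have inc: "F t > q * (t - e)" if e: "0 < e" "e < t" for e
  proof -
    have "\<exists>s>e. s < t \<and> F t - F e = (t - e) *
        (1 + (poly (pderiv h) s * poly g s - poly h s * poly (pderiv g) s) / (poly g s)\<^sup>2)"
      using e by (intro MVT2 DF) auto
    then obtain s where s: "e < s" "s < t" and eq: "F t - F e = (t - e) *
        (1 + (poly (pderiv h) s * poly g s - poly h s * poly (pderiv g) s) / (poly g s)\<^sup>2)"
      by blast
    have "s > 0" using s e by simp
    have "q = 1 + c / real (Suc k)" by (simp add: q_def c_def field_simps)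
    also have "\<dots> \<le> 1 + (poly (pderiv h) s * poly g s - poly h s * poly (pderiv g) s) / (poly g s)\<^sup>2"
      using key[of s] gpos[OF \<open>s > 0\<close>] by (simp add: pos_le_divide_eq)
    finally have "(t - e) * q \<le> F t - F e" unfolding eq using e by (intro mult_left_mono) auto
    moreover have "F e > 0" using F[OF e(1)] fpos[OF e(1)] gpos[OF e(1)]
      by (metis zero_less_mult_pos2)
    ultimately show ?thesis by (simp add: mult.commute)
  qed
  have "F t \<ge> q * t"
  proof (rule ccontr)
    assume "\<not> ?thesis"
    then have d: "(q * t - F t) / q > 0" using q by simp
    define e where "e = min (t / 2) ((q * t - F t) / q)"
    have "e \<le> (q * t - F t) / q" by (simp add: e_def)
    then have "q * e \<le> q * t - F t" using q by (simp add: pos_le_divide_eq mult.commute)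
    moreover have "0 < e" "e < t" using t d by (auto simp: e_def)
    ultimately show False using inc[of e] by (simp add: algebra_simps)
  qed
  then have "q * t * poly g t \<le> F t * poly g t" using gpos[OF t] by (intro mult_right_mono) auto
  then show ?thesis unfolding F[OF t] by (simp add: f_def g_def q_def poly_esym_poly)
qed

section \<open>Symmetric matrices\<close>

abbreviation sym_mat :: "real^'n^'n \<Rightarrow> bool" where
  "sym_mat A \<equiv> transpose A = A"

definition outer :: "real^'n \<Rightarrow> real^'n^'n" where
  "outer x = (\<chi> i j. x $ i * x $ j)"

definition eigenbasis :: "real^'n^'n \<Rightarrow> ('n \<Rightarrow> real^'n) \<Rightarrow> ('n \<Rightarrow> real) \<Rightarrow> bool" where
  "eigenbasis A v l \<longleftrightarrow> (\<forall>i j. v i \<bullet> v j = (if i = j then 1 else 0)) \<and> (\<forall>i. A *v v i = l i *\<^sub>R v i)"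

lemma sym_mat_inner: "sym_mat A \<Longrightarrow> x \<bullet> (A *v y) = (A *v x) \<bullet> y"
  by (metis dot_lmul_matrix transpose_matrix_vector)

lemma sym_mat_outer [simp]: "sym_mat (outer x)"
  by (simp add: outer_def transpose_def vec_eq_iff mult.commute)

lemma sym_mat_scaleR: "sym_mat A \<Longrightarrow> sym_mat (c *\<^sub>R A)"
  by (simp add: transpose_def vec_eq_iff)

lemma sym_mat_add: "sym_mat A \<Longrightarrow> sym_mat B \<Longrightarrow> sym_mat (A + B)"
  by (simp add: transpose_def vec_eq_iff)

lemma sym_mat_diff: "sym_mat A \<Longrightarrow> sym_mat B \<Longrightarrow> sym_mat (A - B)"
  by (simp add: transpose_def vec_eq_iff)

lemma outer_mult_vec: "outer x *v y = (x \<bullet> y) *\<^sub>R x"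
  by (simp add: outer_def matrix_vector_mult_def inner_vec_def vec_eq_iff sum_distrib_left sum_distrib_right mult_ac)

lemma mat_mult_vec: "mat c *v x = c *\<^sub>R (x :: real^'n)"
  by (simp add: mat_def matrix_vector_mult_def vec_eq_iff mult_delta_left)

lemma scaleR_mult_vec: "(c *\<^sub>R A) *v x = c *\<^sub>R (A *v (x :: real^'n))"
  by (simp add: matrix_vector_mult_def vec_eq_iff sum_distrib_left mult_ac)

text \<open>The first-order condition at a maximum, in algebraic form:
  \<open>t = a / (\<bar>b\<bar> + 1)\<close> is small enough for the linear term to
  dominate.\<close>

lemma quadratic_nonpos_imp_zero:
  fixes a b :: real
  assumes "\<And>t. 2 * t * a + t\<^sup>2 * b \<le> 0"
  shows "a = 0"
proof -
  define c where "c = \<bar>b\<bar> + 1"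
  have c: "c > 0" "2 * c + b > 0" by (auto simp: c_def)
  have "c\<^sup>2 * (2 * (a / c) * a + (a / c)\<^sup>2 * b) \<le> 0"
    using assms[of "a / c"] c by (simp add: mult_nonneg_nonpos)
  moreover have "c\<^sup>2 * (2 * (a / c) * a + (a / c)\<^sup>2 * b) = a\<^sup>2 * (2 * c + b)"
    using c by (simp add: field_simps power2_eq_square)
  ultimately have "a\<^sup>2 * (2 * c + b) \<le> 0" by simp
  then have "a\<^sup>2 \<le> 0" using c(2) by (simp add: mult_le_0_iff)
  then show ?thesis by simp
qed

text \<open>Maximise the Rayleigh quotient over the unit sphere of \<open>S\<close>. The residual
  \<open>y = A x - \<mu> x\<close> lies in \<open>S\<close> by invariance, and varying the maximiser
  along \<open>y\<close> forces \<open>y \<bullet> y = 0\<close>.\<close>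

lemma sym_mat_eigenvector_in_subspace:
  fixes A :: "real^'n^'n"
  assumes A: "sym_mat A" and S: "subspace S" "\<And>x. x \<in> S \<Longrightarrow> A *v x \<in> S" and ne: "\<exists>x\<in>S. x \<noteq> 0"
  shows "\<exists>x\<in>S. norm x = 1 \<and> (\<exists>\<mu>. A *v x = \<mu> *\<^sub>R x)"
proof -
  let ?K = "S \<inter> sphere 0 1"
  obtain z where z: "z \<in> S" "z \<noteq> 0" using ne by blast
  then have "(1 / norm z) *\<^sub>R z \<in> ?K" using S(1) by (simp add: subspace_scale)
  then have "?K \<noteq> {}" by blast
  moreover have "compact ?K" using S(1) by (simp add: closed_subspace closed_Int_compact)
  moreover have "continuous_on ?K (\<lambda>x. x \<bullet> (A *v x))"
    by (intro continuous_intros linear_continuous_on) (simp add: linear_linear[symmetric])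
  ultimately obtain x where x: "x \<in> ?K" and mx: "\<And>y. y \<in> ?K \<Longrightarrow> y \<bullet> (A *v y) \<le> x \<bullet> (A *v x)"
    using continuous_attains_sup[of ?K "\<lambda>x. x \<bullet> (A *v x)"] by blast
  define \<mu> where "\<mu> = x \<bullet> (A *v x)"
  have le: "y \<bullet> (A *v y) \<le> \<mu> * (y \<bullet> y)" if "y \<in> S" for y
  proof (cases "y = 0")
    case False
    then have "(1 / norm y) *\<^sub>R y \<in> ?K" using S(1) that by (simp add: subspace_scale)
    then have "(1 / norm y) * ((1 / norm y) * (y \<bullet> (A *v y))) \<le> \<mu>"
      using mx unfolding \<mu>_def by (fastforce simp: matrix_vector_mult_scaleR)
    moreover have "(1 / norm y) * ((1 / norm y) * (y \<bullet> (A *v y))) = (y \<bullet> (A *v y)) / (y \<bullet> y)"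
      using False by (simp add: dot_square_norm power2_eq_square)
    ultimately show ?thesis using False by (simp add: field_simps dot_square_norm power2_eq_square)
  qed simp
  define y where "y = A *v x - \<mu> *\<^sub>R x"
  have xS: "x \<in> S" "x \<bullet> x = 1" using x by (auto simp: norm_eq_1)
  then have yS: "y \<in> S" unfolding y_def using S by (simp add: subspace_diff subspace_scale)
  have "2 * t * (y \<bullet> y) + t\<^sup>2 * (y \<bullet> (A *v y) - \<mu> * (y \<bullet> y)) \<le> 0" for t
  proof -
    have "x + t *\<^sub>R y \<in> S" using xS yS S(1) by (simp add: subspace_add subspace_scale)
    from le[OF this] have "(x + t *\<^sub>R y) \<bullet> (A *v (x + t *\<^sub>R y)) - \<mu> * ((x + t *\<^sub>R y) \<bullet> (x + t *\<^sub>R y)) \<le> 0"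
      by simp
    also have "(x + t *\<^sub>R y) \<bullet> (A *v (x + t *\<^sub>R y)) - \<mu> * ((x + t *\<^sub>R y) \<bullet> (x + t *\<^sub>R y))
      = 2 * t * (y \<bullet> (A *v x) - \<mu> * (y \<bullet> x)) + t\<^sup>2 * (y \<bullet> (A *v y) - \<mu> * (y \<bullet> y))"
      using sym_mat_inner[OF A, of x y] xS(2)
      by (simp add: algebra_simps inner_add_left inner_add_right matrix_vector_mult_scaleR
          matrix_vector_right_distrib power2_eq_square inner_commute \<mu>_def)
    also have "y \<bullet> (A *v x) - \<mu> * (y \<bullet> x) = y \<bullet> y"
      by (simp add: y_def[of] inner_diff_right)
    finally show ?thesis .
  qed
  then have "y \<bullet> y = 0" by (rule quadratic_nonpos_imp_zero)
  then have "A *v x = \<mu> *\<^sub>R x" by (simp add: y_def)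
  then show ?thesis using x by auto
qed

text \<open>A maximal orthonormal set of eigenvectors spans: its orthogonal complement is invariant.\<close>

theorem sym_mat_eigenbasis:
  fixes A :: "real^'n^'n"
  assumes A: "sym_mat A"
  shows "\<exists>v l. eigenbasis A v l"
proof -
  define P where "P = (\<lambda>B. pairwise orthogonal B \<and> (\<forall>x\<in>B. norm x = 1 \<and> (\<exists>\<mu>. A *v x = \<mu> *\<^sub>R x)))"
  have ind: "independent B" if "P B" for B
    using that by (intro pairwise_orthogonal_independent) (auto simp: P_def)
  have bnd: "finite B \<and> card B \<le> CARD('n)" if "P B" for B
    using independent_bound[OF ind[OF that]] by simp
  have "P {}" by (simp add: P_def pairwise_def)
  then have "\<exists>B. P B \<and> (\<forall>B'. P B' \<longrightarrow> card B' \<le> card B)"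
    using bnd by (intro ex_has_greatest_nat[of P "{}" card "Suc CARD('n)"]) (auto simp: less_Suc_eq_le)
  then obtain B where B: "P B" and max: "\<And>B'. P B' \<Longrightarrow> card B' \<le> card B"
    by blast
  have card: "card B = CARD('n)"
  proof (rule ccontr)
    assume "card B \<noteq> CARD('n)"
    then have "dim B < DIM(real^'n)"
      using bnd[OF B] ind[OF B] by (simp add: dim_eq_card_independent)
    then obtain z where z: "z \<noteq> 0" "\<And>y. y \<in> span B \<Longrightarrow> orthogonal z y"
      using orthogonal_to_subspace_exists by blast
    define S where "S = {x. \<forall>b\<in>B. orthogonal b x}"
    have S: "subspace S"
      by (auto simp: S_def subspace_def orthogonal_def inner_add_right)
    have "z \<in> S" using z by (auto simp: S_def orthogonal_commute span_base)
    moreover have "A *v x \<in> S" if "x \<in> S" for x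
      unfolding S_def
    proof safe
      fix b assume b: "b \<in> B"
      obtain \<mu> where "A *v b = \<mu> *\<^sub>R b" using B b unfolding P_def by blast
      then show "orthogonal b (A *v x)"
        using that b by (simp add: S_def orthogonal_def sym_mat_inner[OF A])
    qed
    ultimately obtain x where x: "x \<in> S" "norm x = 1" "\<exists>\<mu>. A *v x = \<mu> *\<^sub>R x"
      using sym_mat_eigenvector_in_subspace[OF A S] z(1) by blast
    have "P (insert x B)"
      using B x unfolding P_def S_def by (auto simp: pairwise_insert orthogonal_commute)
    moreover have "x \<notin> B"
      using x by (auto simp: S_def orthogonal_def)
    ultimately show False using max[of "insert x B"] bnd[OF B] by auto
  qed
  obtain v where v: "bij_betw v (UNIV :: 'n set) B"
    using finite_same_card_bij[of "UNIV :: 'n set" B] bnd[OF B] card by auto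
  have "v i \<bullet> v j = (if i = j then 1 else 0)" for i j
  proof -
    have "v i \<in> B" "v j \<in> B" using v by (auto simp: bij_betw_def)
    moreover have "i \<noteq> j \<Longrightarrow> v i \<noteq> v j" using v by (auto simp: bij_betw_def inj_eq)
    ultimately show ?thesis using B by (auto simp: P_def pairwise_def orthogonal_def norm_eq_1)
  qed
  moreover have "\<forall>i. \<exists>\<mu>. A *v v i = \<mu> *\<^sub>R v i"
    using v B by (auto simp: P_def bij_betw_def)
  then obtain l where "\<forall>i. A *v v i = l i *\<^sub>R v i" by metis
  ultimately show ?thesis unfolding eigenbasis_def by blast
qed

lemma eigenbasis_orthogonal_matrix:
  assumes "eigenbasis A v l"
  shows "orthogonal_matrix (\<chi> i. v i)"
  unfolding orthogonal_matrix_orthonormal_rows using assms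
  by (simp add: eigenbasis_def row_def norm_eq_1 orthogonal_def vec_nth_inverse)

lemma eigenbasis_parseval:
  fixes v :: "'n::finite \<Rightarrow> real^'n"
  assumes "eigenbasis A v l"
  shows "(\<Sum>i\<in>UNIV. (v i \<bullet> x)\<^sup>2) = x \<bullet> x"
proof -
  let ?V = "\<chi> i. v i"
  have "orthogonal_transformation (\<lambda>x. ?V *v x)"
    using eigenbasis_orthogonal_matrix[OF assms]
    by (simp add: orthogonal_transformation_matrix)
  then have "(?V *v x) \<bullet> (?V *v x) = x \<bullet> x"
    by (simp add: orthogonal_transformation_def)
  then show ?thesis
    by (simp add: inner_vec_def[of "?V *v x"] matrix_vector_mul_component power2_eq_square)
qed

lemma eigenbasis_expand:
  fixes v :: "'n::finite \<Rightarrow> real^'n"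
  assumes "eigenbasis A v l"
  shows "(\<Sum>i\<in>UNIV. (v i \<bullet> x) *\<^sub>R v i) = x"
proof -
  define y where "y = x - (\<Sum>i\<in>UNIV. (v i \<bullet> x) *\<^sub>R v i)"
  have "v j \<bullet> y = 0" for j
  proof -
    have "v j \<bullet> (\<Sum>i\<in>UNIV. (v i \<bullet> x) *\<^sub>R v i) = (\<Sum>i\<in>UNIV. if j = i then v i \<bullet> x else 0)"
      using assms by (simp add: eigenbasis_def inner_sum_right mult_delta_right)
    then show ?thesis by (simp add: y_def inner_diff_right)
  qed
  then have "y \<bullet> y = 0" using eigenbasis_parseval[OF assms, of y] by simp
  then show ?thesis by (simp add: y_def)
qed

text \<open>This spectral decomposition lets a positive semidefinite matrix be added to an element
  of the cone one rank-one term at a time.\<close>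

lemma eigenbasis_eq_sum_outer:
  fixes v :: "'n::finite \<Rightarrow> real^'n"
  assumes "eigenbasis A v l"
  shows "A = (\<Sum>i\<in>UNIV. l i *\<^sub>R outer (v i))"
proof -
  have 1: "(\<Sum>i\<in>I. l i *\<^sub>R outer (v i)) *v x = (\<Sum>i\<in>I. (l i * (v i \<bullet> x)) *\<^sub>R v i)" for x and I :: "'n set"
    by (induction I rule: infinite_finite_induct)
      (simp_all add: matrix_vector_mult_add_rdistrib scaleR_mult_vec outer_mult_vec)
  have "A *v x = (\<Sum>i\<in>UNIV. (l i * (v i \<bullet> x)) *\<^sub>R v i)" for x
  proof -
    have "A *v x = A *v (\<Sum>i\<in>UNIV. (v i \<bullet> x) *\<^sub>R v i)" by (simp only: eigenbasis_expand[OF assms])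
    also have "\<dots> = (\<Sum>i\<in>UNIV. (v i \<bullet> x) *\<^sub>R (A *v v i))"
      by (simp add: linear_sum[OF matrix_vector_mul_linear] matrix_vector_mult_scaleR)
    also have "\<dots> = (\<Sum>i\<in>UNIV. (l i * (v i \<bullet> x)) *\<^sub>R v i)"
      using assms by (simp add: eigenbasis_def mult.commute)
    finally show ?thesis .
  qed
  then show ?thesis unfolding matrix_eq 1 by blast
qed

section \<open>Determinants in an orthonormal basis and under rank-one perturbations\<close>

lemma matrix_component_eq: "M $ i $ j = axis i 1 \<bullet> (M *v axis j 1)" for M :: "real^'n^'n"
  by (simp add: inner_axis' matrix_vector_mult_basis column_def)

text \<open>Here \<open>A\<close> only supplies the orthonormal basis \<open>v\<close>, while
  \<open>M\<close> is arbitrary: the right-hand matrix is \<open>M\<close> conjugated by the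
  orthogonal matrix with rows \<open>v i\<close>.\<close>

lemma det_in_orthonormal_basis:
  fixes v :: "'n::finite \<Rightarrow> real^'n"
  assumes "eigenbasis A v l"
  shows "det M = det (\<chi> i j. v i \<bullet> (M *v v j))"
proof -
  let ?V = "\<chi> i. v i"
  have V: "?V ** transpose ?V = mat 1"
    using eigenbasis_orthogonal_matrix[OF assms] by (simp add: orthogonal_matrix_def)
  have "transpose ?V *v axis j 1 = v j" for j
    by (simp only: matrix_vector_mult_basis column_transpose) (simp add: row_def vec_nth_inverse)
  then have "(?V ** M ** transpose ?V) $ i $ j = v i \<bullet> (M *v v j)" for i j
    by (simp only: matrix_component_eq matrix_vector_mul_assoc[symmetric])
      (simp add: inner_axis' matrix_vector_mul_component)
  then have "(\<chi> i j. v i \<bullet> (M *v v j)) = ?V ** M ** transpose ?V"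
    by (simp add: vec_eq_iff)
  moreover have "det (?V ** M ** transpose ?V) = det (?V ** transpose ?V) * det M"
    by (simp only: det_mul mult_ac)
  ultimately show ?thesis by (simp only: V) simp
qed

text \<open>In an orthonormal basis whose \<open>k\<close>-th vector points along \<open>a\<close>
  the matrix is diagonal, with a single entry different from 1.\<close>

lemma det_mat_add_outer:
  fixes a :: "real^'n"
  shows "det (mat 1 + s *\<^sub>R outer a) = 1 + s * (a \<bullet> a)"
proof (cases "a = 0")
  case True
  then show ?thesis by (simp add: outer_def) (simp add: zero_vec_def[symmetric])
next
  case False
  fix k :: 'n
  define e where "e = (1 / norm a) *\<^sub>R a"
  have "norm e = 1" using False by (simp add: e_def)
  then obtain Q where Q: "orthogonal_matrix Q" "Q *v axis k 1 = e"
    using orthogonal_matrix_exists_basis by blast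
  define v where "v = (\<lambda>i. Q *v axis i 1)"
  have "orthogonal_transformation (\<lambda>x. Q *v x)"
    using Q(1) by (simp add: orthogonal_transformation_matrix)
  then have on: "v i \<bullet> v j = (if i = j then 1 else 0)" for i j
    by (simp add: v_def orthogonal_transformation_def inner_axis_axis)
  then have eb: "eigenbasis (mat 1) v (\<lambda>_. 1)"
    by (simp add: eigenbasis_def)
  have a: "a = norm a *\<^sub>R v k" using False by (simp add: v_def Q(2) e_def)
  have va: "v i \<bullet> a = (if i = k then norm a else 0)" for i
    by (subst a) (simp add: on)
  then have av: "a \<bullet> v i = (if i = k then norm a else 0)" for i
    by (simp add: inner_commute)
  have aa: "a \<bullet> a = norm a * norm a"
    by (metis power2_norm_eq_inner power2_eq_square)
  have Mv: "(mat 1 + s *\<^sub>R outer a) *v y = y + (s * (a \<bullet> y)) *\<^sub>R a" for y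
    by (simp only: matrix_vector_mult_add_rdistrib scaleR_mult_vec outer_mult_vec matrix_vector_mul_lid scaleR_scaleR)
  have "v i \<bullet> ((mat 1 + s *\<^sub>R outer a) *v v j)
      = (if i = j then (if i = k then 1 + s * (a \<bullet> a) else 1) else 0)" for i j
    unfolding Mv by (simp add: inner_add_right on va av) (simp add: aa)
  then have "det (mat 1 + s *\<^sub>R outer a)
      = det ((\<chi> i j. if i = j then (if i = k then 1 + s * (a \<bullet> a) else 1) else 0) :: real^'n^'n)"
    unfolding det_in_orthonormal_basis[OF eb, of "mat 1 + s *\<^sub>R outer a"] by simp
  also have "\<dots> = (\<Prod>i\<in>UNIV. if i = k then 1 + s * (a \<bullet> a) else 1)"
    by (subst det_diagonal) auto
  finally show ?thesis by simp
qed

text \<open>Factoring out the square root of the diagonal on both sides reduces this to the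
  perturbed identity, which is why the diagonal must be positive; the result itself contains no
  division.\<close>

lemma det_diag_rank_one:
  fixes d w :: "'n::finite \<Rightarrow> real"
  assumes d: "\<And>i. d i > 0"
  shows "det ((\<chi> i j. (if i = j then d i else 0) + s * w i * w j) :: real^'n^'n)
    = (\<Prod>i\<in>UNIV. d i) + s * (\<Sum>i\<in>UNIV. (w i)\<^sup>2 * (\<Prod>j\<in>UNIV - {i}. d j))"
proof -
  have dn: "d i \<noteq> 0" "0 \<le> d i" for i using d[of i] by auto
  define D :: "real^'n^'n" where "D = (\<chi> i j. if i = j then sqrt (d i) else 0)"
  define a :: "real^'n" where "a = (\<chi> i. w i / sqrt (d i))"
  have DM: "(D ** M) $ i $ j = sqrt (d i) * M $ i $ j" for M :: "real^'n^'n" and i j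
    by (simp add: D_def matrix_matrix_mult_def mult_delta_left)
  have MD: "(M ** D) $ i $ j = M $ i $ j * sqrt (d j)" for M :: "real^'n^'n" and i j
    by (simp add: D_def matrix_matrix_mult_def mult_delta_right)
  have "(\<chi> i j. (if i = j then d i else 0) + s * w i * w j) = D ** (mat 1 + s *\<^sub>R outer a) ** D"
  proof -
    have "sqrt (d i) * ((if i = j then 1 else 0) + s * (w i / sqrt (d i) * (w j / sqrt (d j)))) * sqrt (d j)
        = (if i = j then d i else 0) + s * w i * w j" for i j
    proof -
      have "sqrt (d i) \<noteq> 0" "sqrt (d j) \<noteq> 0" "sqrt (d j) * sqrt (d j) = d j"
        using dn by auto
      then show ?thesis by (simp add: distrib_left distrib_right)
    qed
    then show ?thesis by (simp add: vec_eq_iff DM MD mat_def outer_def a_def)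
  qed
  then have "det (\<chi> i j. (if i = j then d i else 0) + s * w i * w j)
      = det D * det D * (1 + s * (a \<bullet> a))"
    by (simp add: det_mul det_mat_add_outer mult_ac)
  also have "det D = (\<Prod>i\<in>UNIV. sqrt (d i))"
    unfolding D_def by (subst det_diagonal) auto
  also have "(\<Prod>i\<in>UNIV. sqrt (d i)) * (\<Prod>i\<in>UNIV. sqrt (d i)) = (\<Prod>i\<in>UNIV. d i)"
    using dn by (simp add: prod.distrib[symmetric])
  also have "a \<bullet> a = (\<Sum>i\<in>UNIV. (w i)\<^sup>2 / d i)"
    using dn by (simp add: inner_vec_def a_def power2_eq_square)
  also have "(\<Prod>i\<in>UNIV. d i) * (1 + s * (\<Sum>i\<in>UNIV. (w i)\<^sup>2 / d i))
      = (\<Prod>i\<in>UNIV. d i) + s * (\<Sum>i\<in>UNIV. (w i)\<^sup>2 * ((\<Prod>i\<in>UNIV. d i) / d i))"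
    by (simp add: algebra_simps sum_distrib_left sum_divide_distrib)
  also have "(\<Sum>i\<in>UNIV. (w i)\<^sup>2 * ((\<Prod>i\<in>UNIV. d i) / d i))
      = (\<Sum>i\<in>UNIV. (w i)\<^sup>2 * (\<Prod>j\<in>UNIV - {i}. d j))"
    using dn by (intro sum.cong refl) (simp add: prod_diff1)
  finally show ?thesis .
qed

lemma poly_det: "poly (det M) x = det (\<chi> i j. poly (M $ i $ j) x)"
  for M :: "real poly^'n^'n"
  by (simp add: det_def poly_sum poly_prod)

lemma poly_charpoly: "poly (charpoly M) x = det (mat x - M)"
proof -
  have "(\<chi> i j. poly ((\<chi> i j. (if i = j then [:0, 1:] else 0) - [:M $ i $ j:]) $ i $ j) x) = mat x - M"
    by (simp add: vec_eq_iff mat_def)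
  then show ?thesis by (simp add: charpoly_def poly_det)
qed

section \<open>The cone of the Hessian operator\<close>

lemma sigma_eq_esym: "sigma k l = esym UNIV k (\<lambda>i. l $ i)"
  by (simp add: sigma_def esym_def)

lemma det_mat_add_eigenbasis:
  fixes v :: "'n::finite \<Rightarrow> real^'n"
  assumes "eigenbasis A v l"
  shows "det (mat t + A) = (\<Prod>i\<in>UNIV. l i + t)"
proof -
  have "v i \<bullet> ((mat t + A) *v v j) = (if i = j then l i + t else 0)" for i j
    using assms by (auto simp: eigenbasis_def matrix_vector_mult_add_rdistrib mat_mult_vec inner_add_right)
  then show ?thesis
    unfolding det_in_orthonormal_basis[OF assms, of "mat t + A"] by (subst det_diagonal) auto
qed

lemma charpoly_eq_prod:
  fixes v :: "'n::finite \<Rightarrow> real^'n"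
  assumes "eigenbasis A v l"
  shows "charpoly A = (\<Prod>i\<in>UNIV. [:- l i, 1:])"
proof -
  have "poly (charpoly A) x = poly (\<Prod>i\<in>UNIV. [:- l i, 1:]) x" for x
  proof -
    have "v i \<bullet> ((mat x - A) *v v j) = (if i = j then x - l i else 0)" for i j
      using assms by (auto simp: eigenbasis_def matrix_vector_mult_diff_rdistrib mat_mult_vec inner_diff_right)
    then show ?thesis
      unfolding poly_charpoly det_in_orthonormal_basis[OF assms, of "mat x - A"]
      by (subst det_diagonal) (auto simp: poly_prod)
  qed
  then show ?thesis by (simp add: poly_eq_poly_eq_iff[symmetric] fun_eq_iff)
qed

text \<open>\<open>eigvals\<close> picks some ordering of the eigenvalues, so only their product
  polynomial is known. This suffices, as the \<open>Sk j A\<close> are the coefficients of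
  \<open>det (mat t + A)\<close>.\<close>

lemma det_mat_add_eq_Sk:
  fixes A :: "real^'n^'n"
  assumes "sym_mat A"
  shows "det (mat t + A) = (\<Sum>j\<le>CARD('n). Sk j A * t ^ (CARD('n) - j))"
proof -
  obtain v l where ev: "eigenbasis A v l" using sym_mat_eigenbasis[OF assms] by blast
  then have "charpoly A = (\<Prod>i\<in>UNIV. [:- ((\<chi> i. l i) $ i), 1:])"
    by (simp add: charpoly_eq_prod)
  then have "charpoly A = (\<Prod>i\<in>UNIV. [:- (eigvals A $ i), 1:])"
    unfolding eigvals_def by (rule someI)
  then have "(\<Prod>i\<in>UNIV. [:- l i, 1:]) = (\<Prod>i\<in>UNIV. [:- (eigvals A $ i), 1:])"
    using charpoly_eq_prod[OF ev] by simp
  \<comment> \<open>At \<open>- t\<close> every factor is \<open>- (l i + t)\<close>, and the common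
    sign cancels from the two products.\<close>
  then have "poly (\<Prod>i\<in>UNIV. [:- l i, 1:]) (- t) = poly (\<Prod>i\<in>UNIV. [:- (eigvals A $ i), 1:]) (- t)"
    by simp
  then have "(\<Prod>i\<in>UNIV. - 1 * (l i + t)) = (\<Prod>i\<in>UNIV. - 1 * (eigvals A $ i + t))"
    by (simp add: poly_prod algebra_simps)
  then have "(\<Prod>i\<in>UNIV. l i + t) = (\<Prod>i\<in>UNIV. eigvals A $ i + t)"
    unfolding prod.distrib by simp
  then show ?thesis
    unfolding det_mat_add_eigenbasis[OF ev] by (simp add: prod_add_eq_esym Sk_def sigma_eq_esym)
qed

text \<open>Equality is required for large \<open>t\<close> only, since the determinant formula is
  available only once all \<open>l i + t\<close> are positive.\<close>

lemma real_poly_coeffs_eq: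
  fixes a b :: "nat \<Rightarrow> real"
  assumes "\<And>t. t > T \<Longrightarrow> (\<Sum>j\<le>n. a j * t ^ (n - j)) = (\<Sum>j\<le>n. b j * t ^ (n - j))" "j \<le> n"
  shows "a j = b j"
proof -
  define p where "p = (\<Sum>i\<le>n. monom (a (n - i) - b (n - i)) i)"
  have "poly p t = 0" if "t > T" for t
  proof -
    have rev: "(\<Sum>j\<le>n. c j * t ^ (n - j)) = (\<Sum>i\<le>n. c (n - i) * t ^ i)" for c :: "nat \<Rightarrow> real"
      by (rule sum.reindex_bij_witness[of _ "\<lambda>i. n - i" "\<lambda>i. n - i"]) auto
    show ?thesis
      using assms(1)[OF that] unfolding rev
      by (simp add: p_def poly_sum poly_monom algebra_simps sum_subtractf)
  qed
  then have "{T<..} \<subseteq> {t. poly p t = 0}" by auto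
  then have "p = 0" using poly_roots_finite[of p] infinite_Ioi[of T] finite_subset by blast
  then have "coeff p (n - j) = 0" by simp
  moreover have "coeff p (n - j) = a j - b j"
    using assms(2) by (simp add: p_def coeff_sum)
  ultimately show ?thesis by simp
qed

text \<open>First order perturbation by a rank-one matrix is exact, since the determinant is affine along it.\<close>

lemma Sk_add_outer:
  fixes v :: "'n::finite \<Rightarrow> real^'n"
  assumes ev: "eigenbasis A v l" and A: "sym_mat A" and k: "Suc k \<le> CARD('n)"
  shows "Sk (Suc k) (A + s *\<^sub>R outer x)
    = esym UNIV (Suc k) l + s * (\<Sum>i\<in>UNIV. (v i \<bullet> x)\<^sup>2 * esym (UNIV - {i}) k l)"
proof -
  \<comment> \<open>Beyond this bound every shifted eigenvalue \<open>l i + t\<close> is positive.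
    The sequence \<open>b\<close> collects the claimed coefficients, the leading one being
    1.\<close>
  define T where "T = (\<Sum>i\<in>UNIV. \<bar>l i\<bar>)"
  define b where "b = (\<lambda>j. case j of 0 \<Rightarrow> 1
    | Suc k \<Rightarrow> esym UNIV (Suc k) l + s * (\<Sum>i\<in>UNIV. (v i \<bullet> x)\<^sup>2 * esym (UNIV - {i}) k l))"
  obtain m where m: "CARD('n) = Suc m" using k by (cases "CARD('n)") auto
  have "(\<Sum>j\<le>CARD('n). Sk j (A + s *\<^sub>R outer x) * t ^ (CARD('n) - j))
      = (\<Sum>j\<le>CARD('n). b j * t ^ (CARD('n) - j))" if t: "t > T" for t
  proof -
    have pos: "l i + t > 0" for i
    proof -
      have "\<bar>l i\<bar> \<le> T" unfolding T_def by (rule member_le_sum) auto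
      then show ?thesis using t by linarith
    qed
    have "(\<Sum>j\<le>CARD('n). Sk j (A + s *\<^sub>R outer x) * t ^ (CARD('n) - j)) = det (mat t + (A + s *\<^sub>R outer x))"
      by (rule det_mat_add_eq_Sk[symmetric]) (intro sym_mat_add A sym_mat_scaleR sym_mat_outer)
    also have "\<dots> = det (\<chi> i j. (if i = j then l i + t else 0) + s * (v i \<bullet> x) * (v j \<bullet> x))"
    proof -
      have "v i \<bullet> ((mat t + (A + s *\<^sub>R outer x)) *v v j)
          = (if i = j then l i + t else 0) + s * (v i \<bullet> x) * (v j \<bullet> x)" for i j
        using ev by (auto simp: eigenbasis_def matrix_vector_mult_add_rdistrib mat_mult_vec inner_add_right
            scaleR_mult_vec outer_mult_vec inner_commute[of x "v _"])
      then show ?thesis unfolding det_in_orthonormal_basis[OF ev, of "mat t + _"] by simp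
    qed
    also have "\<dots> = (\<Prod>i\<in>UNIV. l i + t) + s * (\<Sum>i\<in>UNIV. (v i \<bullet> x)\<^sup>2 * (\<Prod>j\<in>UNIV - {i}. l j + t))"
      using pos by (rule det_diag_rank_one)
    also have "(\<Prod>i\<in>UNIV. l i + t) = t ^ Suc m + (\<Sum>j\<le>m. esym UNIV (Suc j) l * t ^ (m - j))"
      by (simp add: prod_add_eq_esym m sum.atMost_Suc_shift del: sum.atMost_Suc)
    also have "(\<Sum>i\<in>UNIV. (v i \<bullet> x)\<^sup>2 * (\<Prod>j\<in>UNIV - {i}. l j + t))
        = (\<Sum>i\<in>UNIV. \<Sum>j\<le>m. (v i \<bullet> x)\<^sup>2 * esym (UNIV - {i}) j l * t ^ (m - j))"
      by (simp add: prod_add_eq_esym m sum_distrib_left mult.assoc)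
    also have "\<dots> = (\<Sum>j\<le>m. (\<Sum>i\<in>UNIV. (v i \<bullet> x)\<^sup>2 * esym (UNIV - {i}) j l) * t ^ (m - j))"
      by (subst sum.swap) (simp add: sum_distrib_right)
    also have "t ^ Suc m + (\<Sum>j\<le>m. esym UNIV (Suc j) l * t ^ (m - j)) + s * \<dots>
        = (\<Sum>j\<le>CARD('n). b j * t ^ (CARD('n) - j))"
      by (simp add: m sum.atMost_Suc_shift b_def sum.distrib sum_distrib_left algebra_simps del: sum.atMost_Suc)
    finally show ?thesis .
  qed
  from real_poly_coeffs_eq[OF this k] show ?thesis by (simp add: b_def)
qed

text \<open>The rank-one formula with \<open>s = 0\<close> replaces the chosen
  \<open>eigvals\<close> by the eigenvalues of any given eigenbasis.\<close>

lemma Sk_eigenbasis: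
  fixes v :: "'n::finite \<Rightarrow> real^'n"
  assumes ev: "eigenbasis A v l" and A: "sym_mat A" and k: "1 \<le> k" "k \<le> CARD('n)"
  shows "Sk k A = esym UNIV k l"
  using Sk_add_outer[OF ev A, of "k - 1" 0] k by simp

text \<open>The weak inequalities follow from membership in \<open>closure (Gamma k)\<close> and,
  unlike a closure, can be verified directly from formulas for \<open>Sk\<close>. Symmetry is
  included because every use diagonalises.\<close>

definition k_cone :: "nat \<Rightarrow> (real^'n^'n) set" where
  "k_cone k = {A. sym_mat A \<and> (\<forall>j. 1 \<le> j \<and> j \<le> k \<longrightarrow> 0 \<le> Sk j A)}"

lemma k_cone_sym: "A \<in> k_cone k \<Longrightarrow> sym_mat A"
  by (simp add: k_cone_def)

lemma k_cone_esym:
  fixes v :: "'n::finite \<Rightarrow> real^'n"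
  assumes "A \<in> k_cone k" "k \<le> CARD('n)" "eigenbasis A v l" "1 \<le> j" "j \<le> k"
  shows "0 \<le> esym UNIV j l"
  using assms Sk_eigenbasis[of A v l j] by (auto simp: k_cone_def)

lemma k_coneI:
  fixes A :: "real^'n^'n"
  assumes "sym_mat A" "eigvals A \<in> closure (Gamma k)"
  shows "A \<in> k_cone k"
proof -
  have "0 \<le> Sk j A" if "1 \<le> j" "j \<le> k" for j
  proof -
    have "closed {l :: real^'n. 0 \<le> sigma j l}"
      unfolding sigma_def by (intro closed_Collect_le continuous_intros)
    moreover have "Gamma k \<subseteq> {l :: real^'n. 0 \<le> sigma j l}"
      using that by (auto simp: Gamma_def less_imp_le)
    ultimately have "closure (Gamma k) \<subseteq> {l :: real^'n. 0 \<le> sigma j l}"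
      by (rule closure_minimal[rotated])
    then show ?thesis using assms(2) by (auto simp: Sk_def)
  qed
  then show ?thesis using assms(1) by (simp add: k_cone_def)
qed

section \<open>Stability of the cone under shifts and rank-one terms\<close>

lemma eigenbasis_add_mat:
  assumes "eigenbasis A v l"
  shows "eigenbasis (A + mat c) v (\<lambda>i. l i + c)"
  using assms
  by (simp add: eigenbasis_def matrix_vector_mult_add_rdistrib mat_mult_vec scaleR_left_distrib)

text \<open>The quantitative form of strict admissibility: a leftover multiple of the identity
  yields the lower bound for \<open>Sk k\<close> that beats the right-hand side of the
  equation.\<close>

lemma Sk_add_mat_ge:
  fixes A :: "real^'n^'n"
  assumes "A \<in> k_cone k" "1 \<le> k" "k \<le> CARD('n)" "t > 0"
  shows "t ^ k / fact k \<le> Sk k (A + mat t)"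
proof -
  obtain v l where ev: "eigenbasis A v l" using sym_mat_eigenbasis k_cone_sym assms(1) by blast
  have "Sk k (A + mat t) = esym UNIV k (\<lambda>i. l i + t)"
    using assms k_cone_sym by (intro Sk_eigenbasis[OF eigenbasis_add_mat[OF ev]] sym_mat_add) auto
  then show ?thesis
    using esym_shift_ge[of UNIV k l t] k_cone_esym[OF assms(1,3) ev] assms(3,4) by simp
qed

text \<open>Let the shift in \<open>esym_remove_shift_pos\<close> tend to 0 from the right.\<close>

lemma esym_remove_nonneg:
  fixes x :: "'a \<Rightarrow> real"
  assumes S: "finite S" "i \<in> S" "Suc k \<le> card S"
    and x: "\<And>j. 1 \<le> j \<Longrightarrow> j \<le> Suc k \<Longrightarrow> 0 \<le> esym S j x"
  shows "0 \<le> esym (S - {i}) k x"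
proof -
  let ?p = "poly (esym_poly (S - {i}) k x)"
  have "(?p \<longlongrightarrow> ?p 0) (at_right 0)"
    by (intro tendsto_intros)
  moreover have "eventually (\<lambda>t. 0 \<le> ?p t) (at_right 0)"
    using esym_remove_shift_pos[OF S x] unfolding poly_esym_poly
    by (auto simp: eventually_at_right_field intro!: exI[of _ 1] less_imp_le)
  ultimately have "0 \<le> ?p 0" by (intro tendsto_lowerbound) auto
  then show ?thesis by (simp add: poly_esym_poly)
qed

lemma k_cone_add_outer:
  fixes A :: "real^'n^'n"
  assumes A: "A \<in> k_cone k" and k: "k \<le> CARD('n)" and s: "0 \<le> s"
  shows "A + s *\<^sub>R outer x \<in> k_cone k"
proof -
  obtain v l where ev: "eigenbasis A v l" using sym_mat_eigenbasis k_cone_sym A by blast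
  have "0 \<le> Sk j (A + s *\<^sub>R outer x)" if j: "1 \<le> j" "j \<le> k" for j
  proof -
    obtain m where m: "j = Suc m" using j by (cases j) auto
    have "0 \<le> esym (UNIV - {i}) m l" for i
      using j k k_cone_esym[OF A k ev] unfolding m by (intro esym_remove_nonneg) auto
    then have "0 \<le> s * (\<Sum>i\<in>UNIV. (v i \<bullet> x)\<^sup>2 * esym (UNIV - {i}) m l)"
      using s by (intro mult_nonneg_nonneg sum_nonneg) auto
    moreover have "0 \<le> esym UNIV (Suc m) l"
      using j k_cone_esym[OF A k ev, of "Suc m"] m by auto
    ultimately show ?thesis
      using j k unfolding m by (subst Sk_add_outer[OF ev k_cone_sym[OF A]]) auto
  qed
  then show ?thesis
    using k_cone_sym[OF A] by (simp add: k_cone_def sym_mat_add sym_mat_scaleR)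
qed

lemma k_cone_add_psd:
  fixes A :: "real^'n^'n"
  assumes A: "A \<in> k_cone k" and k: "k \<le> CARD('n)" and P: "sym_mat P" "\<And>x. 0 \<le> x \<bullet> (P *v x)"
  shows "A + P \<in> k_cone k"
proof -
  obtain v l where ev: "eigenbasis P v l" using sym_mat_eigenbasis P(1) by blast
  have l: "0 \<le> l i" for i
    using P(2)[of "v i"] ev by (simp add: eigenbasis_def)
  have "A + (\<Sum>i\<in>I. l i *\<^sub>R outer (v i)) \<in> k_cone k" if "finite I" for I
    using that
  proof (induction I rule: finite_induct)
    case (insert i I)
    then show ?case
      using k_cone_add_outer[OF insert.IH k l[of i], of "v i"] by (simp add: algebra_simps)
  qed (use A in simp)
  then show ?thesis using eigenbasis_eq_sum_outer[OF ev] by (metis finite)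
qed

text \<open>After the shift by \<open>c\<close>, \<open>esym_shift_ge_remove\<close> bounds each
  coefficient in the rank-one formula by \<open>E / q\<close>. By Parseval the weights add up to
  \<open>x \<bullet> x\<close>, so the amount subtracted is at most
  \<open>c * g * (x \<bullet> x) * E / q \<le> E\<close>.\<close>

lemma k_cone_add_mat_diff_outer:
  fixes A :: "real^'n^'n"
  assumes A: "A \<in> k_cone k" and k: "k \<le> CARD('n)" and c: "0 < c" and g: "0 \<le> g"
    and gx: "g * (x \<bullet> x) \<le> CARD('n) / k"
  shows "A + mat c - (c * g) *\<^sub>R outer x \<in> k_cone k"
proof -
  obtain v l where ev: "eigenbasis A v l" using sym_mat_eigenbasis k_cone_sym A by blast
  have sym: "sym_mat (A + mat c)" using k_cone_sym[OF A] by (intro sym_mat_add) auto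
  let ?l = "\<lambda>i. l i + c"
  have "0 \<le> Sk j (A + mat c + (- c * g) *\<^sub>R outer x)" if j: "1 \<le> j" "j \<le> k" for j
  proof -
    obtain m where m: "j = Suc m" using j by (cases j) auto
    define q where "q = (CARD('n) / Suc m) * c"
    define E where "E = esym UNIV (Suc m) ?l"
    have q: "q > 0" using c by (simp add: q_def)
    have le: "q * esym (UNIV - {i}) m ?l \<le> E" for i
      using j k k_cone_esym[OF A k ev] c unfolding m q_def E_def
      by (intro esym_shift_ge_remove) auto
    have E: "0 \<le> E"
    proof -
      have "c ^ Suc m / fact (Suc m) \<le> E"
        unfolding E_def using j k k_cone_esym[OF A k ev] c unfolding m by (intro esym_shift_ge) auto
      moreover have "0 \<le> c ^ Suc m / fact (Suc m)" using c by simp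
      ultimately show ?thesis by linarith
    qed
    have "q * (\<Sum>i\<in>UNIV. (v i \<bullet> x)\<^sup>2 * esym (UNIV - {i}) m ?l)
        = (\<Sum>i\<in>UNIV. (v i \<bullet> x)\<^sup>2 * (q * esym (UNIV - {i}) m ?l))"
      by (simp add: sum_distrib_left mult_ac)
    also have "\<dots> \<le> (\<Sum>i\<in>UNIV. (v i \<bullet> x)\<^sup>2 * E)"
      using le by (intro sum_mono mult_left_mono) auto
    also have "\<dots> = (x \<bullet> x) * E"
      by (simp add: sum_distrib_right[symmetric] eigenbasis_parseval[OF ev])
    finally have 1: "q * (\<Sum>i\<in>UNIV. (v i \<bullet> x)\<^sup>2 * esym (UNIV - {i}) m ?l) \<le> (x \<bullet> x) * E" .
    \<comment> \<open>The order \<open>j = k\<close> is the most restrictive one.\<close>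
    have "real CARD('n) / k \<le> real CARD('n) / Suc m"
      using j m by (intro divide_left_mono) auto
    then have "c * (g * (x \<bullet> x)) \<le> c * (real CARD('n) / Suc m)"
      using gx c by (intro mult_left_mono) auto
    then have 2: "c * g * (x \<bullet> x) \<le> q" by (simp add: q_def mult_ac)
    have "q * (c * g * (\<Sum>i\<in>UNIV. (v i \<bullet> x)\<^sup>2 * esym (UNIV - {i}) m ?l))
        = c * g * (q * (\<Sum>i\<in>UNIV. (v i \<bullet> x)\<^sup>2 * esym (UNIV - {i}) m ?l))" by simp
    also have "\<dots> \<le> c * g * ((x \<bullet> x) * E)" using 1 c g by (intro mult_left_mono) auto
    also have "\<dots> \<le> q * E" using mult_right_mono[OF 2 E] by (simp add: mult_ac)
    finally have "c * g * (\<Sum>i\<in>UNIV. (v i \<bullet> x)\<^sup>2 * esym (UNIV - {i}) m ?l) \<le> E"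
      using q by simp
    then show ?thesis
      using j k unfolding m
      by (subst Sk_add_outer[OF eigenbasis_add_mat[OF ev] sym]) (auto simp: E_def)
  qed
  then show ?thesis
    using sym by (simp add: k_cone_def sym_mat_diff sym_mat_scaleR)
qed

section \<open>The cone and matrices shaped like the Hessian of the barrier\<close>

lemma esym_const:
  assumes "finite S"
  shows "esym S k (\<lambda>_. c) = of_nat (card S choose k) * c ^ k"
  unfolding esym_def using n_subsets[OF assms, of k] by simp

text \<open>For \<open>c > 0\<close> the last factor shows that the threshold \<open>n / k\<close>
  is sharp: past it the value is negative.\<close>

lemma Sk_mat_diff_outer:
  fixes x :: "real^'n"
  assumes k: "Suc k \<le> CARD('n)"
  shows "Sk (Suc k) (mat c - (c * g) *\<^sub>R outer x)
    = c ^ Suc k * (CARD('n) choose Suc k) * (1 - g * (x \<bullet> x) * Suc k / CARD('n))"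
proof -
  obtain v l where "eigenbasis (mat c :: real^'n^'n) v l" using sym_mat_eigenbasis[of "mat c"] by auto
  then have ev: "eigenbasis (mat c :: real^'n^'n) v (\<lambda>_. c)"
    by (simp add: eigenbasis_def mat_mult_vec)
  obtain n where n: "CARD('n) = Suc n" using k by (cases "CARD('n)") auto
  have "Sk (Suc k) (mat c + (- c * g) *\<^sub>R outer x) = (CARD('n) choose Suc k) * c ^ Suc k
      - c * g * (\<Sum>i\<in>UNIV. (v i \<bullet> x)\<^sup>2 * (real (n choose k) * c ^ k))"
    using k by (subst Sk_add_outer[OF ev]) (auto simp: esym_const n)
  also have "(\<Sum>i\<in>UNIV. (v i \<bullet> x)\<^sup>2 * (real (n choose k) * c ^ k)) = (x \<bullet> x) * (real (n choose k) * c ^ k)"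
    by (simp only: sum_distrib_right[symmetric] eigenbasis_parseval[OF ev])
  also have "real (n choose k) = real (CARD('n) choose Suc k) * Suc k / CARD('n)"
  proof -
    have "real (Suc k * (Suc n choose Suc k)) = real (Suc n * (n choose k))"
      using Suc_times_binomial_eq[of n k] by (simp only: mult.commute)
    then show ?thesis unfolding n of_nat_mult by (simp add: field_simps del: binomial_Suc_Suc)
  qed
  finally show ?thesis by (simp add: algebra_simps del: binomial_Suc_Suc)
qed

lemma Sk_ge_of_barrier:
  fixes A H :: "real^'n^'n"
  assumes A: "A \<in> k_cone k" and H: "sym_mat H" and k: "1 \<le> k" "2 * k \<le> CARD('n)"
    and x: "x \<bullet> x \<le> 1" and c: "0 < c" and b: "0 < b" "b < 2"
    and psd: "\<And>y. c * (y \<bullet> y) - c * (2 - b) * (x \<bullet> y)\<^sup>2 \<le> y \<bullet> (H *v y) - y \<bullet> (A *v y)"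
  shows "(c * b / 2) ^ k / fact k \<le> Sk k H"
proof -
  \<comment> \<open>Split \<open>c (I - (2 - b) x x^T)\<close> as
    \<open>c' (I - 2 x x^T) + (c b / 2) I\<close>. The first part preserves the cone because
    \<open>2 \<le> n / k\<close>; the second gives the strict lower bound.\<close>
  define c' where "c' = c * (1 - b / 2)"
  have c': "c' > 0" using c b by (simp add: c'_def)
  define X where "X = A + mat c' - (c' * 2) *\<^sub>R outer x"
  have "real (2 * k) \<le> real CARD('n)" using k by (simp only: of_nat_le_iff)
  then have "2 \<le> real CARD('n) / k" using k by (simp add: field_simps)
  then have X: "X \<in> k_cone k"
    unfolding X_def using A k c' x by (intro k_cone_add_mat_diff_outer) auto
  define P where "P = H - X - mat (c * b / 2)"
  have "sym_mat P" unfolding P_def using H k_cone_sym[OF X] by (intro sym_mat_diff) auto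
  moreover have "0 \<le> y \<bullet> (P *v y)" for y
  proof -
    have "y \<bullet> (P *v y) = y \<bullet> (H *v y) - y \<bullet> (A *v y) - (c' * (y \<bullet> y) - c' * 2 * (x \<bullet> y)\<^sup>2) - c * b / 2 * (y \<bullet> y)"
      by (simp add: P_def X_def matrix_vector_mult_add_rdistrib matrix_vector_mult_diff_rdistrib mat_mult_vec
          scaleR_mult_vec outer_mult_vec inner_add_right inner_diff_right inner_commute[of y x] power2_eq_square)
    also have "c' * (y \<bullet> y) - c' * 2 * (x \<bullet> y)\<^sup>2 = c * (y \<bullet> y) - c * (2 - b) * (x \<bullet> y)\<^sup>2 - c * b / 2 * (y \<bullet> y)"
      by (simp add: c'_def field_simps)
    finally show ?thesis using psd[of y] by simp
  qed
  ultimately have "X + P \<in> k_cone k" using X k by (intro k_cone_add_psd) auto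
  then have "(c * b / 2) ^ k / fact k \<le> Sk k (X + P + mat (c * b / 2))"
    using k c b by (intro Sk_add_mat_ge) auto
  then show ?thesis by (simp add: P_def)
qed

text \<open>By stability under positive semidefinite terms the majorant of \<open>A\<close> would
  lie in the cone too, but past the threshold its \<open>Sk k\<close> is negative.\<close>

lemma k_cone_not_below_barrier:
  fixes A :: "real^'n^'n"
  assumes A: "A \<in> k_cone k" and k: "1 \<le> k" "k \<le> CARD('n)" and x: "x \<bullet> x = 1" and c: "0 < c"
    and g: "CARD('n) / k < g"
    and psd: "\<And>y. y \<bullet> (A *v y) \<le> c * (y \<bullet> y) - c * g * (x \<bullet> y)\<^sup>2"
  shows False
proof -
  define P where "P = mat c - (c * g) *\<^sub>R outer x - A"
  have "sym_mat P" unfolding P_def using k_cone_sym[OF A] by (intro sym_mat_diff sym_mat_scaleR) auto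
  moreover have "0 \<le> y \<bullet> (P *v y)" for y
    using psd[of y]
    by (simp add: P_def matrix_vector_mult_diff_rdistrib mat_mult_vec
          scaleR_mult_vec outer_mult_vec inner_diff_right inner_commute[of y x] power2_eq_square mult_ac)
  ultimately have "A + P \<in> k_cone k" using A k by (intro k_cone_add_psd) auto
  then have "0 \<le> Sk k (mat c - (c * g) *\<^sub>R outer x)" using k by (simp add: P_def k_cone_def)
  moreover obtain m where m: "k = Suc m" using k by (cases k) auto
  have "c ^ Suc m * (CARD('n) choose Suc m) * (1 - g * (x \<bullet> x) * Suc m / CARD('n)) < 0"
    using c g k x unfolding m
    by (intro mult_pos_neg mult_pos_pos) (auto simp: field_simps simp del: binomial_Suc_Suc)
  ultimately show False
    using k unfolding m by (simp only: Sk_mat_diff_outer)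
qed

section \<open>Second derivatives and barriers\<close>

text \<open>A pointwise notion shared by \<open>u\<close> and the barrier: a gradient field near
  \<open>x\<close> that is differentiable at \<open>x\<close> itself. Continuity of the second
  derivative is not part of it.\<close>

definition twice_diff :: "('a::real_inner \<Rightarrow> real) \<Rightarrow> ('a \<Rightarrow> 'a) \<Rightarrow> ('a \<Rightarrow> 'a) \<Rightarrow> 'a \<Rightarrow> bool" where
  "twice_diff u G L x \<longleftrightarrow> (\<exists>r>0. \<forall>y\<in>ball x r. (u has_derivative (\<lambda>h. G y \<bullet> h)) (at y)) \<and>
     (G has_derivative L) (at x)"

lemma twice_diff_diff:
  assumes "twice_diff u G L x" "twice_diff v G' L' x"
  shows "twice_diff (\<lambda>x. u x - v x) (\<lambda>x. G x - G' x) (\<lambda>h. L h - L' h) x"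
proof -
  obtain r r' where r: "r > 0" "r' > 0"
    and "\<And>y. y \<in> ball x r \<Longrightarrow> (u has_derivative (\<lambda>h. G y \<bullet> h)) (at y)"
    and "\<And>y. y \<in> ball x r' \<Longrightarrow> (v has_derivative (\<lambda>h. G' y \<bullet> h)) (at y)"
    using assms unfolding twice_diff_def by blast
  then have "\<forall>y\<in>ball x (min r r'). ((\<lambda>x. u x - v x) has_derivative (\<lambda>h. (G y - G' y) \<bullet> h)) (at y)"
    by (auto simp: inner_diff_left intro!: has_derivative_diff)
  moreover have "((\<lambda>x. G x - G' x) has_derivative (\<lambda>h. L h - L' h)) (at x)"
    using assms unfolding twice_diff_def by (auto intro!: has_derivative_diff)
  ultimately show ?thesis
    using r unfolding twice_diff_def by (intro conjI exI[of _ "min r r'"]) auto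
qed

lemma twice_diff_cmult:
  assumes "twice_diff u G L x"
  shows "twice_diff (\<lambda>x. c * u x) (\<lambda>x. c *\<^sub>R G x) (\<lambda>h. c *\<^sub>R L h) x"
proof -
  obtain r where r: "r > 0" and d: "\<And>y. y \<in> ball x r \<Longrightarrow> (u has_derivative (\<lambda>h. G y \<bullet> h)) (at y)"
    using assms unfolding twice_diff_def by blast
  have "\<forall>y\<in>ball x r. ((\<lambda>x. c * u x) has_derivative (\<lambda>h. (c *\<^sub>R G y) \<bullet> h)) (at y)"
    using d by (auto intro!: has_derivative_mult_right)
  then show ?thesis
    using assms r unfolding twice_diff_def by (blast intro: has_derivative_scaleR_right)
qed

lemma twice_diff_shift:
  assumes "twice_diff u G L (x + a)"
  shows "twice_diff (\<lambda>x. u (x + a)) (\<lambda>x. G (x + a)) L x"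
proof -
  obtain r where r: "r > 0" and d: "\<And>y. y \<in> ball (x + a) r \<Longrightarrow> (u has_derivative (\<lambda>h. G y \<bullet> h)) (at y)"
    using assms unfolding twice_diff_def by blast
  have "((\<lambda>x. x + a) has_derivative (\<lambda>h. h)) (at y)" for y
    by (auto intro!: derivative_eq_intros)
  then have sh: "((\<lambda>x. g (x + a)) has_derivative g') (at y)" if "(g has_derivative g') (at (y + a))"
    for g :: "'a \<Rightarrow> 'b::real_normed_vector" and g' y
    using has_derivative_compose[of "\<lambda>x. x + a" "\<lambda>h. h" y UNIV g g'] that by simp
  have "\<forall>y\<in>ball x r. ((\<lambda>x. u (x + a)) has_derivative (\<lambda>h. G (y + a) \<bullet> h)) (at y)"
    using d by (auto intro!: sh simp: dist_norm)
  then show ?thesis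
    using assms r unfolding twice_diff_def by (auto intro!: sh)
qed

lemma has_derivative_along_line:
  assumes "(u has_derivative (\<lambda>h. G \<bullet> h)) (at (x + t *\<^sub>R a))"
  shows "((\<lambda>t. u (x + t *\<^sub>R a)) has_real_derivative G \<bullet> a) (at t)"
proof -
  have "((\<lambda>t. x + t *\<^sub>R a) has_derivative (\<lambda>h. h *\<^sub>R a)) (at t)"
    by (auto intro!: derivative_eq_intros)
  from has_derivative_compose[OF this assms]
  show ?thesis
    by (simp add: has_field_derivative_def mult_commute_abs)
qed

text \<open>Second difference quotients converge to \<open>L b \<bullet> a\<close>; they are symmetric in \<open>a\<close> and \<open>b\<close>.\<close>

lemma twice_diff_second_difference:
  assumes u: "twice_diff u G L x" and e: "0 < e"
  shows "\<exists>d>0. \<forall>t. 0 < t \<and> t < d \<longrightarrow>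
    \<bar>u (x + t *\<^sub>R a + t *\<^sub>R b) - u (x + t *\<^sub>R a) - u (x + t *\<^sub>R b) + u x - t\<^sup>2 * (L b \<bullet> a)\<bar> \<le> e * t\<^sup>2"
proof -
  define s where "s = norm a + norm b + 1"
  have s: "s > 0" "norm a \<le> s" "norm b \<le> s" "norm a + norm b \<le> s"
    unfolding s_def using norm_ge_zero[of a] norm_ge_zero[of b] by linarith+
  \<comment> \<open>Two gradient errors of size \<open>\<epsilon> * (t * s)\<close>, paired with
    \<open>a\<close> and multiplied by the step \<open>t\<close>, add up to
    \<open>2 * \<epsilon> * s * s\<close> times the square of \<open>t\<close>.\<close>
  define \<epsilon> where "\<epsilon> = e / (2 * s * s)"
  have \<epsilon>: "\<epsilon> > 0" using s e by (simp add: \<epsilon>_def)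
  obtain r where r: "r > 0" and du: "\<And>y. y \<in> ball x r \<Longrightarrow> (u has_derivative (\<lambda>h. G y \<bullet> h)) (at y)"
    using u unfolding twice_diff_def by blast
  have G: "(G has_derivative L) (at x)" using u by (simp add: twice_diff_def)
  then obtain d where d: "d > 0"
    and dG: "\<And>y. norm (y - x) < d \<Longrightarrow> norm (G y - G x - L (y - x)) \<le> \<epsilon> * norm (y - x)"
    using \<epsilon> unfolding has_derivative_at_alt by blast
  interpret L: bounded_linear L using G by (rule has_derivative_bounded_linear)
  define d0 where "d0 = min r d / s"
  have d0: "d0 > 0" using r d s by (simp add: d0_def)
  moreover have "\<bar>u (x + t *\<^sub>R a + t *\<^sub>R b) - u (x + t *\<^sub>R a) - u (x + t *\<^sub>R b) + u x - t\<^sup>2 * (L b \<bullet> a)\<bar> \<le> e * t\<^sup>2"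
    if t: "0 < t" "t < d0" for t
  proof -
    \<comment> \<open>The mean value theorem in direction \<open>a\<close> turns the second
      difference into a difference of gradients at two points, to which differentiability of
      \<open>G\<close> at \<open>x\<close> applies.\<close>
    define \<psi> where "\<psi> = (\<lambda>\<tau>. u (x + t *\<^sub>R b + \<tau> *\<^sub>R a) - u (x + \<tau> *\<^sub>R a))"
    have ts: "t * s < min r d" using t s by (simp add: d0_def pos_less_divide_eq)
    have small: "norm (\<tau> *\<^sub>R a) < min r d \<and> norm (t *\<^sub>R b + \<tau> *\<^sub>R a) < min r d
        \<and> norm (\<tau> *\<^sub>R a) \<le> t * s \<and> norm (t *\<^sub>R b + \<tau> *\<^sub>R a) \<le> t * s"
      if \<tau>: "0 \<le> \<tau>" "\<tau> \<le> t" for \<tau>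
    proof -
      have 1: "norm (\<tau> *\<^sub>R a) \<le> t * norm a" using \<tau> by (simp add: mult_right_mono)
      have 2: "norm (t *\<^sub>R b + \<tau> *\<^sub>R a) \<le> norm (t *\<^sub>R b) + norm (\<tau> *\<^sub>R a)"
        by (rule norm_triangle_ineq)
      have 3: "norm (t *\<^sub>R b) = t * norm b" using t by simp
      have 4: "t * norm a \<le> t * s" "t * norm b + t * norm a \<le> t * s"
        using s t by (auto simp: distrib_left[symmetric] add.commute intro!: mult_left_mono)
      from 1 2 3 4 ts show ?thesis by linarith
    qed
    have "(\<psi> has_real_derivative (G (x + t *\<^sub>R b + \<tau> *\<^sub>R a) \<bullet> a - G (x + \<tau> *\<^sub>R a) \<bullet> a)) (at \<tau>)"
      if "0 \<le> \<tau>" "\<tau> \<le> t" for \<tau>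
      unfolding \<psi>_def using small[OF that]
      by (intro DERIV_diff has_derivative_along_line du)
        (auto simp: dist_norm norm_minus_commute algebra_simps)
    from MVT2[of 0 t \<psi>, OF t(1) this] obtain \<tau> where \<tau>: "0 < \<tau>" "\<tau> < t"
      and eq: "\<psi> t - \<psi> 0 = (t - 0) * (G (x + t *\<^sub>R b + \<tau> *\<^sub>R a) \<bullet> a - G (x + \<tau> *\<^sub>R a) \<bullet> a)"
      by blast
    define E1 E2 where "E1 = G (x + t *\<^sub>R b + \<tau> *\<^sub>R a) - G x - L (t *\<^sub>R b + \<tau> *\<^sub>R a)"
      and "E2 = G (x + \<tau> *\<^sub>R a) - G x - L (\<tau> *\<^sub>R a)"
    have sm: "norm (\<tau> *\<^sub>R a) < d" "norm (t *\<^sub>R b + \<tau> *\<^sub>R a) < d"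
        "norm (\<tau> *\<^sub>R a) \<le> t * s" "norm (t *\<^sub>R b + \<tau> *\<^sub>R a) \<le> t * s"
      using small[of \<tau>] \<tau> by auto
    have "norm E1 \<le> \<epsilon> * norm (t *\<^sub>R b + \<tau> *\<^sub>R a)"
      using dG[of "x + (t *\<^sub>R b + \<tau> *\<^sub>R a)"] sm(2) unfolding E1_def by (simp add: add.assoc)
    also have "\<dots> \<le> \<epsilon> * (t * s)" using sm \<epsilon> by (intro mult_left_mono) auto
    finally have E1: "norm E1 \<le> \<epsilon> * (t * s)" .
    have "norm E2 \<le> \<epsilon> * norm (\<tau> *\<^sub>R a)"
      using dG[of "x + \<tau> *\<^sub>R a"] sm(1) unfolding E2_def by simp
    also have "\<dots> \<le> \<epsilon> * (t * s)" using sm \<epsilon> by (intro mult_left_mono) auto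
    finally have E2: "norm E2 \<le> \<epsilon> * (t * s)" .
    have "norm (E1 - E2) \<le> \<epsilon> * (t * s) + \<epsilon> * (t * s)"
      using norm_triangle_ineq4[of E1 E2] E1 E2 by linarith
    then have n: "\<bar>(E1 - E2) \<bullet> a\<bar> \<le> (2 * \<epsilon> * (t * s)) * s"
      using Cauchy_Schwarz_ineq2[of "E1 - E2" a] s mult_mono[of "norm (E1 - E2)" "2 * \<epsilon> * (t * s)" "norm a" s]
        \<epsilon> t by (simp add: algebra_simps)
    have "G (x + t *\<^sub>R b + \<tau> *\<^sub>R a) - G (x + \<tau> *\<^sub>R a) = t *\<^sub>R L b + (E1 - E2)"
      unfolding E1_def E2_def by (simp add: L.add L.scaleR)
    then have gg: "G (x + t *\<^sub>R b + \<tau> *\<^sub>R a) \<bullet> a - G (x + \<tau> *\<^sub>R a) \<bullet> a = t * (L b \<bullet> a) + (E1 - E2) \<bullet> a"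
      by (metis inner_add_left inner_diff_left inner_scaleR_left)
    have "\<psi> t - \<psi> 0 - t\<^sup>2 * (L b \<bullet> a) = t * ((E1 - E2) \<bullet> a)"
      unfolding eq gg by (simp add: algebra_simps power2_eq_square)
    then have "\<bar>\<psi> t - \<psi> 0 - t\<^sup>2 * (L b \<bullet> a)\<bar> \<le> t * ((2 * \<epsilon> * (t * s)) * s)"
      using n t by (simp add: abs_mult)
    also have "\<dots> = e * t\<^sup>2"
      using s by (simp add: \<epsilon>_def power2_eq_square)
    finally show ?thesis unfolding \<psi>_def by (simp add: algebra_simps)
  qed
  ultimately show ?thesis by blast
qed

lemma twice_diff_symmetric:
  assumes u: "twice_diff u G L x"
  shows "L a \<bullet> b = L b \<bullet> a"
proof -
  have "\<bar>L a \<bullet> b - L b \<bullet> a\<bar> \<le> e" if e: "e > 0" for e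
  proof -
    obtain d d' where d: "d > 0" "d' > 0"
      and 1: "\<And>t. 0 < t \<Longrightarrow> t < d \<Longrightarrow>
        \<bar>u (x + t *\<^sub>R a + t *\<^sub>R b) - u (x + t *\<^sub>R a) - u (x + t *\<^sub>R b) + u x - t\<^sup>2 * (L b \<bullet> a)\<bar> \<le> e / 2 * t\<^sup>2"
      and 2: "\<And>t. 0 < t \<Longrightarrow> t < d' \<Longrightarrow>
        \<bar>u (x + t *\<^sub>R b + t *\<^sub>R a) - u (x + t *\<^sub>R b) - u (x + t *\<^sub>R a) + u x - t\<^sup>2 * (L a \<bullet> b)\<bar> \<le> e / 2 * t\<^sup>2"
      using twice_diff_second_difference[OF u half_gt_zero[OF e], of a b]
        twice_diff_second_difference[OF u half_gt_zero[OF e], of b a] by blast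
    define t where "t = min d d' / 2"
    have t: "0 < t" "t < d" "t < d'" using d by (auto simp: t_def)
    have "x + t *\<^sub>R b + t *\<^sub>R a = x + t *\<^sub>R a + t *\<^sub>R b" by simp
    then have "\<bar>t\<^sup>2 * (L a \<bullet> b) - t\<^sup>2 * (L b \<bullet> a)\<bar> \<le> e / 2 * t\<^sup>2 + e / 2 * t\<^sup>2"
      using 1[OF t(1,2)] 2[OF t(1,3)] by (smt (verit))
    then have "t\<^sup>2 * \<bar>L a \<bullet> b - L b \<bullet> a\<bar> \<le> t\<^sup>2 * e"
      by (simp only: right_diff_distrib[symmetric] abs_mult) (simp add: mult.commute)
    then show ?thesis using t(1) by simp
  qed
  then have "\<bar>L a \<bullet> b - L b \<bullet> a\<bar> \<le> 0" by (rule field_le_epsilon) simp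
  then show ?thesis by simp
qed

text \<open>The gradient vanishes at \<open>x\<close>, so \<open>G (x + \<tau> a)\<close> is
  \<open>\<tau> L a\<close> up to a small error. If \<open>a \<bullet> L a\<close> were negative,
  the slope along \<open>a\<close> would be negative at all small \<open>\<tau> > 0\<close>, against
  the mean value theorem.\<close>

lemma twice_diff_local_min:
  assumes u: "twice_diff u G L x" and S: "open S" "x \<in> S" "\<And>y. y \<in> S \<Longrightarrow> u x \<le> u y"
  shows "0 \<le> a \<bullet> L a"
proof (rule ccontr)
  assume neg: "\<not> ?thesis"
  have "(u has_derivative (\<lambda>h. G x \<bullet> h)) (at x)"
    using u by (force simp: twice_diff_def)
  then have "(\<lambda>h. G x \<bullet> h) = (\<lambda>h. 0)"
    using differential_zero_maxmin[OF S(2,1)] S(3) by blast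
  then have "G x \<bullet> G x = 0" by metis
  then have G0: "G x = 0" by simp
  obtain r where r: "r > 0" and du: "\<And>y. y \<in> ball x r \<Longrightarrow> (u has_derivative (\<lambda>h. G y \<bullet> h)) (at y)"
    using u unfolding twice_diff_def by blast
  have G: "(G has_derivative L) (at x)" using u by (simp add: twice_diff_def)
  interpret L: bounded_linear L using G by (rule has_derivative_bounded_linear)
  define q where "q = - (a \<bullet> L a)"
  have q: "q > 0" using neg by (simp add: q_def)
  have a: "a \<noteq> 0" using q by (auto simp: q_def)
  \<comment> \<open>With this choice the error uses up half of the negative term
    \<open>- \<tau> * q\<close>.\<close>
  define \<epsilon> where "\<epsilon> = q / (2 * (norm a)\<^sup>2)"
  have \<epsilon>: "\<epsilon> > 0" using a q by (simp add: \<epsilon>_def)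
  obtain d where d: "d > 0"
    and dG: "\<And>y. norm (y - x) < d \<Longrightarrow> norm (G y - G x - L (y - x)) \<le> \<epsilon> * norm (y - x)"
    using \<epsilon> G unfolding has_derivative_at_alt by blast
  obtain r' where r': "r' > 0" "ball x r' \<subseteq> S" using S by (meson openE)
  define t where "t = min (min r d) r' / (2 * norm a)"
  have t: "t > 0" using r d r' a by (simp add: t_def)
  have "t * norm a = min (min r d) r' / 2" using a by (simp add: t_def)
  then have ta: "t * norm a < min (min r d) r'" using r d r' by linarith
  have small: "norm (\<tau> *\<^sub>R a) < min (min r d) r'" if "0 \<le> \<tau>" "\<tau> \<le> t" for \<tau>
    using that ta mult_right_mono[of \<tau> t "norm a"] by auto
  have "((\<lambda>t. u (x + t *\<^sub>R a)) has_real_derivative G (x + \<tau> *\<^sub>R a) \<bullet> a) (at \<tau>)"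
    if "0 \<le> \<tau>" "\<tau> \<le> t" for \<tau>
    using small[OF that] by (intro has_derivative_along_line du) (auto simp: dist_norm)
  from MVT2[of 0 t "\<lambda>t. u (x + t *\<^sub>R a)", OF t this] obtain \<tau> where \<tau>: "0 < \<tau>" "\<tau> < t"
    and eq: "u (x + t *\<^sub>R a) - u (x + 0 *\<^sub>R a) = (t - 0) * (G (x + \<tau> *\<^sub>R a) \<bullet> a)"
    by blast
  have "x + t *\<^sub>R a \<in> S" using small[of t] t r' by (auto simp: dist_norm subset_iff)
  then have "0 \<le> t * (G (x + \<tau> *\<^sub>R a) \<bullet> a)" using S(3) eq by fastforce
  then have nn: "0 \<le> G (x + \<tau> *\<^sub>R a) \<bullet> a" using t by (simp add: zero_le_mult_iff)
  define E where "E = G (x + \<tau> *\<^sub>R a) - \<tau> *\<^sub>R L a"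
  have "norm E \<le> \<epsilon> * (\<tau> * norm a)"
    using dG[of "x + \<tau> *\<^sub>R a"] small[of \<tau>] \<tau> by (simp add: E_def G0 L.scaleR)
  then have "E \<bullet> a \<le> \<epsilon> * (\<tau> * norm a) * norm a"
    using norm_cauchy_schwarz[of E a] mult_right_mono[of "norm E" "\<epsilon> * (\<tau> * norm a)" "norm a"] by auto
  also have "\<dots> = \<tau> * q / 2" using a by (simp add: \<epsilon>_def power2_eq_square)
  finally have "G (x + \<tau> *\<^sub>R a) \<bullet> a \<le> - \<tau> * q + \<tau> * q / 2"
    by (simp add: E_def inner_diff_left q_def inner_commute[of "L a"] field_simps)
  also have "\<dots> < 0" using \<tau> q by simp
  finally show False using nn by simp
qed

text \<open>The barrier \<open>(|x|\<^sup>2 + d)\<^bsup>\<beta>/2\<^esup>\<close>: smooth for \<open>d > 0\<close>, and \<open>|x|\<^sup>\<beta>\<close> for \<open>d = 0\<close>.\<close>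

definition barrier :: "real \<Rightarrow> real \<Rightarrow> 'a::real_inner \<Rightarrow> real" where
  "barrier \<beta> d x = (x \<bullet> x + d) powr (\<beta> / 2)"

lemma twice_diff_barrier:
  fixes x :: "'a::real_inner"
  assumes pos: "x \<bullet> x + d > 0"
  defines "\<rho> \<equiv> x \<bullet> x + d"
  shows "twice_diff (barrier \<beta> d) (\<lambda>x. (\<beta> * (x \<bullet> x + d) powr (\<beta> / 2 - 1)) *\<^sub>R x)
    (\<lambda>h. (\<beta> * \<rho> powr (\<beta> / 2 - 1)) *\<^sub>R h
        + (\<beta> * (\<beta> - 2) * \<rho> powr (\<beta> / 2 - 2) * (x \<bullet> h)) *\<^sub>R x) x"
proof -
  have P: "((\<lambda>y. (y \<bullet> y + d) powr p) has_derivative (\<lambda>h. 2 * p * (y \<bullet> y + d) powr (p - 1) * (y \<bullet> h))) (at y)"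
    if "y \<bullet> y + d > 0" for p and y :: 'a
  proof -
    have "((\<lambda>y. (y \<bullet> y + d) powr p) has_derivative
      (\<lambda>h. (y \<bullet> y + d) powr p * (0 * ln (y \<bullet> y + d) + (y \<bullet> h + h \<bullet> y + 0) * p / (y \<bullet> y + d)))) (at y)"
      using that by (intro derivative_intros) auto
    moreover have "(y \<bullet> y + d) powr p * (0 * ln (y \<bullet> y + d) + (y \<bullet> h + h \<bullet> y + 0) * p / (y \<bullet> y + d))
       = 2 * p * (y \<bullet> y + d) powr (p - 1) * (y \<bullet> h)" for h
      using that by (simp add: powr_diff inner_commute[of h y] field_simps)
    ultimately show ?thesis by simp
  qed
  have "open {y :: 'a. y \<bullet> y + d > 0}"
    by (intro open_Collect_less continuous_intros)
  moreover have "x \<in> {y. y \<bullet> y + d > 0}" using pos by simp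
  ultimately obtain r where r: "r > 0" "ball x r \<subseteq> {y. y \<bullet> y + d > 0}"
    by (rule openE)
  have "\<forall>y\<in>ball x r. (barrier \<beta> d has_derivative (\<lambda>h. ((\<beta> * (y \<bullet> y + d) powr (\<beta> / 2 - 1)) *\<^sub>R y) \<bullet> h)) (at y)"
  proof
    fix y assume "y \<in> ball x r"
    then have "y \<bullet> y + d > 0" using r by auto
    from P[OF this, of "\<beta> / 2"] show "(barrier \<beta> d has_derivative (\<lambda>h. ((\<beta> * (y \<bullet> y + d) powr (\<beta> / 2 - 1)) *\<^sub>R y) \<bullet> h)) (at y)"
      unfolding barrier_def[abs_def] by simp
  qed
  moreover have "((\<lambda>x. (\<beta> * (x \<bullet> x + d) powr (\<beta> / 2 - 1)) *\<^sub>R x) has_derivative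
    (\<lambda>h. (\<beta> * \<rho> powr (\<beta> / 2 - 1)) *\<^sub>R h
        + (\<beta> * (\<beta> - 2) * \<rho> powr (\<beta> / 2 - 2) * (x \<bullet> h)) *\<^sub>R x)) (at x)"
    using has_derivative_scaleR[OF has_derivative_mult_right[OF P[OF pos, of "\<beta> / 2 - 1"], of \<beta>]
        has_derivative_ident]
    unfolding \<rho>_def by (simp add: mult.assoc)
  ultimately show ?thesis using r(1) unfolding twice_diff_def by blast
qed

text \<open>This is the form \<open>c (I - (2 - \<beta>) e e^T)\<close> of the cone lemmas. For
  \<open>d \<ge> 0\<close> the vector \<open>e\<close> has length at most 1, and exactly 1 when
  \<open>d = 0\<close>.\<close>

lemma barrier_hessian:
  fixes x h :: "'a::real_inner" and \<beta> :: real
  assumes pos: "x \<bullet> x + d > 0"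
  defines "\<rho> \<equiv> x \<bullet> x + d"
  defines "c \<equiv> \<beta> * \<rho> powr (\<beta> / 2 - 1)" and "e \<equiv> (1 / sqrt \<rho>) *\<^sub>R x"
  shows "h \<bullet> (c *\<^sub>R h + (\<beta> * (\<beta> - 2) * \<rho> powr (\<beta> / 2 - 2) * (x \<bullet> h)) *\<^sub>R x)
    = c * (h \<bullet> h) - c * (2 - \<beta>) * (e \<bullet> h)\<^sup>2"
proof -
  have "\<rho> powr (\<beta> / 2 - 2) = \<rho> powr (\<beta> / 2 - 1 - 1)" by simp
  also have "\<dots> = \<rho> powr (\<beta> / 2 - 1) / \<rho>"
    using pos unfolding \<rho>_def by (subst powr_diff) simp
  finally have 1: "\<rho> powr (\<beta> / 2 - 2) = \<rho> powr (\<beta> / 2 - 1) / \<rho>" .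
  have 2: "(e \<bullet> h)\<^sup>2 = (x \<bullet> h)\<^sup>2 / \<rho>"
    using pos by (simp add: e_def power_divide \<rho>_def)
  have 3: "\<beta> * R * q + \<beta> * (\<beta> - 2) * (R / \<rho>) * p * p = \<beta> * R * q - \<beta> * R * (2 - \<beta>) * (p\<^sup>2 / \<rho>)" for p q R
    by (simp add: divide_inverse power2_eq_square algebra_simps)
  show ?thesis
    unfolding 1 2 c_def inner_add_right inner_scaleR_right inner_commute[of h x] by (rule 3)
qed

section \<open>Comparison and the estimate near the origin\<close>

lemma has_derivative_grad:
  fixes u :: "real^'n \<Rightarrow> real"
  assumes "u differentiable (at x)"
  shows "(u has_derivative (\<lambda>h. grad u x \<bullet> h)) (at x)"
proof -
  let ?D = "frechet_derivative u (at x)"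
  have D: "(u has_derivative ?D) (at x)" using assms by (simp add: frechet_derivative_works[symmetric])
  then interpret linear ?D by (rule has_derivative_linear)
  have "?D h = grad u x \<bullet> h" for h
  proof -
    have "?D h = ?D (\<Sum>i\<in>UNIV. (h $ i) *\<^sub>R axis i 1)"
      using basis_expansion[of h] by (simp add: scalar_mult_eq_scaleR)
    also have "\<dots> = grad u x \<bullet> h"
      by (simp add: sum scaleR grad_def pd_def inner_vec_def mult.commute)
    finally show ?thesis .
  qed
  then have "?D = (\<lambda>h. grad u x \<bullet> h)" by auto
  then show ?thesis using D by simp
qed

lemma has_derivative_vec:
  fixes g :: "'a::real_normed_vector \<Rightarrow> real^'n"
  assumes "\<And>i. ((\<lambda>x. g x $ i) has_derivative (\<lambda>h. g' h $ i)) (at x)"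
  shows "(g has_derivative g') (at x)"
  unfolding has_derivative_componentwise_within[of g g' x UNIV]
  using assms by (auto simp: Basis_vec_def inner_axis)

lemma twice_diff_Ck2:
  fixes u :: "real^'n \<Rightarrow> real"
  assumes u: "Ck_on 2 \<Omega> u" and \<Omega>: "open \<Omega>" "x \<in> \<Omega>"
  shows "twice_diff u (grad u) (\<lambda>h. hess u x *v h) x" "sym_mat (hess u x)"
proof -
  have d: "u differentiable (at y)" "pd i u differentiable (at y)" if "y \<in> \<Omega>" for y i
    using u that by (auto simp: numeral_2_eq_2)
  obtain r where r: "r > 0" "ball x r \<subseteq> \<Omega>" using \<Omega> by (rule openE)
  \<comment> \<open>As \<open>hess\<close> puts the outer derivative in the row index, the
    derivative of the gradient is at first the transpose of \<open>hess u x\<close>; symmetry of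
    second differences then identifies the two.\<close>
  have G: "((\<lambda>y. grad u y $ j) has_derivative (\<lambda>h. (transpose (hess u x) *v h) $ j)) (at x)" for j
  proof -
    have "(transpose (hess u x) *v h) $ j = grad (pd j u) x \<bullet> h" for h
      by (simp add: matrix_vector_mult_def transpose_def hess_def grad_def inner_vec_def
          del: transpose_matrix_vector)
    then show ?thesis
      using has_derivative_grad[OF d(2)[OF \<Omega>(2), of j]] by (simp add: grad_def del: transpose_matrix_vector)
  qed
  have T: "twice_diff u (grad u) (\<lambda>h. transpose (hess u x) *v h) x"
    unfolding twice_diff_def
  proof (intro conjI exI[of _ r] ballI has_derivative_vec[OF G] has_derivative_grad d(1))
    fix y assume "y \<in> ball x r" then show "y \<in> \<Omega>" using r by blast
  qed (rule r)
  have "hess u x $ i $ j = hess u x $ j $ i" for i j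
    using twice_diff_symmetric[OF T, of "axis i 1" "axis j 1"]
    by (simp only: matrix_vector_mult_basis) (simp add: inner_axis column_def transpose_def)
  then show S: "sym_mat (hess u x)" by (simp add: transpose_def vec_eq_iff)
  show "twice_diff u (grad u) (\<lambda>h. hess u x *v h) x" using T unfolding S .
qed

lemma Ck2_continuous:
  assumes "Ck_on 2 \<Omega> u"
  shows "continuous_on \<Omega> u"
  using assms by (auto simp: numeral_2_eq_2 intro!: continuous_at_imp_continuous_on differentiable_imp_continuous_within)

text \<open>The conditions on a solution that enter the estimate; \<open>F\<close> is an upper bound for \<open>f(x, u(x))\<close>.\<close>

definition admissible_bounded :: "nat \<Rightarrow> real \<Rightarrow> real \<Rightarrow> real \<Rightarrow> real \<Rightarrow> real \<Rightarrow> (real^'n) set \<Rightarrow> (real^'n \<Rightarrow> real) \<Rightarrow> bool" where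
  "admissible_bounded k s F \<delta> K M \<Omega> u \<longleftrightarrow> Ck_on 2 \<Omega> u \<and>
     (\<forall>x\<in>\<Omega>. eigvals (hess u x) \<in> closure (Gamma k) \<and>
        Sk k (hess u x) \<le> ((x \<bullet> x + \<delta>\<^sup>2) powr s * F) ^ k \<and>
        \<bar>u x\<bar> \<le> M \<and> norm x * norm (grad u x) \<le> K)"

lemma admissible_segment_bound:
  fixes u :: "real^'n \<Rightarrow> real"
  assumes u: "admissible_bounded k s F \<delta> K M \<Omega> u" and ab: "closed_segment a b \<subseteq> \<Omega>"
    and m: "0 < m" "\<And>z. z \<in> closed_segment a b \<Longrightarrow> m \<le> norm z"
  shows "\<bar>u b - u a\<bar> \<le> K / m * norm (b - a)"
proof -
  have "norm (u b - u a) \<le> K / m * norm (b - a)"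
  proof (rule differentiable_bound[of "closed_segment a b" u "\<lambda>z h. grad u z \<bullet> h"])
    fix z assume z: "z \<in> closed_segment a b"
    then have "z \<in> \<Omega>" using ab by blast
    then have "u differentiable (at z)" using u by (auto simp: admissible_bounded_def numeral_2_eq_2)
    then show "(u has_derivative (\<lambda>h. grad u z \<bullet> h)) (at z within closed_segment a b)"
      by (rule has_derivative_at_withinI[OF has_derivative_grad])
    have "m * norm (grad u z) \<le> norm z * norm (grad u z)"
      using m(2)[OF z] by (intro mult_right_mono) auto
    also have "\<dots> \<le> K" using u \<open>z \<in> \<Omega>\<close> by (auto simp: admissible_bounded_def)
    finally have "norm (grad u z) \<le> K / m" using m by (simp add: field_simps)
    moreover have "norm (grad u z \<bullet> h) \<le> norm (grad u z) * norm h" for h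
      using Cauchy_Schwarz_ineq2 by simp
    ultimately show "onorm (\<lambda>h. grad u z \<bullet> h) \<le> K / m"
      by (intro onorm_le) (meson mult_right_mono norm_ge_zero order_trans)
  qed auto
  then show ?thesis by simp
qed

lemma continuous_on_barrier [continuous_intros]:
  assumes "0 < \<beta>" "0 \<le> d" "continuous_on S g"
  shows "continuous_on S (\<lambda>x. barrier \<beta> d (g x))"
  unfolding barrier_def using assms by (intro continuous_on_powr' continuous_intros) auto

lemma powr_add_le:
  fixes x y p :: real
  assumes "0 \<le> x" "0 \<le> y" "0 \<le> p" "p \<le> 1"
  shows "(x + y) powr p \<le> x powr p + y powr p"
proof (cases "x + y = 0")
  case False
  then have s: "x + y > 0" using assms by simp
  have le: "z / (x + y) * (x + y) powr p \<le> z powr p" if "0 \<le> z" "z \<le> x + y" for z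
  proof -
    have "(z / (x + y)) powr 1 \<le> (z / (x + y)) powr p"
      using that s assms by (intro powr_mono') auto
    then have "z / (x + y) \<le> z powr p / (x + y) powr p"
      using that s by (simp add: powr_divide)
    then show ?thesis using s by (simp add: field_simps)
  qed
  have "(x + y) powr p = x / (x + y) * (x + y) powr p + y / (x + y) * (x + y) powr p"
    using s by (simp add: distrib_right[symmetric] add_divide_distrib[symmetric])
  then show ?thesis using le[of x] le[of y] assms by simp
qed (use assms in auto)

text \<open>The constant \<open>d powr (\<beta> / 2)\<close> occurs in both bounds, so the
  oscillation of the barrier is controlled independently of \<open>d\<close>. This is where
  uniformity in \<delta> comes from.\<close>

lemma barrier_bounds:
  fixes x :: "'a::real_inner"
  assumes "0 < \<beta>" "\<beta> \<le> 2" "0 \<le> d"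
  shows "d powr (\<beta> / 2) \<le> barrier \<beta> d x" "barrier \<beta> d x \<le> d powr (\<beta> / 2) + norm x powr \<beta>"
proof -
  show "d powr (\<beta> / 2) \<le> barrier \<beta> d x"
    unfolding barrier_def using assms by (intro powr_mono2) auto
  have "(x \<bullet> x) powr (\<beta> / 2) = norm x powr \<beta>"
    by (simp add: norm_eq_sqrt_inner powr_half_sqrt[symmetric] powr_powr)
  then show "barrier \<beta> d x \<le> d powr (\<beta> / 2) + norm x powr \<beta>"
    unfolding barrier_def using powr_add_le[of "x \<bullet> x" d "\<beta> / 2"] assms by simp
qed

text \<open>Since the principal part is translation invariant, a bound for \<open>u(x + h) - u(x)\<close> propagates from a
  sphere into the ball, up to the barrier that absorbs the right-hand side.\<close>

lemma admissible_bounded_comparison: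
  fixes u :: "real^'n \<Rightarrow> real"
  assumes u: "admissible_bounded k s F \<delta> K M \<Omega> u" and \<Omega>: "open \<Omega>"
    and sub: "\<And>x. norm x \<le> r \<Longrightarrow> x \<in> \<Omega> \<and> x + h \<in> \<Omega>"
    and k: "1 \<le> k" "2 * k \<le> CARD('n)" and \<beta>: "0 < \<beta>" "\<beta> < 2" and \<delta>: "0 < \<delta>" and N: "0 < N"
    and strict: "\<And>x. x \<in> \<Omega> \<Longrightarrow> fact k * ((x \<bullet> x + \<delta>\<^sup>2) powr s * F)
      < N * (\<beta> * (x \<bullet> x + \<delta>\<^sup>2) powr (\<beta> / 2 - 1)) * \<beta> / 2" and F: "0 \<le> F"
    and bd: "\<And>x. norm x = r \<Longrightarrow> m \<le> u (x + h) - u x - N * barrier \<beta> (\<delta>\<^sup>2) (x + h)"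
    and x: "norm x \<le> r"
  shows "m \<le> u (x + h) - u x - N * barrier \<beta> (\<delta>\<^sup>2) (x + h)"
proof -
  define w where "w = (\<lambda>x. (u (x + h) - u x) - N * barrier \<beta> (\<delta>\<^sup>2) (x + h))"
  have cu: "continuous_on \<Omega> u" using u by (auto simp: admissible_bounded_def intro: Ck2_continuous)
  have "continuous_on (cball 0 r) w"
    unfolding w_def using sub \<beta>
    by (intro continuous_intros continuous_on_compose2[OF cu]) auto
  moreover have "cball (0 :: real^'n) r \<noteq> {}" using order_trans[OF norm_ge_zero x] by simp
  ultimately obtain z where z: "norm z \<le> r" and min: "\<And>y. norm y \<le> r \<Longrightarrow> w z \<le> w y"
    using continuous_attains_inf[of "cball 0 r" w] by auto
  have "norm z = r"
  proof (rule ccontr)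
    assume "norm z \<noteq> r"
    then have zi: "z \<in> ball 0 r" using z by simp
    have z\<Omega>: "z \<in> \<Omega>" "z + h \<in> \<Omega>" using sub z by auto
    \<comment> \<open>The barrier is translated together with \<open>u\<close>, so its Hessian and
      the right-hand side of the equation are evaluated at the same point \<open>p\<close>.\<close>
    define p where "p = z + h"
    define \<rho> where "\<rho> = p \<bullet> p + \<delta>\<^sup>2"
    have \<rho>: "\<rho> > 0" using \<delta> by (simp add: \<rho>_def add_nonneg_pos)
    define c where "c = \<beta> * \<rho> powr (\<beta> / 2 - 1)"
    define e where "e = (1 / sqrt \<rho>) *\<^sub>R p"
    define L where "L = (\<lambda>y. c *\<^sub>R y + (\<beta> * (\<beta> - 2) * \<rho> powr (\<beta> / 2 - 2) * (p \<bullet> y)) *\<^sub>R p)"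
    have cpos: "c > 0" using \<beta> \<rho> by (simp add: c_def)
    have Cu: "Ck_on 2 \<Omega> u" using u by (simp add: admissible_bounded_def)
    note tu = twice_diff_Ck2[OF Cu \<Omega>]
    have "twice_diff (barrier \<beta> (\<delta>\<^sup>2)) (\<lambda>x. (\<beta> * (x \<bullet> x + \<delta>\<^sup>2) powr (\<beta> / 2 - 1)) *\<^sub>R x) L (z + h)"
      using twice_diff_barrier[of p "\<delta>\<^sup>2" \<beta>] \<rho> unfolding L_def c_def \<rho>_def p_def by blast
    then have tb: "twice_diff (\<lambda>x. N * barrier \<beta> (\<delta>\<^sup>2) (x + h))
        (\<lambda>x. N *\<^sub>R ((\<beta> * ((x + h) \<bullet> (x + h) + \<delta>\<^sup>2) powr (\<beta> / 2 - 1)) *\<^sub>R (x + h))) (\<lambda>y. N *\<^sub>R L y) z"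
      by (intro twice_diff_cmult twice_diff_shift)
    have "twice_diff w (\<lambda>x. (grad u (x + h) - grad u x)
        - N *\<^sub>R ((\<beta> * ((x + h) \<bullet> (x + h) + \<delta>\<^sup>2) powr (\<beta> / 2 - 1)) *\<^sub>R (x + h)))
        (\<lambda>y. (hess u (z + h) *v y - hess u z *v y) - N *\<^sub>R L y) z"
      unfolding w_def
      by (intro twice_diff_diff tb twice_diff_shift[OF tu(1)[OF z\<Omega>(2)]] tu(1)[OF z\<Omega>(1)])
    then have "0 \<le> y \<bullet> ((hess u (z + h) *v y - hess u z *v y) - N *\<^sub>R L y)" for y
      using min by (intro twice_diff_local_min[where S = "ball 0 r", OF _ _ zi]) auto
    then have H: "N * (y \<bullet> L y) \<le> y \<bullet> (hess u p *v y) - y \<bullet> (hess u z *v y)" for y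
      by (simp add: inner_diff_right p_def)
    have yL: "y \<bullet> L y = c * (y \<bullet> y) - c * (2 - \<beta>) * (e \<bullet> y)\<^sup>2" for y
      using barrier_hessian[of p "\<delta>\<^sup>2" y \<beta>] \<rho> unfolding L_def c_def e_def \<rho>_def by blast
    have psd: "(N * c) * (y \<bullet> y) - (N * c) * (2 - \<beta>) * (e \<bullet> y)\<^sup>2
        \<le> y \<bullet> (hess u p *v y) - y \<bullet> (hess u z *v y)" for y
      using H[of y] unfolding yL by (simp add: algebra_simps)
    have "hess u z \<in> k_cone k"
      using u z\<Omega>(1) tu(2)[OF z\<Omega>(1)] by (intro k_coneI) (auto simp: admissible_bounded_def)
    moreover have "sym_mat (hess u p)" using tu(2)[OF z\<Omega>(2)] by (simp add: p_def)
    moreover have "e \<bullet> e \<le> 1"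
    proof -
      have "e \<bullet> e = (p \<bullet> p) / \<rho>" using \<rho> by (simp add: e_def field_simps)
      then show ?thesis using \<rho> by (simp add: \<rho>_def)
    qed
    ultimately have ge: "((N * c) * \<beta> / 2) ^ k / fact k \<le> Sk k (hess u p)"
      using k \<beta> N cpos psd by (intro Sk_ge_of_barrier[where x = e]) auto
    define a where "a = \<rho> powr s * F"
    have a: "0 \<le> a" using F by (simp add: a_def)
    have lt: "fact k * a < (N * c) * \<beta> / 2"
      using strict[OF z\<Omega>(2)] unfolding a_def c_def \<rho>_def p_def .
    have "Sk k (hess u p) \<le> a ^ k"
      using u z\<Omega>(2) unfolding admissible_bounded_def a_def \<rho>_def p_def by auto
    with ge have "((N * c) * \<beta> / 2) ^ k / fact k \<le> a ^ k" by (rule order_trans)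
    then have "((N * c) * \<beta> / 2) ^ k \<le> fact k * a ^ k"
      by (simp only: pos_divide_le_eq[OF fact_gt_zero] mult.commute[of "fact k"])
    \<comment> \<open>The hypothesis \<open>strict\<close> carries the full factor
      \<open>fact k\<close>, which avoids a \<open>k\<close>-th root here.\<close>
    also have "\<dots> \<le> fact k ^ k * a ^ k"
      using k a by (intro mult_right_mono self_le_power) auto
    also have "\<dots> < ((N * c) * \<beta> / 2) ^ k"
      using lt a k unfolding power_mult_distrib[symmetric] by (intro power_strict_mono) auto
    finally show False by simp
  qed
  then have "m \<le> w z" using bd by (simp add: w_def)
  also have "\<dots> \<le> w x" using min x by simp
  finally show ?thesis by (simp add: w_def)
qed

section \<open>Hoelder bounds near the origin\<close>

lemma segment_norm_bounds:
  fixes x h :: "'a::real_normed_vector"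
  assumes "z \<in> closed_segment x (x + h)"
  shows "norm x - norm h \<le> norm z" "norm z \<le> norm x + norm h"
proof -
  obtain t where t: "0 \<le> t" "t \<le> 1" "z = x + t *\<^sub>R h"
    using assms by (auto simp: closed_segment_def algebra_simps)
  have "norm (t *\<^sub>R h) \<le> norm h" using t by (simp add: mult_left_le_one_le)
  then show "norm x - norm h \<le> norm z" "norm z \<le> norm x + norm h"
    using norm_triangle_ineq[of x "t *\<^sub>R h"] norm_diff_ineq[of x "t *\<^sub>R h"] t(3) by auto
qed

lemma admissible_bounded_holder_small_k:
  fixes \<Omega> :: "(real^'n) set"
  assumes k: "1 \<le> k" "2 * k \<le> CARD('n)" and s: "s > -1" and \<Omega>: "open \<Omega>"
    and R: "0 < R" "R \<le> 1" "ball 0 R \<subseteq> \<Omega>" and D: "\<And>x. x \<in> \<Omega> \<Longrightarrow> x \<bullet> x + 1 \<le> D" and F: "0 \<le> F"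
  shows "\<exists>\<alpha> C r. 0 < \<alpha> \<and> \<alpha> < 1 \<and> 0 < r \<and> (\<forall>\<delta> u x y. 0 < \<delta> \<and> \<delta> < 1 \<and> admissible_bounded k s F \<delta> K M \<Omega> u \<and>
    x \<in> ball 0 r \<and> y \<in> ball 0 r \<longrightarrow> \<bar>u x - u y\<bar> \<le> C * dist x y powr \<alpha>)"
proof -
  \<comment> \<open>The second entry makes \<open>\<beta> / 2 - 1 - s\<close> nonpositive, so that
    the barrier beats the weight \<open>\<rho> powr s\<close> for small \<rho>; it is positive
    because \<open>s > -1\<close>. The bound 1 gives
    \<open>r \<le> norm h powr (\<beta> / 2)\<close> below.\<close>
  define \<beta> where "\<beta> = min 1 (2 + 2 * s)"
  have "\<beta> \<le> 1" "\<beta> \<le> 2 + 2 * s" by (auto simp only: \<beta>_def min.cobounded1 min.cobounded2)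
  moreover have "0 < \<beta>" using s by (simp add: \<beta>_def)
  ultimately have \<beta>: "0 < \<beta>" "\<beta> < 2" "\<beta> \<le> 1" "\<beta> / 2 - 1 - s \<le> 0" by linarith+
  have "0 \<in> \<Omega>" using R by auto
  then have D0: "D > 0" using D[of 0] by simp
  \<comment> \<open>Solves \<open>N * \<beta>^2 / 2 * D powr (\<beta> / 2 - 1 - s) = fact k * F +
    1\<close>; the summand 1 makes the inequality strict even if \<open>F = 0\<close>.\<close>
  define N where "N = 2 * (fact k * F + 1) / (\<beta>\<^sup>2 * D powr (\<beta> / 2 - 1 - s))"
  have N: "0 < N" using F \<beta> D0 by (simp add: N_def add_nonneg_pos)
  have strict: "fact k * (\<rho> powr s * F) < N * (\<beta> * \<rho> powr (\<beta> / 2 - 1)) * \<beta> / 2"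
    if \<rho>: "0 < \<rho>" "\<rho> \<le> D" for \<rho>
  proof -
    have "D powr (\<beta> / 2 - 1 - s) \<le> \<rho> powr (\<beta> / 2 - 1 - s)"
      using \<rho> \<beta> by (intro powr_mono2') auto
    then have "\<rho> powr s * D powr (\<beta> / 2 - 1 - s) \<le> \<rho> powr s * \<rho> powr (\<beta> / 2 - 1 - s)"
      by (intro mult_left_mono) auto
    also have "\<dots> = \<rho> powr (\<beta> / 2 - 1)" by (simp add: powr_add[symmetric])
    finally have 1: "(N * \<beta>\<^sup>2 / 2) * (\<rho> powr s * D powr (\<beta> / 2 - 1 - s)) \<le> (N * \<beta>\<^sup>2 / 2) * \<rho> powr (\<beta> / 2 - 1)"
      using N by (intro mult_left_mono) auto
    have "(N * \<beta>\<^sup>2 / 2) * D powr (\<beta> / 2 - 1 - s) = fact k * F + 1"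
      using \<beta> D0 by (simp add: N_def)
    then have "(N * \<beta>\<^sup>2 / 2) * (\<rho> powr s * D powr (\<beta> / 2 - 1 - s)) = \<rho> powr s * (fact k * F + 1)"
      by (metis mult.assoc mult.commute)
    moreover have "fact k * (\<rho> powr s * F) < \<rho> powr s * (fact k * F + 1)"
      using \<rho> by (simp add: algebra_simps)
    ultimately have "fact k * (\<rho> powr s * F) < (N * \<beta>\<^sup>2 / 2) * \<rho> powr (\<beta> / 2 - 1)"
      using 1 by linarith
    then show ?thesis by (simp add: power2_eq_square mult_ac)
  qed
  \<comment> \<open>Then \<open>norm h < 2 * r0\<close>, hence \<open>sqrt (norm h) < R / 2\<close>,
    which keeps the ball of that radius and its translate by \<open>h\<close> inside
    \<open>ball 0 R\<close>.\<close>
  define r0 where "r0 = R\<^sup>2 / 16"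
  have r0: "0 < r0" using R by (simp add: r0_def)
  \<comment> \<open>A one-sided bound suffices, since the two points can be exchanged.\<close>
  have lower: "- ((2 * K + 2 * N) * norm h powr (\<beta> / 2)) \<le> u (x + h) - u x"
    if \<delta>: "0 < \<delta>" "\<delta> < 1" and u: "admissible_bounded k s F \<delta> K M \<Omega> u"
      and x: "norm x < r0" "norm (x + h) < r0" and h: "h \<noteq> 0" for \<delta> u x h
  proof -
    define r where "r = sqrt (norm h)"
    have h2: "norm h < R\<^sup>2 / 8"
      using norm_triangle_ineq4[of "x + h" x] x by (simp add: r0_def)
    have r: "0 < r" "norm h = r * r" using h by (auto simp: r_def)
    have rR: "r < R / 2"
    proof (rule ccontr)
      assume "\<not> ?thesis"
      then have "(R / 2) * (R / 2) \<le> r * r" using R by (intro mult_mono) auto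
      then show False using h2 r R by (simp add: power2_eq_square) (smt (verit) mult_pos_pos)
    qed
    have hr: "norm h \<le> r / 2"
      using rR R r mult_right_mono[of r "1 / 2" r] by simp
    have K: "0 \<le> K" using u \<open>0 \<in> \<Omega>\<close> by (auto simp: admissible_bounded_def)
    \<comment> \<open>As \<open>norm h \<le> r / 2\<close>, the segment stays at distance at least
      \<open>r / 2\<close> from the origin. This serves both the sphere of radius \<open>r\<close>
      and all points outside it.\<close>
    have seg: "\<bar>u (y + h) - u y\<bar> \<le> 2 * K * r" if y: "r \<le> norm y" "norm y + norm h < R" for y
    proof -
      have "\<bar>u (y + h) - u y\<bar> \<le> K / (r / 2) * norm ((y + h) - y)"
      proof (rule admissible_segment_bound[OF u])
        show "closed_segment y (y + h) \<subseteq> \<Omega>"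
          using segment_norm_bounds(2)[of _ y h] y R(3) by force
        show "r / 2 \<le> norm z" if "z \<in> closed_segment y (y + h)" for z
          using segment_norm_bounds(1)[OF that] y hr by linarith
      qed (use r in simp)
      then show ?thesis using r by (simp add: field_simps)
    qed
    have rp: "r \<le> norm h powr (\<beta> / 2)"
    proof -
      have "R\<^sup>2 \<le> 1" using R by (simp add: power_le_one)
      then have "norm h powr (1 / 2) \<le> norm h powr (\<beta> / 2)"
        using h2 \<beta> by (intro powr_mono') auto
      then show ?thesis by (simp add: r_def powr_half_sqrt)
    qed
    show ?thesis
    proof (cases "norm x \<le> r")
      case True
      \<comment> \<open>The gradient bound on the sphere, combined with the largest barrier value
        there, where \<open>norm (y + h) \<le> 2 * r\<close>. The \<delta> term cancels against the
        lower bound of the barrier at \<open>x + h\<close>.\<close>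
      define m where "m = - (2 * K * r) - N * ((\<delta>\<^sup>2) powr (\<beta> / 2) + (2 * r) powr \<beta>)"
      have inR: "norm y + norm h < R" if "norm y \<le> r" for y :: "real^'n"
        using that hr rR R by linarith
      have "m \<le> u (x + h) - u x - N * barrier \<beta> (\<delta>\<^sup>2) (x + h)"
      proof (rule admissible_bounded_comparison[OF u \<Omega> _ k \<beta>(1,2) \<delta>(1) N _ F _ True])
        fix y :: "real^'n" assume y: "norm y \<le> r"
        have "norm y < R" "norm (y + h) < R"
          using inR[OF y] norm_triangle_ineq[of y h] by (smt (verit) norm_ge_zero)+
        then show "y \<in> \<Omega> \<and> y + h \<in> \<Omega>" using R(3) by auto
      next
        fix y assume y: "y \<in> \<Omega>"
        have "\<delta>\<^sup>2 \<le> 1" using \<delta> by (simp add: power_le_one)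
        then show "fact k * ((y \<bullet> y + \<delta>\<^sup>2) powr s * F)
            < N * (\<beta> * (y \<bullet> y + \<delta>\<^sup>2) powr (\<beta> / 2 - 1)) * \<beta> / 2"
          using D[OF y] \<delta> by (intro strict add_nonneg_pos) auto
      next
        fix y :: "real^'n" assume y: "norm y = r"
        have "norm (y + h) \<le> 2 * r" using norm_triangle_ineq[of y h] y hr r by linarith
        then have "norm (y + h) powr \<beta> \<le> (2 * r) powr \<beta>" using \<beta> by (intro powr_mono2) auto
        then have "barrier \<beta> (\<delta>\<^sup>2) (y + h) \<le> (\<delta>\<^sup>2) powr (\<beta> / 2) + (2 * r) powr \<beta>"
          using barrier_bounds(2)[of \<beta> "\<delta>\<^sup>2" "y + h"] \<beta> by simp
        then have "N * barrier \<beta> (\<delta>\<^sup>2) (y + h) \<le> N * ((\<delta>\<^sup>2) powr (\<beta> / 2) + (2 * r) powr \<beta>)"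
          using N by (intro mult_left_mono) auto
        then show "m \<le> u (y + h) - u y - N * barrier \<beta> (\<delta>\<^sup>2) (y + h)"
          using seg[of y] inR[of y] y unfolding m_def by auto
      qed
      moreover have "N * (\<delta>\<^sup>2) powr (\<beta> / 2) \<le> N * barrier \<beta> (\<delta>\<^sup>2) (x + h)"
        using barrier_bounds(1)[of \<beta> "\<delta>\<^sup>2" "x + h"] \<beta> N by (intro mult_left_mono) auto
      ultimately have 1: "- (2 * K * r) - N * (2 * r) powr \<beta> \<le> u (x + h) - u x"
        by (simp add: m_def algebra_simps)
      have "(2 * r) powr \<beta> = 2 powr \<beta> * norm h powr (\<beta> / 2)"
        by (simp add: powr_mult r_def powr_half_sqrt[symmetric] powr_powr)
      also have "\<dots> \<le> 2 powr 1 * norm h powr (\<beta> / 2)"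
        using \<beta> by (intro mult_right_mono powr_mono) auto
      finally have "N * (2 * r) powr \<beta> \<le> N * (2 * norm h powr (\<beta> / 2))"
        using N by (intro mult_left_mono) auto
      moreover have "2 * K * r \<le> 2 * K * norm h powr (\<beta> / 2)"
        using rp K by (intro mult_left_mono) auto
      ultimately show ?thesis using 1 by (simp add: algebra_simps)
    next
      case False
      have "R\<^sup>2 \<le> R" using R by (simp add: power2_eq_square mult_left_le)
      then have "norm x + norm h < R" using x h2 R by (simp add: r0_def)
      then have "\<bar>u (x + h) - u x\<bar> \<le> 2 * K * r" using False by (intro seg) auto
      also have "\<dots> \<le> 2 * K * norm h powr (\<beta> / 2)"
        using rp K by (intro mult_left_mono) auto
      also have "\<dots> \<le> (2 * K + 2 * N) * norm h powr (\<beta> / 2)"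
        using N by (intro mult_right_mono) auto
      finally show ?thesis by simp
    qed
  qed
  have "\<bar>u x - u y\<bar> \<le> (2 * K + 2 * N) * dist x y powr (\<beta> / 2)"
    if "0 < \<delta>" "\<delta> < 1" "admissible_bounded k s F \<delta> K M \<Omega> u" "x \<in> ball 0 r0" "y \<in> ball 0 r0" for \<delta> u x y
  proof (cases "x = y")
    case False
    then show ?thesis
      using lower[OF that(1-3), of x "y - x"] lower[OF that(1-3), of y "x - y"] that(4,5)
      by (simp add: dist_norm norm_minus_commute[of y x])
  qed simp
  then show ?thesis
    using \<beta> r0 by (intro exI[of _ "\<beta> / 2"] exI[of _ "2 * K + 2 * N"] exI[of _ r0]) auto
qed

text \<open>For \<open>2 k > n\<close> no equation is needed: \<open>|x - y|\<^sup>\<beta>\<close> is not \<open>k\<close>-admissible for \<open>\<beta> < 2 - n / k\<close>, hence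
  cannot touch \<open>u\<close> from above.\<close>

lemma admissible_bounded_holder_large_k:
  fixes \<Omega> :: "(real^'n) set"
  assumes k: "1 \<le> k" "k \<le> CARD('n)" "CARD('n) < 2 * k" and \<Omega>: "open \<Omega>"
    and R: "0 < R" "ball 0 R \<subseteq> \<Omega>"
  shows "\<exists>\<alpha> C r. 0 < \<alpha> \<and> \<alpha> < 1 \<and> 0 < r \<and> (\<forall>\<delta> u x y. 0 < \<delta> \<and> \<delta> < 1 \<and> admissible_bounded k s F \<delta> K M \<Omega> u \<and>
    x \<in> ball 0 r \<and> y \<in> ball 0 r \<longrightarrow> \<bar>u x - u y\<bar> \<le> C * dist x y powr \<alpha>)"
proof -
  have "real CARD('n) < real (2 * k)" using k(3) by (simp only: of_nat_less_iff)
  then have nk: "real CARD('n) / k < 2" using k by (simp add: pos_divide_less_eq)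
  \<comment> \<open>Half of the gap \<open>2 - n / k\<close> keeps \<open>2 - \<beta>\<close>
    strictly above the threshold; the bound \<open>1 / 2\<close> keeps the exponent below 1.\<close>
  define \<beta> where "\<beta> = min (1 / 2) ((2 - real CARD('n) / k) / 2)"
  have \<beta>: "0 < \<beta>" "\<beta> < 1" using nk by (auto simp: \<beta>_def)
  have "\<beta> \<le> (2 - real CARD('n) / k) / 2" unfolding \<beta>_def by (rule min.cobounded2)
  then have \<beta>k: "real CARD('n) / k < 2 - \<beta>" using nk by simp
  \<comment> \<open>On the sphere of radius \<open>R / 2\<close> the barrier then equals
    \<open>2 * (\<bar>M\<bar> + 1)\<close>, more than \<open>u\<close> can vary, so a violating
    minimum of \<open>w\<close> is interior.\<close>
  define N where "N = 2 * (\<bar>M\<bar> + 1) / (R / 2) powr \<beta>"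
  have N: "0 < N" using R by (simp add: N_def)
  have one: "u x - u y \<le> N * dist x y powr \<beta>"
    if u: "admissible_bounded k s F \<delta> K M \<Omega> u" and x: "norm x < R / 4" and y: "norm y < R / 4" for \<delta> u x y
  proof -
    define w where "w = (\<lambda>x. N * barrier \<beta> 0 (x + (- y)) - u x)"
    have Cu: "Ck_on 2 \<Omega> u" using u by (simp add: admissible_bounded_def)
    have sub: "cball y (R / 2) \<subseteq> \<Omega>"
    proof
      fix z assume "z \<in> cball y (R / 2)"
      then have "norm z < R" using y norm_triangle_ineq[of "z - y" y] R
        by (simp add: dist_norm norm_minus_commute[of y z])
      then show "z \<in> \<Omega>" using R(2) by auto
    qed
    have bw: "barrier \<beta> 0 (z + (- y)) = dist z y powr \<beta>" for z
      by (simp add: barrier_def dist_norm norm_eq_sqrt_inner powr_half_sqrt[symmetric] powr_powr)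
    have "continuous_on (cball y (R / 2)) w"
      unfolding w_def using \<beta> continuous_on_subset[OF Ck2_continuous[OF Cu] sub]
      by (intro continuous_intros) auto
    then obtain z where z: "z \<in> cball y (R / 2)" and min: "\<And>v. v \<in> cball y (R / 2) \<Longrightarrow> w z \<le> w v"
      using continuous_attains_inf[of "cball y (R / 2)" w] R by auto
    have Mu: "\<bar>u v\<bar> \<le> M" if "v \<in> cball y (R / 2)" for v
      using u sub that by (auto simp: admissible_bounded_def)
    have "w z \<ge> - u y"
    proof (rule ccontr)
      assume less: "\<not> ?thesis"
      \<comment> \<open>At the centre the barrier vanishes and \<open>w y = - u y\<close>; a
        violating minimum therefore avoids the only point where the barrier is not smooth.\<close>
      have zy: "z \<noteq> y" using less by (auto simp: w_def barrier_def)
      have "dist y z \<noteq> R / 2"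
      proof
        assume "dist y z = R / 2"
        then have "dist z y = R / 2" by (simp only: dist_commute)
        moreover have "N * (R / 2) powr \<beta> = 2 * (\<bar>M\<bar> + 1)" using R by (simp add: N_def)
        ultimately have "w z = 2 * (\<bar>M\<bar> + 1) - u z"
          unfolding w_def bw by (simp only:)
        moreover have "u z \<le> \<bar>M\<bar>" "- u y \<le> \<bar>M\<bar>" "0 \<le> \<bar>M\<bar>" using Mu[OF z] Mu[of y] R by auto
        ultimately show False using less by (simp add: not_le)
      qed
      then have zi: "z \<in> ball y (R / 2)" using z by auto
      have z\<Omega>: "z \<in> \<Omega>" using sub z by blast
      define p where "p = z + (- y)"
      define \<rho> where "\<rho> = p \<bullet> p + 0"
      have \<rho>: "\<rho> > 0" using zy by (simp add: \<rho>_def p_def)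
      define c where "c = \<beta> * \<rho> powr (\<beta> / 2 - 1)"
      define e where "e = (1 / sqrt \<rho>) *\<^sub>R p"
      define L where "L = (\<lambda>v. c *\<^sub>R v + (\<beta> * (\<beta> - 2) * \<rho> powr (\<beta> / 2 - 2) * (p \<bullet> v)) *\<^sub>R p)"
      have cpos: "c > 0" using \<beta> \<rho> by (simp add: c_def)
      note tu = twice_diff_Ck2[OF Cu \<Omega> z\<Omega>]
      have "twice_diff (barrier \<beta> 0) (\<lambda>x. (\<beta> * (x \<bullet> x + 0) powr (\<beta> / 2 - 1)) *\<^sub>R x) L (z + (- y))"
        using twice_diff_barrier[of p 0 \<beta>] \<rho> unfolding L_def c_def \<rho>_def p_def by blast
      then have "twice_diff (\<lambda>x. N * barrier \<beta> 0 (x + (- y)))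
          (\<lambda>x. N *\<^sub>R ((\<beta> * ((x + (- y)) \<bullet> (x + (- y)) + 0) powr (\<beta> / 2 - 1)) *\<^sub>R (x + (- y)))) (\<lambda>v. N *\<^sub>R L v) z"
        by (intro twice_diff_cmult twice_diff_shift)
      from twice_diff_diff[OF this tu(1)]
      have "0 \<le> v \<bullet> (N *\<^sub>R L v - hess u z *v v)" for v
        using min unfolding w_def[symmetric]
        by (intro twice_diff_local_min[where S = "ball y (R / 2)", OF _ _ zi]) auto
      then have H: "v \<bullet> (hess u z *v v) \<le> N * (v \<bullet> L v)" for v
        by (simp add: inner_diff_right)
      have vL: "v \<bullet> L v = c * (v \<bullet> v) - c * (2 - \<beta>) * (e \<bullet> v)\<^sup>2" for v
        using barrier_hessian[of p 0 v \<beta>] \<rho> unfolding L_def c_def e_def \<rho>_def by blast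
      have "v \<bullet> (hess u z *v v) \<le> (N * c) * (v \<bullet> v) - (N * c) * (2 - \<beta>) * (e \<bullet> v)\<^sup>2" for v
        using H[of v] unfolding vL by (simp add: algebra_simps)
      moreover have "hess u z \<in> k_cone k"
        using u z\<Omega> tu(2) by (intro k_coneI) (auto simp: admissible_bounded_def)
      moreover have "e \<bullet> e = 1" using \<rho> by (simp add: e_def) (simp add: \<rho>_def)
      ultimately show False
        using k_cone_not_below_barrier[of "hess u z" k e "N * c" "2 - \<beta>"] k \<beta>k N cpos by auto
    qed
    also have "w z \<le> w x"
    proof (rule min)
      show "x \<in> cball y (R / 2)" using x y norm_triangle_ineq4[of y x] by (simp add: dist_norm)
    qed
    finally show ?thesis unfolding w_def bw by (simp add: barrier_def)
  qed
  have "\<bar>u x - u y\<bar> \<le> N * dist x y powr \<beta>"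
    if "admissible_bounded k s F \<delta> K M \<Omega> u" "x \<in> ball 0 (R / 4)" "y \<in> ball 0 (R / 4)" for \<delta> u x y
    using one[OF that(1), of x y] one[OF that(1), of y x] that(2,3) by (simp add: dist_commute)
  then show ?thesis
    using \<beta> R by (intro exI[of _ \<beta>] exI[of _ N] exI[of _ "R / 4"]) auto
qed

section \<open>The estimate up to the boundary\<close>

lemma Ck_on_Suc_imp: "Ck_on (Suc m) S u \<Longrightarrow> Ck_on m S u"
proof (induction m arbitrary: u)
  case 0
  then show ?case
    by (auto intro!: continuous_at_imp_continuous_on differentiable_imp_continuous_within)
next
  case (Suc m)
  then show ?case by simp
qed

lemma closed_segment_shift_obtain:
  fixes x h :: "'a::real_vector"
  assumes "z \<in> closed_segment x (x + h)"
  obtains t where "0 \<le> t" "t \<le> 1" "z = x + t *\<^sub>R h"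
  using assms by (auto simp: closed_segment_def algebra_simps)

text \<open>Inside a boundary chart two points are joined by going up in direction \<open>\<nu>\<close>, across, and down again.\<close>

lemma boundary_local_lipschitz:
  fixes \<Omega> :: "(real^'n) set"
  assumes chart: "boundary_chart 3 \<Omega> x0 \<nu> \<rho>" and x0: "x0 \<noteq> 0"
  shows "\<exists>r L. 0 < r \<and> (\<forall>\<delta> u x y. admissible_bounded k s F \<delta> K M \<Omega> u \<and> x \<in> \<Omega> \<inter> ball x0 r \<and> y \<in> \<Omega> \<inter> ball x0 r
    \<longrightarrow> \<bar>u x - u y\<bar> \<le> L * dist x y)"
proof -
  obtain r where \<nu>: "norm \<nu> = 1" and r: "r > 0" and C3: "Ck_on 3 (ball 0 r) \<rho>"
    and \<Omega>: "\<And>x. x \<in> ball x0 r \<Longrightarrow> x \<in> \<Omega> \<longleftrightarrow> (x - x0) \<bullet> \<nu> > \<rho> (x - x0)"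
    and tang: "\<And>y. \<rho> y = \<rho> (y - (y \<bullet> \<nu>) *\<^sub>R \<nu>)" and g0: "grad \<rho> 0 = 0"
    using chart unfolding boundary_chart_def by blast
  have \<nu>1: "\<nu> \<bullet> \<nu> = 1" using \<nu> by (simp add: norm_eq_1)
  have inv: "\<rho> (y + t *\<^sub>R \<nu>) = \<rho> y" for y t
    using tang[of y] tang[of "y + t *\<^sub>R \<nu>"] by (simp add: inner_add_left \<nu>1 algebra_simps)
  have "Ck_on (Suc 2) (ball 0 r) \<rho>" using C3 by (simp add: numeral_3_eq_3 numeral_2_eq_2)
  then have C2: "Ck_on 2 (ball 0 r) \<rho>" by (rule Ck_on_Suc_imp)
  have "twice_diff \<rho> (grad \<rho>) (\<lambda>h. hess \<rho> 0 *v h) 0"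
    using twice_diff_Ck2(1)[OF C2, of 0] r by simp
  then have "isCont (grad \<rho>) 0"
    unfolding twice_diff_def using has_derivative_continuous by blast
  then obtain r' where r': "r' > 0" and g: "\<And>y. norm y < r' \<Longrightarrow> norm (grad \<rho> y) < 1"
    unfolding continuous_at_eps_delta using g0 by (metis diff_zero dist_norm zero_less_one)
  define r1 where "r1 = min r r'"
  have r1: "r1 > 0" using r r' by (simp add: r1_def)
  \<comment> \<open>Since \<open>grad \<rho> 0 = 0\<close>, the slope of the boundary graph is at
    most 1 on a small ball; this constant fixes how far paths must be lifted.\<close>
  have lip: "\<bar>\<rho> a - \<rho> b\<bar> \<le> norm (a - b)" if "a \<in> ball 0 r1" "b \<in> ball 0 r1" for a b
  proof -
    have "norm (\<rho> a - \<rho> b) \<le> 1 * norm (a - b)"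
    proof (rule differentiable_bound[OF convex_ball _ _ that])
      fix z :: "real^'n" assume z: "z \<in> ball 0 r1"
      then have "\<rho> differentiable (at z)" using C2 by (auto simp: numeral_2_eq_2 r1_def)
      then show "(\<rho> has_derivative (\<lambda>h. grad \<rho> z \<bullet> h)) (at z within ball 0 r1)"
        by (rule has_derivative_at_withinI[OF has_derivative_grad])
      have "norm (grad \<rho> z) \<le> 1" using g[of z] z by (simp add: r1_def)
      moreover have "norm (grad \<rho> z \<bullet> h) \<le> norm (grad \<rho> z) * norm h" for h
        using Cauchy_Schwarz_ineq2 by simp
      ultimately show "onorm (\<lambda>h. grad \<rho> z \<bullet> h) \<le> 1"
        by (intro onorm_le) (meson mult_right_mono norm_ge_zero order_trans)
    qed
    then show ?thesis by simp
  qed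
  define m where "m = norm x0 / 2"
  have m: "m > 0" using x0 by (simp add: m_def)
  \<comment> \<open>For endpoints within \<open>r2\<close> of \<open>x0\<close> we have
    \<open>d < 2 * r2\<close> and \<open>t < 4 * r2\<close>, so the whole path stays within
    \<open>6 * r2\<close>, inside the chart and at distance at least \<open>m\<close> from the
    origin.\<close>
  define r2 where "r2 = min r1 m / 6"
  have r2: "r2 > 0" "6 * r2 \<le> r1" "6 * r2 \<le> m" using r1 m by (auto simp: r2_def)
  have "\<bar>u x - u y\<bar> \<le> 5 * (K / m) * dist x y"
    if u: "admissible_bounded k s F \<delta> K M \<Omega> u" and x: "x \<in> \<Omega>" "dist x0 x < r2" and y: "y \<in> \<Omega>" "dist x0 y < r2"
    for \<delta> u x y
  proof -
    define d where "d = dist x y"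
    \<comment> \<open>While moving across by at most \<open>d\<close>, the graph rises by at most
      \<open>d\<close> and the height of the path falls by at most \<open>d\<close>; a lift of
      \<open>2 * d\<close> compensates both. The three pieces have total length
      \<open>5 * d\<close>.\<close>
    define t where "t = 2 * d"
    have d: "0 \<le> d" "norm (y - x) = d" "d < 2 * r2"
      using x y dist_triangle_less_add[of x x0 r2 y r2] by (auto simp: d_def dist_norm norm_minus_commute dist_commute)
    have near: "z \<in> ball x0 r \<and> z - x0 \<in> ball 0 r1 \<and> m \<le> norm z" if "dist x0 z < 6 * r2" for z
      using that r2 m norm_triangle_ineq2[of x0 "x0 - z"] r1_def m_def
      by (auto simp: dist_norm norm_minus_commute[of z])
    have up: "z \<in> \<Omega> \<and> m \<le> norm z" if z: "z \<in> closed_segment p (p + t *\<^sub>R \<nu>)"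
      and p: "p \<in> \<Omega>" "dist x0 p < r2" for p z
    proof -
      obtain \<tau> where \<tau>: "0 \<le> \<tau>" "\<tau> \<le> 1" "z = p + \<tau> *\<^sub>R (t *\<^sub>R \<nu>)" using z by (rule closed_segment_shift_obtain)
      have n: "norm (\<tau> *\<^sub>R (t *\<^sub>R \<nu>)) \<le> t" using \<tau> d \<nu> by (simp add: t_def mult_left_le_one_le)
      have "dist x0 z \<le> dist x0 p + norm (\<tau> *\<^sub>R (t *\<^sub>R \<nu>))"
        using dist_triangle[of x0 z p] \<tau>(3) by (simp add: dist_norm)
      then have "dist x0 z < 6 * r2" using n p d by (simp add: t_def)
      note nz = near[OF this]
      have "p \<in> ball x0 r" using p near[of p] r2 by auto
      then have "\<rho> (p - x0) < (p - x0) \<bullet> \<nu>" using p \<Omega> by blast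
      also have "\<dots> \<le> (z - x0) \<bullet> \<nu>"
        using \<tau> d by (simp add: inner_add_left inner_diff_left \<nu>1 t_def)
      also have "\<rho> (p - x0) = \<rho> (z - x0)"
        using inv[of "p - x0" "\<tau> * t"] \<tau> by (simp add: algebra_simps)
      finally show ?thesis using \<Omega> nz by blast
    qed
    have across: "z \<in> \<Omega> \<and> m \<le> norm z"
      if z: "z \<in> closed_segment (x + t *\<^sub>R \<nu>) ((x + t *\<^sub>R \<nu>) + (y - x))" for z
    proof -
      obtain \<tau> where \<tau>: "0 \<le> \<tau>" "\<tau> \<le> 1" "z = (x + t *\<^sub>R \<nu>) + \<tau> *\<^sub>R (y - x)"
        using z by (rule closed_segment_shift_obtain)
      define q where "q = x + \<tau> *\<^sub>R (y - x)"
      have zq: "z = q + t *\<^sub>R \<nu>" using \<tau> by (simp add: q_def)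
      have n: "norm (\<tau> *\<^sub>R (y - x)) \<le> d" using \<tau> d by (simp add: mult_left_le_one_le)
      have dq: "dist x0 q < 6 * r2" and dz: "dist x0 z < 6 * r2"
      proof -
        have "q \<in> closed_segment x y"
          using \<tau> by (auto simp: q_def closed_segment_def algebra_simps intro!: exI[of _ \<tau>])
        moreover have "closed_segment x y \<subseteq> ball x0 r2"
          using x y by (intro closed_segment_subset convex_ball) auto
        ultimately have "dist x0 q < r2" by auto
        moreover have "dist x0 z \<le> dist x0 q + norm (t *\<^sub>R \<nu>)"
          using dist_triangle[of x0 z q] by (simp add: zq dist_norm)
        ultimately show "dist x0 q < 6 * r2" "dist x0 z < 6 * r2" using d r2 \<nu> by (auto simp: t_def)
      qed
      note nz = near[OF dz] and nq = near[OF dq]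
      have nx: "x \<in> ball x0 r" "x - x0 \<in> ball 0 r1" using near[of x] x r2 by auto
      have "\<rho> (z - x0) = \<rho> (q - x0)"
        using inv[of "q - x0" t] zq by (simp add: algebra_simps)
      also have "\<dots> \<le> \<rho> (x - x0) + d"
        using lip[of "q - x0" "x - x0"] nq nx n by (simp add: q_def)
      also have "\<rho> (x - x0) + d < (x - x0) \<bullet> \<nu> + d" using \<Omega> nx x by auto
      also have "\<dots> \<le> (z - x0) \<bullet> \<nu>"
      proof -
        have "\<bar>(\<tau> *\<^sub>R (y - x)) \<bullet> \<nu>\<bar> \<le> d"
          using Cauchy_Schwarz_ineq2[of "\<tau> *\<^sub>R (y - x)" \<nu>] n \<nu> by simp
        moreover have "(z - x0) \<bullet> \<nu> = (x - x0) \<bullet> \<nu> + 2 * d + (\<tau> *\<^sub>R (y - x)) \<bullet> \<nu>"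
          by (simp only: \<tau>(3) inner_add_left inner_diff_left inner_scaleR_left \<nu>1 t_def)
        ultimately show ?thesis by linarith
      qed
      finally show ?thesis using \<Omega> nz by blast
    qed
    have s1: "\<bar>u (x + t *\<^sub>R \<nu>) - u x\<bar> \<le> K / m * norm ((x + t *\<^sub>R \<nu>) - x)"
      using up[OF _ x] by (intro admissible_segment_bound[OF u _ m]) auto
    have s2: "\<bar>u (y + t *\<^sub>R \<nu>) - u y\<bar> \<le> K / m * norm ((y + t *\<^sub>R \<nu>) - y)"
      using up[OF _ y] by (intro admissible_segment_bound[OF u _ m]) auto
    have s3: "\<bar>u ((x + t *\<^sub>R \<nu>) + (y - x)) - u (x + t *\<^sub>R \<nu>)\<bar>
        \<le> K / m * norm (((x + t *\<^sub>R \<nu>) + (y - x)) - (x + t *\<^sub>R \<nu>))"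
      using across by (intro admissible_segment_bound[OF u _ m]) auto
    have e: "(x + t *\<^sub>R \<nu>) + (y - x) = y + t *\<^sub>R \<nu>" "norm (t *\<^sub>R \<nu>) = 2 * d"
      using \<nu> d by (auto simp: t_def)
    show ?thesis
      using s1 s2 s3 unfolding e(1) using e(2) d(2) by (simp add: d_def) 
  qed
  then show ?thesis
    using r2 by (intro exI[of _ r2] exI[of _ "5 * (K / m)"]) auto
qed

lemma interior_local_lipschitz:
  fixes \<Omega> :: "(real^'n) set"
  assumes \<Omega>: "open \<Omega>" "x0 \<in> \<Omega>" and x0: "x0 \<noteq> 0"
  shows "\<exists>r L. 0 < r \<and> (\<forall>\<delta> u x y. admissible_bounded k s F \<delta> K M \<Omega> u \<and> x \<in> \<Omega> \<inter> ball x0 r \<and> y \<in> \<Omega> \<inter> ball x0 r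
    \<longrightarrow> \<bar>u x - u y\<bar> \<le> L * dist x y)"
proof -
  obtain r where r: "r > 0" "ball x0 r \<subseteq> \<Omega>" using \<Omega> by (rule openE)
  define m where "m = norm x0 / 2"
  have m: "m > 0" using x0 by (simp add: m_def)
  have "\<bar>u x - u y\<bar> \<le> (K / m) * dist x y"
    if u: "admissible_bounded k s F \<delta> K M \<Omega> u" and x: "x \<in> ball x0 (min r m)" and y: "y \<in> ball x0 (min r m)"
    for \<delta> u x y
  proof -
    have cs: "closed_segment y x \<subseteq> ball x0 (min r m)"
      using closed_segment_subset[OF y x convex_ball] .
    have "\<bar>u x - u y\<bar> \<le> K / m * norm (x - y)"
    proof (rule admissible_segment_bound[OF u _ m])
      have "ball x0 (min r m) \<subseteq> ball x0 r" by auto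
      then show "closed_segment y x \<subseteq> \<Omega>" using cs r by blast
      show "m \<le> norm z" if "z \<in> closed_segment y x" for z
      proof -
        have "norm (x0 - z) < m" using cs that by (auto simp: dist_norm)
        then show ?thesis using norm_triangle_ineq2[of x0 "x0 - z"] by (simp add: m_def)
      qed
    qed
    then show ?thesis by (simp add: dist_norm)
  qed
  then show ?thesis using r m by (intro exI[of _ "min r m"] exI[of _ "K / m"]) auto
qed

text \<open>A finite subcover and its Lebesgue number \<open>e\<close> handle points closer than
  \<open>e\<close>; for the others the sup bound is enough. The local radii and constants are chosen
  before \<open>u\<close>, which keeps the result uniform over \<open>U\<close>.\<close>

lemma uniform_holder_from_local:
  fixes S \<Omega> :: "'a::metric_space set" and U :: "('a \<Rightarrow> real) set"
  assumes S: "compact S" "\<Omega> \<subseteq> S" and \<alpha>: "0 < \<alpha>"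
    and loc: "\<And>x0. x0 \<in> S \<Longrightarrow> \<exists>r C. 0 < r \<and>
      (\<forall>u\<in>U. \<forall>x\<in>\<Omega> \<inter> ball x0 r. \<forall>y\<in>\<Omega> \<inter> ball x0 r. \<bar>u x - u y\<bar> \<le> C * dist x y powr \<alpha>)"
    and M: "\<And>u x. u \<in> U \<Longrightarrow> x \<in> \<Omega> \<Longrightarrow> \<bar>u x\<bar> \<le> M"
  shows "\<exists>C. \<forall>u\<in>U. \<forall>x\<in>\<Omega>. \<forall>y\<in>\<Omega>. \<bar>u x - u y\<bar> \<le> C * dist x y powr \<alpha>"
proof -
  obtain r C where r: "\<And>x0. x0 \<in> S \<Longrightarrow> 0 < r x0"
    and C: "\<And>x0 u x y. x0 \<in> S \<Longrightarrow> u \<in> U \<Longrightarrow> x \<in> \<Omega> \<inter> ball x0 (r x0) \<Longrightarrow> y \<in> \<Omega> \<inter> ball x0 (r x0)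
      \<Longrightarrow> \<bar>u x - u y\<bar> \<le> C x0 * dist x y powr \<alpha>"
    using loc by metis
  have cov: "S \<subseteq> (\<Union>x\<in>S. ball x (r x))" using r by force
  obtain T where T: "T \<subseteq> S" "finite T" "S \<subseteq> (\<Union>x\<in>T. ball x (r x))"
    using compactE_image[OF S(1) _ cov] by (metis open_ball)
  obtain e where e: "0 < e" "\<And>x. x \<in> S \<Longrightarrow> \<exists>G \<in> (\<lambda>x. ball x (r x)) ` T. ball x e \<subseteq> G"
    using Heine_Borel_lemma[OF S(1), of "(\<lambda>x. ball x (r x)) ` T"] T(3) by auto
  define C' where "C' = (\<Sum>x\<in>T. \<bar>C x\<bar>) + 2 * \<bar>M\<bar> / e powr \<alpha>"
  have "\<bar>u x - u y\<bar> \<le> C' * dist x y powr \<alpha>" if u: "u \<in> U" and x: "x \<in> \<Omega>" and y: "y \<in> \<Omega>" for u x y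
  proof (cases "dist x y < e")
    case True
    obtain z where z: "z \<in> T" "ball x e \<subseteq> ball z (r z)" using e(2)[of x] x S(2) by auto
    have "x \<in> ball x e" "y \<in> ball x e" using e(1) True by auto
    then have "\<bar>u x - u y\<bar> \<le> C z * dist x y powr \<alpha>"
      using C[of z u x y] z T(1) u x y by blast
    also have "C z \<le> C'"
    proof -
      have "\<bar>C z\<bar> \<le> (\<Sum>x\<in>T. \<bar>C x\<bar>)" using z(1) T(2) by (intro member_le_sum) auto
      moreover have "0 \<le> 2 * \<bar>M\<bar> / e powr \<alpha>" by simp
      ultimately show ?thesis unfolding C'_def using abs_ge_self[of "C z"] by linarith
    qed
    finally show ?thesis by (simp add: mult_right_mono)
  next
    case False
    have "\<bar>u x - u y\<bar> \<le> 2 * \<bar>M\<bar>" using M[OF u x] M[OF u y] by linarith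
    also have "\<dots> = 2 * \<bar>M\<bar> / e powr \<alpha> * e powr \<alpha>" using e(1) by simp
    also have "\<dots> \<le> 2 * \<bar>M\<bar> / e powr \<alpha> * dist x y powr \<alpha>"
      using False e(1) \<alpha> by (intro mult_left_mono powr_mono2) auto
    also have "\<dots> \<le> C' * dist x y powr \<alpha>"
      unfolding C'_def by (intro mult_right_mono) (auto intro!: sum_nonneg)
    finally show ?thesis .
  qed
  then show ?thesis by blast
qed

lemma holder_closure:
  fixes u :: "'a::metric_space \<Rightarrow> real"
  assumes u: "continuous_on (closure \<Omega>) u" and \<alpha>: "0 < \<alpha>"
    and H: "\<And>x y. x \<in> \<Omega> \<Longrightarrow> y \<in> \<Omega> \<Longrightarrow> \<bar>u x - u y\<bar> \<le> C * dist x y powr \<alpha>"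
    and x: "x \<in> closure \<Omega>" and y: "y \<in> closure \<Omega>"
  shows "\<bar>u x - u y\<bar> \<le> C * dist x y powr \<alpha>"
proof -
  obtain a b where a: "\<And>n. a n \<in> \<Omega>" "a \<longlonglongrightarrow> x" and b: "\<And>n. b n \<in> \<Omega>" "b \<longlonglongrightarrow> y"
    using x y unfolding closure_sequential by blast
  have "(\<lambda>n. u (a n)) \<longlonglongrightarrow> u x" "(\<lambda>n. u (b n)) \<longlonglongrightarrow> u y"
    using u a b x y closure_subset[of \<Omega>] unfolding continuous_on_sequentially o_def by blast+
  then have 1: "(\<lambda>n. \<bar>u (a n) - u (b n)\<bar>) \<longlonglongrightarrow> \<bar>u x - u y\<bar>"
    by (intro tendsto_intros)
  have 2: "(\<lambda>n. C * dist (a n) (b n) powr \<alpha>) \<longlonglongrightarrow> C * dist x y powr \<alpha>"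
    using a(2) b(2) \<alpha> by (intro tendsto_mult tendsto_powr' tendsto_dist tendsto_const) auto
  show ?thesis by (rule LIMSEQ_le[OF 1 2]) (use H a b in auto)
qed

lemma hoelder_norm_le:
  fixes u :: "real^'n \<Rightarrow> real"
  assumes "\<And>x. x \<in> S \<Longrightarrow> \<bar>u x\<bar> \<le> M"
    and "\<And>x y. x \<in> S \<Longrightarrow> y \<in> S \<Longrightarrow> \<bar>u x - u y\<bar> \<le> C * dist x y powr \<alpha>"
  shows "hoelder_norm \<alpha> S u \<le> ereal (M + C)"
proof -
  have "\<bar>u x - u y\<bar> / dist x y powr \<alpha> \<le> C" if "x \<in> S" "y \<in> S" "x \<noteq> y" for x y
    using assms(2)[OF that(1,2)] that(3) by (simp add: pos_divide_le_eq)
  then have "hoelder_norm \<alpha> S u \<le> ereal M + ereal C"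
    unfolding hoelder_norm_def using assms(1) by (intro add_mono SUP_least) auto
  then show ?thesis by simp
qed

text \<open>The closure is covered by neighbourhoods of the origin, where the exponent is
  determined, and of nonzero interior and boundary points, where a Lipschitz bound holds. All
  constants are fixed before \<delta> and \<open>u\<close>.\<close>

lemma admissible_bounded_hoelder_norm:
  fixes \<Omega> :: "(real^'n) set"
  assumes k: "1 \<le> k" "k \<le> CARD('n)" and s: "s > -1"
    and \<Omega>: "open \<Omega>" "bounded \<Omega>" "0 \<in> \<Omega>" "C3_boundary \<Omega>" and F: "0 \<le> F"
  shows "\<exists>\<alpha>. 0 < \<alpha> \<and> \<alpha> < 1 \<and> (\<exists>C. \<forall>\<delta> u. 0 < \<delta> \<and> \<delta> < 1 \<and> admissible_bounded k s F \<delta> K M \<Omega> u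
    \<and> continuous_on (closure \<Omega>) u \<longrightarrow> hoelder_norm \<alpha> (closure \<Omega>) u \<le> ereal C)"
proof -
  obtain R0 where "R0 > 0" "ball 0 R0 \<subseteq> \<Omega>" using \<Omega>(1,3) by (rule openE)
  \<comment> \<open>The radius is capped at 1 so that increments \<open>h\<close> have norm below 1,
    where powers with smaller exponents are larger.\<close>
  then have R: "0 < min R0 1" "min R0 1 \<le> 1" "ball 0 (min R0 1) \<subseteq> \<Omega>" by auto
  obtain B where B: "\<And>x. x \<in> \<Omega> \<Longrightarrow> norm x \<le> B" using \<Omega>(2) by (auto simp: bounded_iff)
  have D: "x \<bullet> x + 1 \<le> B\<^sup>2 + 1" if "x \<in> \<Omega>" for x
    using power_mono[OF B[OF that] norm_ge_zero, of 2] by (simp add: power2_norm_eq_inner)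
  obtain \<alpha> C0 r0 where \<alpha>: "0 < \<alpha>" "\<alpha> < 1" and r0: "0 < r0"
    and C0: "\<And>\<delta> u x y. 0 < \<delta> \<Longrightarrow> \<delta> < 1 \<Longrightarrow> admissible_bounded k s F \<delta> K M \<Omega> u \<Longrightarrow> x \<in> ball 0 r0 \<Longrightarrow> y \<in> ball 0 r0
      \<Longrightarrow> \<bar>u x - u y\<bar> \<le> C0 * dist x y powr \<alpha>"
  proof (cases "2 * k \<le> CARD('n)")
    case True
    show ?thesis using admissible_bounded_holder_small_k[OF k(1) True s \<Omega>(1) R D F, of K M] that by blast
  next
    case False
    then show ?thesis
      using admissible_bounded_holder_large_k[OF k _ \<Omega>(1) R(1,3), of s F K M] that by (metis not_le)
  qed
  define U where "U = {u. \<exists>\<delta>. 0 < \<delta> \<and> \<delta> < 1 \<and> admissible_bounded k s F \<delta> K M \<Omega> u}"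
  have "\<exists>C. \<forall>u\<in>U. \<forall>x\<in>\<Omega>. \<forall>y\<in>\<Omega>. \<bar>u x - u y\<bar> \<le> C * dist x y powr \<alpha>"
  proof (rule uniform_holder_from_local[of "closure \<Omega>" \<Omega> \<alpha> U M])
    fix x0 assume x0: "x0 \<in> closure \<Omega>"
    show "\<exists>r C. 0 < r \<and> (\<forall>u\<in>U. \<forall>x\<in>\<Omega> \<inter> ball x0 r. \<forall>y\<in>\<Omega> \<inter> ball x0 r. \<bar>u x - u y\<bar> \<le> C * dist x y powr \<alpha>)"
    proof (cases "x0 = 0")
      case True
      then show ?thesis using C0 r0 by (intro exI[of _ r0] exI[of _ C0]) (auto simp: U_def)
    next
      case False
      have "\<exists>r L. 0 < r \<and> (\<forall>\<delta> u x y. admissible_bounded k s F \<delta> K M \<Omega> u \<and> x \<in> \<Omega> \<inter> ball x0 r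
        \<and> y \<in> \<Omega> \<inter> ball x0 r \<longrightarrow> \<bar>u x - u y\<bar> \<le> L * dist x y)"
      proof (cases "x0 \<in> \<Omega>")
        case True
        then show ?thesis using interior_local_lipschitz[OF \<Omega>(1) True False] by blast
      next
        case notin: False
        then have "x0 \<in> frontier \<Omega>" using x0 \<Omega>(1) by (simp add: frontier_def interior_open)
        then obtain \<nu> \<rho> where "boundary_chart 3 \<Omega> x0 \<nu> \<rho>" using \<Omega>(4) unfolding C3_boundary_def by blast
        then show ?thesis using boundary_local_lipschitz[OF _ False] by blast
      qed
      then obtain r L where r: "0 < r" and L: "\<And>\<delta> u x y. admissible_bounded k s F \<delta> K M \<Omega> u \<Longrightarrow> x \<in> \<Omega> \<inter> ball x0 r
        \<Longrightarrow> y \<in> \<Omega> \<inter> ball x0 r \<Longrightarrow> \<bar>u x - u y\<bar> \<le> L * dist x y" by blast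
      \<comment> \<open>Radius at most \<open>1 / 2\<close> keeps distances below 1, where the
        Lipschitz bound implies the Hoelder bound with exponent \<alpha>.\<close>
      have "\<bar>u x - u y\<bar> \<le> \<bar>L\<bar> * dist x y powr \<alpha>"
        if u: "u \<in> U" and x: "x \<in> \<Omega> \<inter> ball x0 (min r (1 / 2))" and y: "y \<in> \<Omega> \<inter> ball x0 (min r (1 / 2))" for u x y
      proof -
        obtain \<delta> where "admissible_bounded k s F \<delta> K M \<Omega> u" using u by (auto simp: U_def)
        then have "\<bar>u x - u y\<bar> \<le> L * dist x y" using L x y by auto
        also have "\<dots> \<le> \<bar>L\<bar> * dist x y" by (intro mult_right_mono) auto
        also have "\<dots> \<le> \<bar>L\<bar> * dist x y powr \<alpha>"
        proof (rule mult_left_mono)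
          have "dist x y \<le> 1" using x y dist_triangle_less_add[of x x0 "1/2" y "1/2"] by (auto simp: dist_commute)
          then show "dist x y \<le> dist x y powr \<alpha>"
            using powr_mono'[of \<alpha> 1 "dist x y"] \<alpha> by simp
        qed simp
        finally show ?thesis .
      qed
      then show ?thesis using r by (intro exI[of _ "min r (1 / 2)"] exI[of _ "\<bar>L\<bar>"]) auto
    qed
  next
    show "compact (closure \<Omega>)" using \<Omega>(2) by (simp add: compact_closure)
  qed (use \<alpha> closure_subset in \<open>auto simp: U_def admissible_bounded_def\<close>)
  then obtain C where C: "\<And>u x y. u \<in> U \<Longrightarrow> x \<in> \<Omega> \<Longrightarrow> y \<in> \<Omega> \<Longrightarrow> \<bar>u x - u y\<bar> \<le> C * dist x y powr \<alpha>"
    by blast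
  have "hoelder_norm \<alpha> (closure \<Omega>) u \<le> ereal (M + C)"
    if \<delta>: "0 < \<delta>" "\<delta> < 1" and u: "admissible_bounded k s F \<delta> K M \<Omega> u" and cont: "continuous_on (closure \<Omega>) u" for \<delta> u
  proof (rule hoelder_norm_le)
    have "u \<in> U" using \<delta> u by (auto simp: U_def)
    then show "\<bar>u x - u y\<bar> \<le> C * dist x y powr \<alpha>" if "x \<in> closure \<Omega>" "y \<in> closure \<Omega>" for x y
      using holder_closure[OF cont \<alpha>(1) C that] by blast
    show "\<bar>u x\<bar> \<le> M" if "x \<in> closure \<Omega>" for x
    proof (rule continuous_le_on_closure[of \<Omega> "\<lambda>x. \<bar>u x\<bar>" x M])
      show "continuous_on (closure \<Omega>) (\<lambda>x. \<bar>u x\<bar>)" using cont by (intro continuous_intros)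
      show "\<bar>u y\<bar> \<le> M" if "y \<in> \<Omega>" for y using u that by (auto simp: admissible_bounded_def)
    qed (fact that)
  qed
  then show ?thesis using \<alpha> by blast
qed

theorem theorem3p3:
  fixes k :: nat and s K M :: real and \<Omega> :: "(real^'n::finite) set"
    and f :: "real^'n \<Rightarrow> real \<Rightarrow> real"
  assumes "1 \<le> k" and "k \<le> CARD('n)" and "s > -1"
    and "open \<Omega>" and "connected \<Omega>" and "bounded \<Omega>" and "0 \<in> \<Omega>"
    and "C3_boundary \<Omega>" and "strictly_k1_convex k \<Omega>"
    and "\<forall>x\<in>closure \<Omega>. \<forall>t. f x t \<ge> 0"
    and "\<exists>L. L-lipschitz_on (closure \<Omega> \<times> UNIV) (\<lambda>(x, t). f x t)"
  shows "\<exists>\<alpha>. 0 < \<alpha> \<and> \<alpha> < 1 \<and> (\<exists>C. \<forall>\<delta> \<phi> u.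
           0 < \<delta> \<and> \<delta> < 1 \<and>
           Ck_on 3 \<Omega> u \<and> C1_closure \<Omega> u \<and> k_admissible k \<Omega> u \<and>
           (\<forall>x\<in>\<Omega>. Sk k (hess u x) = ((norm x ^ 2 + \<delta> ^ 2) powr s * f x (u x)) ^ k) \<and>
           C11_on_boundary \<Omega> \<phi> \<and> (\<forall>x\<in>frontier \<Omega>. u x = \<phi> x) \<and>
           (\<forall>x\<in>\<Omega>. \<bar>u x\<bar> \<le> M) \<and>
           (\<forall>x\<in>\<Omega>. norm x * norm (grad u x) \<le> K)
           \<longrightarrow> hoelder_norm \<alpha> (closure \<Omega>) u \<le> ereal C)"
proof -
  obtain L where L: "L-lipschitz_on (closure \<Omega> \<times> UNIV) (\<lambda>(x, t). f x t)" using assms(11) by blast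
  have "0 \<le> L" using L by (simp add: lipschitz_on_def)
  obtain B where B: "\<And>x. x \<in> \<Omega> \<Longrightarrow> norm x \<le> B" using assms(6) by (auto simp: bounded_iff)
  have "0 \<le> B" using B[OF assms(7)] by simp
  define F where "F = \<bar>f 0 0\<bar> + L * (B + \<bar>M\<bar>)"
  have F: "0 \<le> F" using \<open>0 \<le> L\<close> \<open>0 \<le> B\<close> by (simp add: F_def)
  have fF: "f x t \<le> F" if x: "x \<in> \<Omega>" and t: "\<bar>t\<bar> \<le> M" for x t
  proof -
    have "x \<in> closure \<Omega>" "0 \<in> closure \<Omega>" using x assms(7) closure_subset by blast+
    then have "dist (f x t) (f 0 0) \<le> L * dist (x, t) (0, 0)"
      using lipschitz_onD[OF L, of "(x, t)" "(0, 0)"] by simp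
    also have "dist (x, t) (0, 0) = norm (x, t)" by (simp add: dist_Pair_Pair norm_Pair)
    also have "L * norm (x, t) \<le> L * (B + \<bar>M\<bar>)"
      using norm_Pair_le[of x t] B[OF x] t \<open>0 \<le> L\<close> by (intro mult_left_mono) auto
    finally show ?thesis unfolding F_def dist_real_def by linarith
  qed
  obtain \<alpha> C where \<alpha>: "0 < \<alpha>" "\<alpha> < 1"
    and C: "\<And>\<delta> u. 0 < \<delta> \<Longrightarrow> \<delta> < 1 \<Longrightarrow> admissible_bounded k s F \<delta> K M \<Omega> u \<Longrightarrow> continuous_on (closure \<Omega>) u
      \<Longrightarrow> hoelder_norm \<alpha> (closure \<Omega>) u \<le> ereal C"
    using admissible_bounded_hoelder_norm[OF assms(1,2,3,4,6,7,8) F, of K M] by blast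
  have "hoelder_norm \<alpha> (closure \<Omega>) u \<le> ereal C"
    if \<delta>: "0 < \<delta>" "\<delta> < 1" and adm: "k_admissible k \<Omega> u"
      and eq: "\<forall>x\<in>\<Omega>. Sk k (hess u x) = ((norm x ^ 2 + \<delta> ^ 2) powr s * f x (u x)) ^ k"
      and M: "\<forall>x\<in>\<Omega>. \<bar>u x\<bar> \<le> M" and K: "\<forall>x\<in>\<Omega>. norm x * norm (grad u x) \<le> K" for \<delta> u
  proof (rule C[OF \<delta>])
    have "Sk k (hess u x) \<le> ((x \<bullet> x + \<delta>\<^sup>2) powr s * F) ^ k" if x: "x \<in> \<Omega>" for x
    proof -
      have "f x (u x) \<le> F" "0 \<le> f x (u x)" using fF x M assms(10) closure_subset by blast+
      then have "((x \<bullet> x + \<delta>\<^sup>2) powr s * f x (u x)) ^ k \<le> ((x \<bullet> x + \<delta>\<^sup>2) powr s * F) ^ k"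
        by (intro power_mono mult_left_mono) auto
      then show ?thesis using eq x by (simp add: power2_norm_eq_inner)
    qed
    then show "admissible_bounded k s F \<delta> K M \<Omega> u"
      using adm M K unfolding admissible_bounded_def k_admissible_def by blast
    show "continuous_on (closure \<Omega>) u" using adm by (simp add: k_admissible_def)
  qed
  then show ?thesis using \<alpha> by blast
qed

end
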